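(* Let $G$ be a graph with a transitive unimodular closed automorphism group $\Gamma\subset\mathrm{Aut}(G)$. If $G\notin\mathcal{O}_{\mathbf{HD}}$, then there is some $p_0<1$ such that for every $\Gamma$-invariant bond percolation $\omega$ on $G$ with $\inf_{e\in E(G)}\mathbf{P}[e\in\omega]>p_0$, the following hold: with positive probability some component of $\omega$ is not in $\mathcal{O}_{\mathbf{HD}}$; and if moreover $\omega$ is ergodic and has indistinguishable components, then almost surely no infinite component of $\omega$ is in $\mathcal{O}_{\mathbf{HD}}$.
   Context: Graphs $G$ are connected and locally finite. $\mathrm{Aut}(G)$ has the topology of pointwise convergence; $\Gamma$ is transitive if it acts transitively on $V(G)$, and unimodular if its left Haar measure is also right invariant. A bond percolation on $G$ is a random subset $\omega$ of $E(G)$, identified with the random subgraph with vertex set $V(G)$ and edge set $\omega$; it is $\Gamma$-invariant if its law is invariant under each element of $\Gamma$, and ergodic if every $\Gamma$-invariant event has probability $0$ or $1$. A $\Gamma$-invariant bond percolation $\omega$ has indistinguishable components if for every measurable $\mathcal{A}\subset 2^{V(G)}\times2^{E(G)}$ invariant under the diagonal action of $\Gamma$, almost surely either $(C,\omega)\in\mathcal{A}$ for all infinite components $C$ of $\omega$, or $(C,\omega)\notin\mathcal{A}$ for all infinite components $C$ of $\omega$. For a connected locally finite graph $H$, a function $F:V(H)\to\mathbb{R}$ is harmonic if $F(x)=\sum_{y\sim x}F(y)/\deg_H x$ for all $x\in V(H)$, and Dirichlet if $\sum_x\sum_{y\sim x}|F(x)-F(y)|^2<\infty$. $\mathcal{O}_{\mathbf{HD}}$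 is the class of graphs that admit no nonconstant harmonic Dirichlet functions. *)

theory Defs
  imports "HOL-Algebra.Bij" "HOL-Algebra.Coset" "HOL-Probability.Probability"
begin

section \<open>Graphs\<close>

text \<open>
  A simple graph is a vertex set \<open>V\<close> with a set \<open>E\<close> of two-element subsets of \<open>V\<close>.
\<close>

definition simple_graph :: "'a set \<Rightarrow> 'a set set \<Rightarrow> bool" where
  "simple_graph V E \<longleftrightarrow> (\<forall>e\<in>E. \<exists>x\<in>V. \<exists>y\<in>V. x \<noteq> y \<and> e = {x, y})"

definition nbrs :: "'a set set \<Rightarrow> 'a \<Rightarrow> 'a set" where
  "nbrs E x = {y. {x, y} \<in> E}"

definition graph_component :: "'a set set \<Rightarrow> 'a \<Rightarrow> 'a set" where
  "graph_component E x = {y. (x, y) \<in> {(u, v). {u, v} \<in> E}\<^sup>*}"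

definition graph_components :: "'a set \<Rightarrow> 'a set set \<Rightarrow> 'a set set" where
  "graph_components V E = graph_component E ` V"

definition connected_graph :: "'a set \<Rightarrow> 'a set set \<Rightarrow> bool" where
  "connected_graph V E \<longleftrightarrow> V \<noteq> {} \<and> (\<forall>x\<in>V. \<forall>y\<in>V. y \<in> graph_component E x)"

definition locally_finite_graph :: "'a set \<Rightarrow> 'a set set \<Rightarrow> bool" where
  "locally_finite_graph V E \<longleftrightarrow> (\<forall>x\<in>V. finite (nbrs E x))"

definition clf_graph :: "'a set \<Rightarrow> 'a set set \<Rightarrow> bool" where
  "clf_graph V E \<longleftrightarrow> simple_graph V E \<and> connected_graph V E \<and> locally_finite_graph V E"

text \<open>The subgraph of \<open>(V, E)\<close> carried by the vertex set \<open>C\<close> of a component.\<close>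

definition component_graph :: "'a set set \<Rightarrow> 'a set \<Rightarrow> 'a set \<times> 'a set set" where
  "component_graph E C = (C, {e \<in> E. e \<subseteq> C})"


section \<open>Harmonic Dirichlet functions\<close>

definition harmonic :: "'a set \<Rightarrow> 'a set set \<Rightarrow> ('a \<Rightarrow> real) \<Rightarrow> bool" where
  "harmonic V E F \<longleftrightarrow> (\<forall>x\<in>V. F x = (\<Sum>y\<in>nbrs E x. F y) / real (card (nbrs E x)))"

definition dirichlet :: "'a set \<Rightarrow> 'a set set \<Rightarrow> ('a \<Rightarrow> real) \<Rightarrow> bool" where
  "dirichlet V E F \<longleftrightarrow> (\<lambda>x. \<Sum>y\<in>nbrs E x. \<bar>F x - F y\<bar>\<^sup>2) summable_on V"

text \<open>
  On a one-vertex graph the quotient in \<^const>\<open>harmonic\<close> is \<open>0 / 0 = 0\<close>; this is immaterial for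
  the following class, since every function on a single vertex is constant.
\<close>

definition O_HD :: "('a set \<times> 'a set set) set" where
  "O_HD = {(V, E). clf_graph V E \<and>
     (\<forall>F. harmonic V E F \<and> dirichlet V E F \<longrightarrow> F constant_on V)}"


section \<open>Automorphism groups\<close>

definition aut_group :: "'a set \<Rightarrow> 'a set set \<Rightarrow> ('a \<Rightarrow> 'a) monoid" where
  "aut_group V E = (BijGroup V)
     \<lparr>carrier := {g \<in> Bij V. \<forall>x\<in>V. \<forall>y\<in>V. {g x, g y} \<in> E \<longleftrightarrow> {x, y} \<in> E}\<rparr>"

text \<open>
  Pointwise convergence with \<open>V\<close> discrete. Elements of \<^const>\<open>Bij\<close> are extensional, hence
  points of the product space.
\<close>

definition aut_topology :: "'a set \<Rightarrow> 'a set set \<Rightarrow> ('a \<Rightarrow> 'a) topology" where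
  "aut_topology V E =
     subtopology (product_topology (\<lambda>_. discrete_topology V) V) (carrier (aut_group V E))"

definition closed_aut_subgroup :: "'a set \<Rightarrow> 'a set set \<Rightarrow> ('a \<Rightarrow> 'a) set \<Rightarrow> bool" where
  "closed_aut_subgroup V E \<Gamma> \<longleftrightarrow>
     subgroup \<Gamma> (aut_group V E) \<and> closedin (aut_topology V E) \<Gamma>"

definition transitive_on :: "'a set \<Rightarrow> ('a \<Rightarrow> 'a) set \<Rightarrow> bool" where
  "transitive_on V \<Gamma> \<longleftrightarrow> (\<forall>x\<in>V. \<forall>y\<in>V. \<exists>g\<in>\<Gamma>. g x = y)"

text \<open>
  A closed subgroup of the automorphism group of a connected locally finite graph is locally
  compact, Hausdorff and second countable, so a Borel measure on it that is finite on compact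
  sets is automatically regular, and regularity is not listed below.
\<close>

definition left_haar_measure :: "('g, 'b) monoid_scheme \<Rightarrow> 'g topology \<Rightarrow> 'g measure \<Rightarrow> bool" where
  "left_haar_measure G T \<mu> \<longleftrightarrow>
     space \<mu> = carrier G \<and>
     sets \<mu> = sigma_sets (carrier G) {U. openin T U} \<and>
     emeasure \<mu> (carrier G) \<noteq> 0 \<and>
     (\<forall>K. compactin T K \<longrightarrow> emeasure \<mu> K < \<infinity>) \<and>
     (\<forall>g\<in>carrier G. \<forall>A\<in>sets \<mu>. emeasure \<mu> (g <#\<^bsub>G\<^esub> A) = emeasure \<mu> A)"

definition right_invariant :: "('g, 'b) monoid_scheme \<Rightarrow> 'g measure \<Rightarrow> bool" where
  "right_invariant G \<mu> \<longleftrightarrow>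
     (\<forall>g\<in>carrier G. \<forall>A\<in>sets \<mu>. emeasure \<mu> (A #>\<^bsub>G\<^esub> g) = emeasure \<mu> A)"

text \<open>
  Left Haar measure exists and is unique up to a positive factor, so ``the left Haar
  measure is right invariant'' is the same as ``some left Haar measure is right invariant''.
\<close>

definition unimodular :: "'a set \<Rightarrow> 'a set set \<Rightarrow> ('a \<Rightarrow> 'a) set \<Rightarrow> bool" where
  "unimodular V E \<Gamma> \<longleftrightarrow>
     (\<exists>\<mu>. left_haar_measure ((aut_group V E)\<lparr>carrier := \<Gamma>\<rparr>) (subtopology (aut_topology V E) \<Gamma>) \<mu> \<and>
          right_invariant ((aut_group V E)\<lparr>carrier := \<Gamma>\<rparr>) \<mu>)"


section \<open>Bond percolation\<close>

text \<open>The power set \<open>2\<^sup>X\<close> with the product \<open>\<sigma>\<close>-algebra.\<close>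

definition subset_space :: "'x set \<Rightarrow> 'x set measure" where
  "subset_space X = sigma (Pow X) ((\<lambda>x. {S \<in> Pow X. x \<in> S}) ` X)"

definition act_edges :: "('a \<Rightarrow> 'a) \<Rightarrow> 'a set set \<Rightarrow> 'a set set" where
  "act_edges g \<omega> = (\<lambda>e. g ` e) ` \<omega>"

text \<open>
  A bond percolation is given by its law \<open>P\<close> on \<open>2\<^sup>E\<close>, the percolation itself being the
  identity map; every notion below depends only on the law.
\<close>

definition bond_percolation :: "'a set set \<Rightarrow> 'a set set measure \<Rightarrow> bool" where
  "bond_percolation E P \<longleftrightarrow> prob_space P \<and> sets P = sets (subset_space E)"

definition invariant_percolation ::
  "'a set set \<Rightarrow> ('a \<Rightarrow> 'a) set \<Rightarrow> 'a set set measure \<Rightarrow> bool" where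
  "invariant_percolation E \<Gamma> P \<longleftrightarrow>
     bond_percolation E P \<and> (\<forall>g\<in>\<Gamma>. distr P (subset_space E) (act_edges g) = P)"

definition ergodic_percolation :: "('a \<Rightarrow> 'a) set \<Rightarrow> 'a set set measure \<Rightarrow> bool" where
  "ergodic_percolation \<Gamma> P \<longleftrightarrow>
     (\<forall>A\<in>sets P. (\<forall>g\<in>\<Gamma>. act_edges g ` A = A) \<longrightarrow> measure P A = 0 \<or> measure P A = 1)"

definition indistinguishable_components ::
  "'a set \<Rightarrow> 'a set set \<Rightarrow> ('a \<Rightarrow> 'a) set \<Rightarrow> 'a set set measure \<Rightarrow> bool" where
  "indistinguishable_components V E \<Gamma> P \<longleftrightarrow>
     (\<forall>\<A>\<in>sets (subset_space V \<Otimes>\<^sub>M subset_space E).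
        (\<forall>g\<in>\<Gamma>. (\<lambda>(C, \<omega>). (g ` C, act_edges g \<omega>)) ` \<A> = \<A>) \<longrightarrow>
        (AE \<omega> in P.
           (\<forall>C\<in>graph_components V \<omega>. infinite C \<longrightarrow> (C, \<omega>) \<in> \<A>) \<or>
           (\<forall>C\<in>graph_components V \<omega>. infinite C \<longrightarrow> (C, \<omega>) \<notin> \<A>)))"

end

theory Submission
  imports Defs "HOL-Library.Diagonal_Subsequence"
begin

text \<open>
  The proof compares two effective resistances between the endpoints of an edge.

  Let \<open>\<Delta>\<close> be the graph Laplacian of a graph of bounded degree and let \<open>g = (\<Delta> + \<epsilon>)\<^sup>-\<^sup>1\<close> be
  the Green function of the walk killed at rate \<open>\<epsilon> > 0\<close>. Put
  \<open>r(x, y) = g(x, x) + g(y, y) - 2 g(x, y)\<close>. When \<open>\<epsilon>\<close> decreases to \<open>0\<close> the number \<open>r(x, y)\<close>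
  increases to the wired effective resistance, which is the supremum of
  \<open>(u x - u y)\<^sup>2 / energy u\<close> over square-summable \<open>u\<close>; the free effective resistance is the
  same supremum over all \<open>u\<close> of finite energy.

  The wired resistances have a universal average. The equation \<open>(\<Delta> + \<epsilon>) g(\<cdot>, x) = \<delta>\<^sub>x\<close> at \<open>x\<close>
  reads \<open>(\<Sum>y \<sim> x. g(x, x) - g(x, y)) = 1 - \<epsilon> g(x, x)\<close>, and \<open>r(x, y)\<close> is the sum of
  \<open>g(x, x) - g(x, y)\<close> and the same quantity with \<open>x\<close> and \<open>y\<close> exchanged. By the mass-transport
  principle, which is where unimodularity enters, both summands contribute equally in
  expectation. Hence for every invariant percolation the expected sum of \<open>r\<close> over the open edges
  at a vertex is \<open>2 (1 - \<epsilon> E g(x, x)) \<le> 2\<close> (\<open>expected_resistance_sum\<close>), and on the infinite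
  graph \<open>G\<close> itself the sum tends to \<open>2\<close> (\<open>resistance_sum\<close>, \<open>killed_green_tendsto_0\<close>). In terms
  of random spanning forests: the wired uniform spanning forest has expected degree \<open>2\<close>.

  A harmonic Dirichlet function \<open>h\<close> on \<open>G\<close> raises the free resistance of \<open>xy\<close> above the wired one
  by at least \<open>(h x - h y)\<^sup>2 / energy h\<close> (\<open>free_resistance_lower_bound\<close>). If \<open>h\<close> is not constant,
  there is a vertex \<open>x\<close> at which the free resistances in \<open>G\<close> of the edges at \<open>x\<close> add up to at least
  \<open>2 + c\<close> with \<open>c > 0\<close>. Deleting edges lowers energies, so it can only increase free resistances.
  On the other hand, if almost surely no component of the percolation \<open>\<omega>\<close> carries a nonconstant
  harmonic Dirichlet function, then free and wired resistances in \<open>\<omega>\<close> agree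
  (\<open>liouville_free_le_wired\<close>). So if every edge is open with probability at least \<open>q\<close>, then
  \<open>q (2 + c) \<le> 2\<close> (\<open>liouville_percolation_marginals\<close>), and \<open>p0 = 2 / (2 + c)\<close> has the first
  asserted property.

  For the second one, a component lies outside the class \<open>O_HD\<close> if and only if some open edge in it
  has endpoints at which a harmonic function of finite energy takes different values
  (\<open>component_not_O_HD_iff\<close>). For a fixed edge this is, by compactness, a countable combination of
  events that depend on finitely many edges (\<open>separates_measurable\<close>). So the event that some
  component is outside \<open>O_HD\<close> is measurable and invariant, and by ergodicity it has probability
  one. Such a component is infinite, and indistinguishability passes the property on to all infinite
  components.
\<close>

section \<open>Square-summable functions\<close>

text \<open>
  The general form of the Cauchy-Schwarz argument: a nonnegative quadratic polynomial has
  nonpositive discriminant. It serves for bilinear forms and for the first variation at a minimiser.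
\<close>

lemma discriminant_bound:
  fixes a b c :: real
  assumes "\<And>t. 0 \<le> a + 2 * t * b + t\<^sup>2 * c" and "0 \<le> c"
  shows "b\<^sup>2 \<le> a * c"
proof (cases "c = 0")
  case True
  have "b = 0"
  proof (rule ccontr)
    assume "b \<noteq> 0"
    with assms(1)[of "- (a + 1) / (2 * b)"] True show False
      by (simp add: field_simps)
  qed
  then show ?thesis using True by simp
next
  case False
  with assms(2) have gt: "c > 0" by linarith
  \<comment> \<open>The minimum of the polynomial.\<close>
  let ?t = "- b / c"
  have "0 \<le> c * (a + 2 * ?t * b + ?t\<^sup>2 * c)"
    by (intro mult_nonneg_nonneg assms)
  also have "\<dots> = a * c - b\<^sup>2"
    using gt by (simp add: power2_eq_square field_simps)
  finally show ?thesis by simp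
qed

definition sq_summable :: "'b set \<Rightarrow> ('b \<Rightarrow> real) \<Rightarrow> bool" where
  "sq_summable S f \<longleftrightarrow> (\<lambda>i. (f i)\<^sup>2) summable_on S"

definition inner_on :: "'b set \<Rightarrow> ('b \<Rightarrow> real) \<Rightarrow> ('b \<Rightarrow> real) \<Rightarrow> real" where
  "inner_on S f g = (\<Sum>\<^sub>\<infinity>i\<in>S. f i * g i)"

lemma summable_on_bounded_by:
  fixes f g :: "'b \<Rightarrow> real"
  assumes "f summable_on S" and "\<And>i. i \<in> S \<Longrightarrow> \<bar>g i\<bar> \<le> f i"
  shows "g summable_on S"
proof -
  have "(\<lambda>i. norm (g i)) summable_on S"
    by (rule summable_on_comparison_test[OF assms(1)]) (use assms(2) in auto)
  then show ?thesis
    by (rule abs_summable_summable)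
qed

lemma sq_summable_mult:
  assumes "sq_summable S f" and "sq_summable S g"
  shows "(\<lambda>i. f i * g i) summable_on S"
proof (rule summable_on_bounded_by)
  show "(\<lambda>i. (f i)\<^sup>2 + (g i)\<^sup>2) summable_on S"
    using assms unfolding sq_summable_def by (rule summable_on_add)
  show "\<bar>f i * g i\<bar> \<le> (f i)\<^sup>2 + (g i)\<^sup>2" for i
  proof -
    have "2 * \<bar>f i\<bar> * \<bar>g i\<bar> \<le> (f i)\<^sup>2 + (g i)\<^sup>2"
      using sum_squares_bound[of "\<bar>f i\<bar>" "\<bar>g i\<bar>"] by simp
    moreover have "0 \<le> \<bar>f i\<bar> * \<bar>g i\<bar>"
      by simp
    ultimately show ?thesis
      unfolding abs_mult by linarith
  qed
qed

lemma sq_summable_cong: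
  assumes "\<And>i. i \<in> S \<Longrightarrow> f i = g i"
  shows "sq_summable S f \<longleftrightarrow> sq_summable S g"
  unfolding sq_summable_def by (rule summable_on_cong) (simp add: assms)

lemma inner_on_cong:
  assumes "\<And>i. i \<in> S \<Longrightarrow> f i = f' i" "\<And>i. i \<in> S \<Longrightarrow> g i = g' i"
  shows "inner_on S f g = inner_on S f' g'"
  unfolding inner_on_def by (rule infsum_cong) (simp add: assms)

lemma sq_summable_axpy:
  assumes "sq_summable S f" and "sq_summable S g"
  shows "sq_summable S (\<lambda>i. f i + t * g i)"
proof -
  have "(\<lambda>i. (f i)\<^sup>2 + (2 * t) * (f i * g i) + t\<^sup>2 * (g i)\<^sup>2) summable_on S"
    using assms sq_summable_mult[OF assms]
    by (intro summable_on_add summable_on_cmult_right) (auto simp: sq_summable_def)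
  moreover have "(f i)\<^sup>2 + (2 * t) * (f i * g i) + t\<^sup>2 * (g i)\<^sup>2 = (f i + t * g i)\<^sup>2" for i
    by (simp add: power2_eq_square algebra_simps)
  ultimately show ?thesis
    unfolding sq_summable_def by simp
qed

lemma sq_summable_diff:
  assumes "sq_summable S f" and "sq_summable S g"
  shows "sq_summable S (\<lambda>i. f i - g i)"
  using sq_summable_axpy[OF assms, of "-1"] by simp

lemma inner_on_commute: "inner_on S f g = inner_on S g f"
  unfolding inner_on_def by (simp add: mult.commute)

lemma inner_on_axpy:
  assumes "sq_summable S f" "sq_summable S g" "sq_summable S h"
  shows "inner_on S (\<lambda>i. f i + t * g i) h = inner_on S f h + t * inner_on S g h"
proof -
  have "inner_on S (\<lambda>i. f i + t * g i) h = (\<Sum>\<^sub>\<infinity>i\<in>S. f i * h i + t * (g i * h i))"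
    unfolding inner_on_def by (rule infsum_cong) (simp add: algebra_simps)
  also have "\<dots> = inner_on S f h + (\<Sum>\<^sub>\<infinity>i\<in>S. t * (g i * h i))"
    unfolding inner_on_def
    by (intro infsum_add summable_on_cmult_right sq_summable_mult assms)
  also have "(\<Sum>\<^sub>\<infinity>i\<in>S. t * (g i * h i)) = t * inner_on S g h"
    unfolding inner_on_def by (intro infsum_cmult_right sq_summable_mult assms)
  finally show ?thesis .
qed

lemma inner_on_diff_right:
  assumes "sq_summable S f" "sq_summable S g" "sq_summable S h"
  shows "inner_on S h (\<lambda>i. f i - g i) = inner_on S h f - inner_on S h g"
  using inner_on_axpy[OF assms, of "-1"] by (simp add: inner_on_commute[of S h])

lemma inner_on_axpy_self:
  assumes "sq_summable S f" "sq_summable S g"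
  shows "inner_on S (\<lambda>i. f i + t * g i) (\<lambda>i. f i + t * g i)
    = inner_on S f f + 2 * t * inner_on S f g + t\<^sup>2 * inner_on S g g"
proof -
  have s: "sq_summable S (\<lambda>i. f i + t * g i)"
    by (rule sq_summable_axpy[OF assms])
  have "inner_on S (\<lambda>i. f i + t * g i) (\<lambda>i. f i + t * g i)
      = inner_on S f (\<lambda>i. f i + t * g i) + t * inner_on S g (\<lambda>i. f i + t * g i)"
    by (rule inner_on_axpy[OF assms s])
  moreover have "inner_on S f (\<lambda>i. f i + t * g i) = inner_on S f f + t * inner_on S f g"
    using inner_on_axpy[OF assms assms(1), of t] by (simp add: inner_on_commute)
  moreover have "inner_on S g (\<lambda>i. f i + t * g i) = inner_on S f g + t * inner_on S g g"
    using inner_on_axpy[OF assms assms(2), of t] by (simp add: inner_on_commute)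
  ultimately show ?thesis
    by (simp add: algebra_simps power2_eq_square)
qed

lemma inner_on_nonneg: "0 \<le> inner_on S f f"
  unfolding inner_on_def by (rule infsum_nonneg) simp

lemma sum_sq_le_inner_on:
  assumes "sq_summable S f" "finite A" "A \<subseteq> S"
  shows "(\<Sum>i\<in>A. (f i)\<^sup>2) \<le> inner_on S f f"
  using finite_sum_le_infsum[of "\<lambda>i. (f i)\<^sup>2" S A] assms
  unfolding sq_summable_def inner_on_def by (simp add: power2_eq_square)

lemma inner_on_Cauchy_Schwarz:
  assumes "sq_summable S f" "sq_summable S g"
  shows "(inner_on S f g)\<^sup>2 \<le> inner_on S f f * inner_on S g g"
proof (rule discriminant_bound)
  show "0 \<le> inner_on S f f + 2 * t * inner_on S f g + t\<^sup>2 * inner_on S g g" for t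
    unfolding inner_on_axpy_self[OF assms, symmetric] by (rule inner_on_nonneg)
qed (rule inner_on_nonneg)

text \<open>
  Only finite partial sums pass to a pointwise limit; bounding all of them by \<open>M\<close> yields both
  summability and the bound on the limit.
\<close>

lemma inner_on_Fatou:
  assumes conv: "\<And>i. i \<in> S \<Longrightarrow> (\<lambda>n. f n i) \<longlonglongrightarrow> g i"
    and sq: "\<And>n. sq_summable S (f n)"
    and bd: "\<forall>\<^sub>F n in sequentially. inner_on S (f n) (f n) \<le> M"
  shows "sq_summable S g" and "inner_on S g g \<le> M"
proof -
  have fin: "(\<Sum>i\<in>A. (g i)\<^sup>2) \<le> M" if A: "finite A" "A \<subseteq> S" for A
  proof (rule tendsto_upperbound)
    show "(\<lambda>n. \<Sum>i\<in>A. (f n i)\<^sup>2) \<longlonglongrightarrow> (\<Sum>i\<in>A. (g i)\<^sup>2)"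
      using A by (intro tendsto_intros conv) auto
    show "\<forall>\<^sub>F n in sequentially. (\<Sum>i\<in>A. (f n i)\<^sup>2) \<le> M"
      using bd by eventually_elim (rule order_trans[OF sum_sq_le_inner_on[OF sq A]])
  qed simp
  show s: "sq_summable S g"
    unfolding sq_summable_def
    by (rule nonneg_bdd_above_summable_on) (use fin in \<open>auto intro!: bdd_aboveI2\<close>)
  show "inner_on S g g \<le> M"
    unfolding inner_on_def power2_eq_square[symmetric]
    by (rule infsum_le_finite_sums) (use s fin in \<open>auto simp: sq_summable_def\<close>)
qed

section \<open>Energy and the Laplacian\<close>

definition oriented_edges :: "'a set set \<Rightarrow> ('a \<times> 'a) set" where
  "oriented_edges E = {(x, y). {x, y} \<in> E}"

definition grad :: "('a \<Rightarrow> real) \<Rightarrow> 'a \<times> 'a \<Rightarrow> real" where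
  "grad u = (\<lambda>e. u (fst e) - u (snd e))"

text \<open>
  Every edge contributes two oriented edges; the division by two undoes this.
\<close>

definition energy :: "'a set set \<Rightarrow> ('a \<Rightarrow> real) \<Rightarrow> ('a \<Rightarrow> real) \<Rightarrow> real" where
  "energy E u v = inner_on (oriented_edges E) (grad u) (grad v) / 2"

definition laplacian :: "'a set set \<Rightarrow> ('a \<Rightarrow> real) \<Rightarrow> 'a \<Rightarrow> real" where
  "laplacian E u x = (\<Sum>y\<in>nbrs E x. u x - u y)"

lemma grad_axpy: "grad (\<lambda>x. u x + t * v x) = (\<lambda>e. grad u e + t * grad v e)"
  by (simp add: grad_def algebra_simps)

lemma grad_diff: "grad (\<lambda>x. u x - v x) = (\<lambda>e. grad u e - grad v e)"
  by (simp add: grad_def algebra_simps)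

lemma energy_commute: "energy E u v = energy E v u"
  by (simp add: energy_def inner_on_commute)

lemma energy_nonneg: "0 \<le> energy E u u"
  by (simp add: energy_def inner_on_nonneg)

text \<open>
  The condition is kept apart from \<^const>\<open>energy\<close> because an infinite sum that diverges has the value \<open>0\<close>.
\<close>

definition finite_energy :: "'a set set \<Rightarrow> ('a \<Rightarrow> real) \<Rightarrow> bool" where
  "finite_energy E u \<longleftrightarrow> sq_summable (oriented_edges E) (grad u)"

lemma finite_energy_axpy:
  "finite_energy E u \<Longrightarrow> finite_energy E v \<Longrightarrow> finite_energy E (\<lambda>x. u x + t * v x)"
  unfolding finite_energy_def grad_axpy by (rule sq_summable_axpy)

lemma finite_energy_diff:
  "finite_energy E u \<Longrightarrow> finite_energy E v \<Longrightarrow> finite_energy E (\<lambda>x. u x - v x)"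
  unfolding finite_energy_def grad_diff by (rule sq_summable_diff)

lemma energy_diff_right:
  assumes "finite_energy E u" "finite_energy E v" "finite_energy E f"
  shows "energy E f (\<lambda>x. u x - v x) = energy E f u - energy E f v"
  using inner_on_diff_right[of "oriented_edges E" "grad u" "grad v" "grad f"] assms
  unfolding energy_def finite_energy_def grad_diff by (simp add: field_simps)

lemma energy_axpy_self:
  assumes "finite_energy E u" "finite_energy E v"
  shows "energy E (\<lambda>x. u x + t * v x) (\<lambda>x. u x + t * v x)
    = energy E u u + 2 * t * energy E u v + t\<^sup>2 * energy E v v"
  using inner_on_axpy_self[of "oriented_edges E" "grad u" "grad v" t] assms
  unfolding energy_def finite_energy_def grad_axpy by (simp add: field_simps)

lemma energy_Cauchy_Schwarz:
  assumes "finite_energy E u" "finite_energy E v"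
  shows "(energy E u v)\<^sup>2 \<le> energy E u u * energy E v v"
  using inner_on_Cauchy_Schwarz[of "oriented_edges E" "grad u" "grad v"] assms
  unfolding energy_def finite_energy_def by (simp add: power2_eq_square field_simps)

text \<open>
  Only differences along edges need to converge, so the functions may drift by constants that depend
  on the component.
\<close>

lemma energy_Fatou:
  assumes conv: "\<And>x y. {x, y} \<in> E \<Longrightarrow> (\<lambda>n. f n x - f n y) \<longlonglongrightarrow> g x - g y"
    and fe: "\<And>n. finite_energy E (f n)"
    and bd: "\<forall>\<^sub>F n in sequentially. energy E (f n) (f n) \<le> M"
  shows "finite_energy E g" and "energy E g g \<le> M"
proof -
  have c: "\<And>e. e \<in> oriented_edges E \<Longrightarrow> (\<lambda>n. grad (f n) e) \<longlonglongrightarrow> grad g e"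
    using conv by (auto simp: oriented_edges_def grad_def)
  have b: "\<forall>\<^sub>F n in sequentially. inner_on (oriented_edges E) (grad (f n)) (grad (f n)) \<le> 2 * M"
    using bd by eventually_elim (simp add: energy_def)
  note F = inner_on_Fatou[OF c fe[unfolded finite_energy_def] b]
  show "finite_energy E g" "energy E g g \<le> M"
    using F by (auto simp: finite_energy_def energy_def)
qed

lemma sq_diff_le_energy:
  assumes "finite_energy E u" "{x, y} \<in> E" "x \<noteq> y"
  shows "(u x - u y)\<^sup>2 \<le> energy E u u"
proof -
  have "(\<Sum>e\<in>{(x, y), (y, x)}. (grad u e)\<^sup>2) \<le> inner_on (oriented_edges E) (grad u) (grad u)"
    using assms by (intro sum_sq_le_inner_on)
      (auto simp: finite_energy_def oriented_edges_def insert_commute)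
  then show ?thesis
    using assms(3) by (simp add: grad_def energy_def power2_commute[of "u y"])
qed

text \<open>
  This is Rayleigh monotonicity in the form in which it is used: passing to a subgraph keeps the
  potential difference of \<open>u\<close> and lowers its energy.
\<close>

lemma energy_mono_edges:
  assumes "F \<subseteq> E" "finite_energy E u"
  shows "finite_energy F u" and "energy F u u \<le> energy E u u"
proof -
  have sub: "oriented_edges F \<subseteq> oriented_edges E"
    using assms(1) by (auto simp: oriented_edges_def)
  show s: "finite_energy F u"
    using assms(2) summable_on_subset_banach[OF _ sub]
    unfolding finite_energy_def sq_summable_def by blast
  show "energy F u u \<le> energy E u u"
    unfolding energy_def inner_on_def power2_eq_square[symmetric]
    using s assms(2) sub
    by (auto intro!: infsum_mono_neutral simp: finite_energy_def sq_summable_def)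
qed

locale bounded_degree_graph =
  fixes V :: "'a set" and E :: "'a set set" and D :: real
  assumes simple: "simple_graph V E"
    and finite_nbrs: "x \<in> V \<Longrightarrow> finite (nbrs E x)"
    and degree_le: "x \<in> V \<Longrightarrow> real (card (nbrs E x)) \<le> D"
    and D_pos: "D > 0"
begin

lemma edgeD:
  assumes "{x, y} \<in> E" shows "x \<in> V" "y \<in> V" "x \<noteq> y"
  using assms simple unfolding simple_graph_def by (fastforce simp: doubleton_eq_iff)+

lemma nbrs_subset: "nbrs E x \<subseteq> V"
  using edgeD by (auto simp: nbrs_def)

lemma oriented_edges_Sigma: "oriented_edges E = Sigma V (nbrs E)"
  using edgeD by (auto simp: oriented_edges_def nbrs_def)

lemma swap_oriented_edges: "bij_betw prod.swap (oriented_edges E) (oriented_edges E)"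
  by (rule bij_betwI[where g = prod.swap]) (auto simp: oriented_edges_def insert_commute)

lemma summable_on_oriented_edges:
  fixes f :: "'a \<times> 'a \<Rightarrow> real"
  assumes "\<And>e. 0 \<le> f e"
  shows "f summable_on oriented_edges E \<longleftrightarrow> (\<lambda>x. \<Sum>y\<in>nbrs E x. f (x, y)) summable_on V"
proof -
  have "infsum (\<lambda>y. f (x, y)) (nbrs E x) = (\<Sum>y\<in>nbrs E x. f (x, y))" if "x \<in> V" for x
    using finite_nbrs[OF that] by simp
  then have eq: "(\<lambda>x. infsum (\<lambda>y. f (x, y)) (nbrs E x)) summable_on V
      \<longleftrightarrow> (\<lambda>x. \<Sum>y\<in>nbrs E x. f (x, y)) summable_on V"
    by (intro summable_on_cong)
  show ?thesis
  proof
    assume "f summable_on oriented_edges E"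
    then show "(\<lambda>x. \<Sum>y\<in>nbrs E x. f (x, y)) summable_on V"
      unfolding eq[symmetric] oriented_edges_Sigma
      using summable_on_Sigma_banach[of "\<lambda>x y. f (x, y)" V "nbrs E"] by simp
  next
    assume *: "(\<lambda>x. \<Sum>y\<in>nbrs E x. f (x, y)) summable_on V"
    show "f summable_on oriented_edges E"
      unfolding oriented_edges_Sigma
      by (rule summable_on_SigmaI[OF has_sum_finite *]) (use finite_nbrs assms in auto)
  qed
qed

lemma infsum_oriented_edges:
  fixes f :: "'a \<times> 'a \<Rightarrow> real"
  assumes "f summable_on oriented_edges E"
  shows "infsum f (oriented_edges E) = (\<Sum>\<^sub>\<infinity>x\<in>V. \<Sum>y\<in>nbrs E x. f (x, y))"
proof -
  have "infsum f (oriented_edges E) = (\<Sum>\<^sub>\<infinity>x\<in>V. \<Sum>\<^sub>\<infinity>y\<in>nbrs E x. f (x, y))"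
    using infsum_Sigma_banach[of f V "nbrs E"] assms by (simp add: oriented_edges_Sigma)
  also have "\<dots> = (\<Sum>\<^sub>\<infinity>x\<in>V. \<Sum>y\<in>nbrs E x. f (x, y))"
    by (rule infsum_cong) (simp add: finite_nbrs)
  finally show ?thesis .
qed

lemma dirichlet_iff_finite_energy: "dirichlet V E u \<longleftrightarrow> finite_energy E u"
  using summable_on_oriented_edges[of "\<lambda>e. (grad u e)\<^sup>2"]
  by (simp add: dirichlet_def finite_energy_def sq_summable_def grad_def)

lemma swap_summable:
  fixes f :: "'a \<times> 'a \<Rightarrow> real"
  shows "(\<lambda>e. f (prod.swap e)) summable_on oriented_edges E \<longleftrightarrow> f summable_on oriented_edges E"
  by (rule summable_on_reindex_bij_betw[OF swap_oriented_edges])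

lemma swap_infsum:
  fixes f :: "'a \<times> 'a \<Rightarrow> real"
  shows "infsum (\<lambda>e. f (prod.swap e)) (oriented_edges E) = infsum f (oriented_edges E)"
  by (rule infsum_reindex_bij_betw[OF swap_oriented_edges])

lemma summable_on_source:
  fixes f :: "'a \<Rightarrow> real"
  assumes "f summable_on V" "\<And>x. x \<in> V \<Longrightarrow> 0 \<le> f x"
  shows "(\<lambda>e. f (fst e)) summable_on oriented_edges E"
proof -
  have "(\<lambda>x. \<Sum>y\<in>nbrs E x. \<bar>f x\<bar>) summable_on V"
  proof (rule summable_on_bounded_by[OF summable_on_cmult_right[OF assms(1), of D]])
    show "\<bar>\<Sum>y\<in>nbrs E x. \<bar>f x\<bar>\<bar> \<le> D * f x" if "x \<in> V" for x
      using assms(2)[OF that] mult_right_mono[OF degree_le[OF that]] by simp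
  qed
  then have "(\<lambda>e. \<bar>f (fst e)\<bar>) summable_on oriented_edges E"
    using summable_on_oriented_edges[of "\<lambda>e. \<bar>f (fst e)\<bar>"] by (simp only: abs_ge_zero fst_conv)
  moreover have "(\<lambda>e. \<bar>f (fst e)\<bar>) summable_on oriented_edges E
      \<longleftrightarrow> (\<lambda>e. f (fst e)) summable_on oriented_edges E"
    by (rule summable_on_cong) (use assms(2) edgeD in \<open>auto simp: oriented_edges_def\<close>)
  ultimately show ?thesis by simp
qed

lemma sq_summable_source:
  assumes "sq_summable V v"
  shows "sq_summable (oriented_edges E) (\<lambda>e. v (fst e))"
  using summable_on_source[of "\<lambda>x. (v x)\<^sup>2"] assms
  by (simp add: sq_summable_def)

lemma sq_summable_target:
  assumes "sq_summable V v"
  shows "sq_summable (oriented_edges E) (\<lambda>e. v (snd e))"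
  using swap_summable[THEN iffD2, OF sq_summable_source[OF assms, unfolded sq_summable_def]]
  by (simp add: sq_summable_def)

lemma sq_summable_finite_energy:
  assumes "sq_summable V v" shows "finite_energy E v"
  using sq_summable_diff[OF sq_summable_source[OF assms] sq_summable_target[OF assms]]
  by (simp add: finite_energy_def grad_def)

text \<open>
  Summation by parts. Square summability of \<open>v\<close> together with bounded degree makes
  \<open>v x * (u x - u y)\<close> absolutely summable over the oriented edges, and reversing all edges turns the
  energy into twice that sum.
\<close>

lemma Green_identity:
  assumes v: "sq_summable V v" and u: "finite_energy E u"
  shows "energy E v u = inner_on V v (laplacian E u)"
proof -
  let ?O = "oriented_edges E"
  define f where "f = (\<lambda>e. v (fst e) * (u (fst e) - u (snd e)))"
  have s1: "f summable_on ?O"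
    using sq_summable_mult[OF sq_summable_source[OF v] u[unfolded finite_energy_def]]
    by (simp add: grad_def f_def)
  have s2: "(\<lambda>e. f (prod.swap e)) summable_on ?O"
    using s1 by (simp add: swap_summable)
  have "inner_on ?O (grad v) (grad u) = (\<Sum>\<^sub>\<infinity>e\<in>?O. f e + f (prod.swap e))"
    unfolding inner_on_def by (rule infsum_cong) (simp add: grad_def f_def algebra_simps)
  also have "\<dots> = infsum f ?O + infsum (\<lambda>e. f (prod.swap e)) ?O"
    by (rule infsum_add[OF s1 s2])
  also have "\<dots> = 2 * infsum f ?O"
    by (simp add: swap_infsum)
  also have "infsum f ?O = inner_on V v (laplacian E u)"
    unfolding infsum_oriented_edges[OF s1] inner_on_def laplacian_def
    by (rule infsum_cong) (simp add: sum_distrib_left f_def)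
  finally show ?thesis by (simp add: energy_def)
qed

end

section \<open>The Green function of the Laplacian with killing\<close>

text \<open>
  One step of the lazy walk that leaves along each edge with probability \<open>1 / D\<close> and otherwise stays.
  Since no degree exceeds \<open>D\<close>, it preserves nonnegativity, and it preserves total mass.
\<close>

definition lazy_step :: "'a set set \<Rightarrow> real \<Rightarrow> ('a \<Rightarrow> real) \<Rightarrow> 'a \<Rightarrow> real" where
  "lazy_step E D f x = f x - laplacian E f x / D"

definition lazy_walk :: "'a set set \<Rightarrow> real \<Rightarrow> 'a \<Rightarrow> nat \<Rightarrow> 'a \<Rightarrow> real" where
  "lazy_walk E D y k = (lazy_step E D ^^ k) (indicator {y})"

text \<open>
  The Neumann series of \<open>(\<Delta> + \<epsilon>)\<^sup>-\<^sup>1\<close>: writing \<open>K\<close> for the lazy step, \<open>\<Delta> = D (1 - K)\<close>, so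
  \<open>\<Delta> + \<epsilon> = (D + \<epsilon>) (1 - D / (D + \<epsilon>) K)\<close>. An explicit series is chosen over an abstract inverse
  because it makes measurability in the graph and equivariance under automorphisms immediate.
\<close>

definition green :: "'a set set \<Rightarrow> real \<Rightarrow> real \<Rightarrow> 'a \<Rightarrow> 'a \<Rightarrow> real" where
  "green E D \<epsilon> y x = (\<Sum>k. (D / (D + \<epsilon>)) ^ Suc k / D * lazy_walk E D y k x)"

definition dipole :: "'a set set \<Rightarrow> real \<Rightarrow> real \<Rightarrow> 'a \<Rightarrow> 'a \<Rightarrow> 'a \<Rightarrow> real" where
  "dipole E D \<epsilon> x y z = green E D \<epsilon> x z - green E D \<epsilon> y z"

text \<open>
  The potential difference produced by a unit current that enters at \<open>x\<close> and leaves at \<open>y\<close>, in the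
  network in which every vertex is also joined to a ground by an edge of conductance \<open>\<epsilon>\<close>.
\<close>

definition resistance :: "'a set set \<Rightarrow> real \<Rightarrow> real \<Rightarrow> 'a \<Rightarrow> 'a \<Rightarrow> real" where
  "resistance E D \<epsilon> x y = dipole E D \<epsilon> x y x - dipole E D \<epsilon> x y y"

context bounded_degree_graph
begin

lemma summable_on_rows:
  fixes f :: "'a \<times> 'a \<Rightarrow> real"
  assumes "f summable_on oriented_edges E"
  shows "(\<lambda>x. \<Sum>y\<in>nbrs E x. f (x, y)) summable_on V"
proof -
  have "(\<lambda>x. infsum (\<lambda>y. f (x, y)) (nbrs E x)) summable_on V"
    using summable_on_Sigma_banach[of "\<lambda>x y. f (x, y)" V "nbrs E"] assms
    by (simp add: oriented_edges_Sigma)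
  then show ?thesis
    by (rule summable_on_cong[THEN iffD1, rotated]) (simp add: finite_nbrs)
qed

text \<open>
  Every oriented edge carries away from one endpoint what it brings to the other.
\<close>

lemma laplacian_has_sum_0:
  assumes "f summable_on V" "\<And>x. x \<in> V \<Longrightarrow> 0 \<le> f x"
  shows "(laplacian E f has_sum 0) V"
proof -
  let ?O = "oriented_edges E"
  have s1: "(\<lambda>e. f (fst e)) summable_on ?O"
    by (rule summable_on_source[OF assms])
  have s2: "(\<lambda>e. f (snd e)) summable_on ?O"
    using swap_summable[of "\<lambda>e. f (fst e)"] s1 by simp
  have d: "(\<lambda>e. f (fst e) - f (snd e)) summable_on ?O"
    using summable_on_add[OF s1 summable_on_uminus[THEN iffD2, OF s2]] by simp
  have "infsum (\<lambda>e. f (fst e) - f (snd e)) ?O = 0"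
    using infsum_add[OF s1 summable_on_uminus[THEN iffD2, OF s2]] swap_infsum[of "\<lambda>e. f (fst e)"]
    by (simp add: infsum_uminus)
  then have z: "infsum (laplacian E f) V = 0"
    using infsum_oriented_edges[OF d] by (simp add: laplacian_def[abs_def])
  have "laplacian E f summable_on V"
    using summable_on_rows[OF d] by (simp add: laplacian_def[abs_def])
  then show ?thesis
    using has_sum_infsum[of "laplacian E f" V] z by simp
qed

lemma lazy_step_nonneg:
  assumes "\<And>x. x \<in> V \<Longrightarrow> 0 \<le> f x" "x \<in> V"
  shows "0 \<le> lazy_step E D f x"
proof -
  have "laplacian E f x \<le> (\<Sum>y\<in>nbrs E x. f x)"
    unfolding laplacian_def using nbrs_subset assms by (intro sum_mono) auto
  also have "\<dots> \<le> D * f x"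
    using mult_right_mono[OF degree_le[OF assms(2)] assms(1)[OF assms(2)]] by simp
  finally show ?thesis
    using D_pos by (simp add: lazy_step_def field_simps)
qed

lemma lazy_walk_nonneg: "x \<in> V \<Longrightarrow> 0 \<le> lazy_walk E D y k x"
proof (induction k arbitrary: x)
  case 0 then show ?case by (simp add: lazy_walk_def)
next
  case (Suc k)
  then show ?case
    using lazy_step_nonneg[of "lazy_walk E D y k" x] by (simp add: lazy_walk_def)
qed

lemma indicator_has_sum:
  assumes "y \<in> V"
  shows "((\<lambda>x. c x * indicator {y} x) has_sum (c y :: real)) V"
proof -
  have "((\<lambda>x. c x * indicator {y} x) has_sum (\<Sum>x\<in>{y}. c x * indicator {y} x)) {y}"
    by (rule has_sum_finite) simp
  then have "((\<lambda>x. c x * indicator {y} x) has_sum c y) {y}"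
    by simp
  then show ?thesis
    by (rule has_sum_cong_neutral[THEN iffD1, rotated -1]) (use assms in auto)
qed

lemma lazy_walk_has_sum:
  assumes "y \<in> V"
  shows "(lazy_walk E D y k has_sum 1) V"
proof (induction k)
  case 0
  show ?case using indicator_has_sum[OF assms, of "\<lambda>_. 1"] by (simp add: lazy_walk_def)
next
  case (Suc k)
  let ?f = "lazy_walk E D y k"
  have "(laplacian E ?f has_sum 0) V"
    using laplacian_has_sum_0[of ?f] Suc lazy_walk_nonneg by (auto simp: summable_on_def)
  then have "((\<lambda>x. ?f x + laplacian E ?f x * (- 1 / D)) has_sum (1 + 0 * (- 1 / D))) V"
    by (intro has_sum_add Suc has_sum_cmult_left)
  moreover have "?f x + laplacian E ?f x * (- 1 / D) = lazy_walk E D y (Suc k) x" for x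
    by (simp add: lazy_walk_def lazy_step_def)
  ultimately show ?case by simp
qed

lemma sum_lazy_walk_le:
  assumes "y \<in> V" "finite A" "A \<subseteq> V"
  shows "(\<Sum>x\<in>A. lazy_walk E D y k x) \<le> 1"
proof -
  have "(\<Sum>x\<in>A. lazy_walk E D y k x) \<le> infsum (lazy_walk E D y k) V"
    using lazy_walk_has_sum[OF assms(1)] lazy_walk_nonneg assms
    by (intro finite_sum_le_infsum) (auto simp: summable_on_def)
  then show ?thesis
    using infsumI[OF lazy_walk_has_sum[OF assms(1)]] by simp
qed

lemma lazy_walk_le_1:
  assumes "y \<in> V" "x \<in> V" shows "lazy_walk E D y k x \<le> 1"
  using sum_lazy_walk_le[of y "{x}" k] assms by simp

context
  fixes \<epsilon> :: real
  assumes eps: "\<epsilon> > 0"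
begin

abbreviation "rate \<equiv> D / (D + \<epsilon>)"

lemma rate_bounds: "0 < rate" "rate < 1"
  using D_pos eps by auto

lemma weight_sums: "(\<lambda>k. rate ^ Suc k / D) sums (1 / \<epsilon>)"
proof -
  define r where "r = rate"
  have r: "0 < r" "r < 1"
    using rate_bounds by (simp_all add: r_def)
  have "(\<lambda>k. r / D * r ^ k) sums (r / D * (1 / (1 - r)))"
    using r by (intro sums_mult geometric_sums) auto
  moreover have "1 - r = \<epsilon> / (D + \<epsilon>)"
    using D_pos eps by (simp add: r_def field_simps)
  then have "r / D * (1 / (1 - r)) = 1 / \<epsilon>"
    using D_pos eps by (simp add: r_def)
  ultimately show ?thesis by (simp add: r_def[symmetric])
qed

lemma weight_nonneg: "0 \<le> rate ^ Suc k / D"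
  using eps D_pos by (intro divide_nonneg_nonneg zero_le_power) auto

lemma green_summable:
  assumes "y \<in> V" "x \<in> V"
  shows "summable (\<lambda>k. rate ^ Suc k / D * lazy_walk E D y k x)"
proof (rule summable_comparison_test'[OF sums_summable[OF weight_sums]])
  show "norm (rate ^ Suc k / D * lazy_walk E D y k x) \<le> rate ^ Suc k / D" for k
  proof -
    have "rate ^ Suc k / D * lazy_walk E D y k x \<le> rate ^ Suc k / D * 1"
      by (intro mult_left_mono lazy_walk_le_1 assms weight_nonneg)
    moreover have "0 \<le> rate ^ Suc k / D * lazy_walk E D y k x"
      by (intro mult_nonneg_nonneg lazy_walk_nonneg assms weight_nonneg)
    ultimately show ?thesis by simp
  qed
qed

lemma green_nonneg:
  assumes "y \<in> V" "x \<in> V" shows "0 \<le> green E D \<epsilon> y x"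
  unfolding green_def
  by (intro suminf_nonneg green_summable mult_nonneg_nonneg lazy_walk_nonneg assms weight_nonneg)

lemma sum_green_le:
  assumes "y \<in> V" "finite A" "A \<subseteq> V"
  shows "(\<Sum>x\<in>A. green E D \<epsilon> y x) \<le> 1 / \<epsilon>"
proof -
  have s: "summable (\<lambda>k. rate ^ Suc k / D * lazy_walk E D y k x)" if "x \<in> A" for x
    using that assms by (intro green_summable) auto
  have "(\<Sum>x\<in>A. green E D \<epsilon> y x) = (\<Sum>k. \<Sum>x\<in>A. rate ^ Suc k / D * lazy_walk E D y k x)"
    unfolding green_def using s by (intro suminf_sum[symmetric])
  also have "\<dots> \<le> (\<Sum>k. rate ^ Suc k / D)"
  proof (rule suminf_le[OF _ _ sums_summable[OF weight_sums]])
    show "(\<Sum>x\<in>A. rate ^ Suc k / D * lazy_walk E D y k x) \<le> rate ^ Suc k / D" for k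
      using mult_left_mono[OF sum_lazy_walk_le[OF assms] weight_nonneg, of k k]
      by (simp add: sum_distrib_left)
    show "summable (\<lambda>k. \<Sum>x\<in>A. rate ^ Suc k / D * lazy_walk E D y k x)"
      by (intro summable_sum s)
  qed
  also have "\<dots> = 1 / \<epsilon>"
    using sums_unique[OF weight_sums] by simp
  finally show ?thesis .
qed

lemma green_le:
  assumes "y \<in> V" "x \<in> V" shows "green E D \<epsilon> y x \<le> 1 / \<epsilon>"
  using sum_green_le[of y "{x}"] assms by simp

lemma green_sq_summable:
  assumes "y \<in> V" shows "sq_summable V (green E D \<epsilon> y)"
proof -
  have "green E D \<epsilon> y summable_on V"
    using sum_green_le[OF assms] green_nonneg[OF assms]
    by (intro nonneg_bdd_above_summable_on) (auto intro!: bdd_aboveI2)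
  then have "(\<lambda>x. 1 / \<epsilon> * green E D \<epsilon> y x) summable_on V"
    by (rule summable_on_cmult_right)
  then show ?thesis
    unfolding sq_summable_def
  proof (rule summable_on_bounded_by)
    show "\<bar>(green E D \<epsilon> y x)\<^sup>2\<bar> \<le> 1 / \<epsilon> * green E D \<epsilon> y x" if "x \<in> V" for x
      using mult_right_mono[OF green_le[OF assms that] green_nonneg[OF assms that]]
      by (simp add: power2_eq_square)
  qed
qed

text \<open>
  Splitting off the first term of the Neumann series gives
  \<open>g = D / (D + \<epsilon>) (\<delta> / D + K g)\<close>.
\<close>

lemma green_equation:
  assumes y: "y \<in> V" and x: "x \<in> V"
  shows "\<epsilon> * green E D \<epsilon> y x + laplacian E (green E D \<epsilon> y) x = indicator {y} x"
proof -
  define a where "a k z = rate ^ Suc k / D * lazy_walk E D y k z" for k z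
  have g: "green E D \<epsilon> y z = (\<Sum>k. a k z)" for z
    by (simp add: green_def a_def)
  have sm: "summable (\<lambda>k. a k z)" if "z \<in> V" for z
    using green_summable[OF y that] by (simp add: a_def)
  have nV: "z \<in> V" if "z \<in> nbrs E x" for z
    using that nbrs_subset by blast
  have sl: "summable (\<lambda>k. laplacian E (a k) x)"
    unfolding laplacian_def by (intro summable_sum summable_diff sm x nV)
  have lap: "laplacian E (green E D \<epsilon> y) x = (\<Sum>k. laplacian E (a k) x)"
    unfolding laplacian_def g
    using x nV by (simp add: suminf_sum suminf_diff sm summable_diff)
  have step: "a (Suc k) x = rate * (a k x - laplacian E (a k) x / D)" for k
  proof -
    define w where "w = rate ^ Suc k / D"
    have a: "a k z = w * lazy_walk E D y k z" for z
      by (simp add: a_def w_def)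
    have l: "laplacian E (a k) x = w * laplacian E (lazy_walk E D y k) x"
      unfolding laplacian_def a by (simp add: sum_distrib_left right_diff_distrib)
    have "lazy_walk E D y (Suc k) x = lazy_walk E D y k x - laplacian E (lazy_walk E D y k) x / D"
      by (simp add: lazy_walk_def lazy_step_def)
    moreover have "a (Suc k) x = rate * w * lazy_walk E D y (Suc k) x"
      unfolding a_def w_def by simp
    ultimately show ?thesis
      unfolding l a by (simp only: mult.assoc right_diff_distrib times_divide_eq_right)
  qed
  have "(\<Sum>k. a (Suc k) x) = rate * (green E D \<epsilon> y x - laplacian E (green E D \<epsilon> y) x / D)"
    unfolding step lap g
    by (subst suminf_mult) (auto intro!: summable_diff summable_divide sm x sl
        simp: suminf_diff[symmetric] suminf_divide summable_divide sm x sl)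
  moreover have "(\<Sum>k. a (Suc k) x) = green E D \<epsilon> y x - a 0 x"
    unfolding g by (rule suminf_split_head[OF sm[OF x]])
  moreover have "a 0 x = rate / D * indicator {y} x"
    by (simp add: a_def lazy_walk_def)
  ultimately have "green E D \<epsilon> y x - rate / D * indicator {y} x
      = rate * (green E D \<epsilon> y x - laplacian E (green E D \<epsilon> y) x / D)"
    by simp
  moreover have "rate / D = 1 / (D + \<epsilon>)"
    using D_pos by simp
  moreover have "rate * (g - l / D) = (D * g - l) / (D + \<epsilon>)" for g l
    using D_pos by (simp add: right_diff_distrib diff_divide_distrib)
  ultimately have "green E D \<epsilon> y x - 1 / (D + \<epsilon>) * indicator {y} x
      = (D * green E D \<epsilon> y x - laplacian E (green E D \<epsilon> y) x) / (D + \<epsilon>)"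
    by simp
  moreover have "D + \<epsilon> \<noteq> 0"
    using D_pos eps by simp
  ultimately show ?thesis
    by (simp add: divide_simps) (simp add: algebra_simps)
qed

subsection \<open>Effective resistance\<close>

text \<open>
  The quadratic form of \<open>\<Delta> + \<epsilon>\<close>. The Green function represents evaluation at a point with respect
  to it, and the dipole represents the difference of two evaluations, which turns bounds for
  potential differences into the Cauchy-Schwarz inequality.
\<close>

definition killed_form :: "('a \<Rightarrow> real) \<Rightarrow> ('a \<Rightarrow> real) \<Rightarrow> real" where
  "killed_form u v = energy E u v + \<epsilon> * inner_on V u v"

lemma killed_form_green:
  assumes "sq_summable V u" "y \<in> V"
  shows "killed_form u (green E D \<epsilon> y) = u y"
proof -
  let ?g = "green E D \<epsilon> y"
  have e: "energy E u ?g = inner_on V u (laplacian E ?g)"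
    by (intro Green_identity assms(1) sq_summable_finite_energy green_sq_summable assms(2))
  have l: "laplacian E ?g x = indicator {y} x + (- \<epsilon>) * ?g x" if "x \<in> V" for x
    using green_equation[OF assms(2) that] by simp
  have si: "sq_summable V (indicator {y} :: 'a \<Rightarrow> real)"
    using indicator_has_sum[OF assms(2), of "indicator {y}"]
    by (auto simp: sq_summable_def power2_eq_square summable_on_def)
  have "inner_on V u (laplacian E ?g) = inner_on V (\<lambda>x. indicator {y} x + (- \<epsilon>) * ?g x) u"
    by (subst inner_on_commute) (rule inner_on_cong, simp_all add: l)
  also have "\<dots> = inner_on V (indicator {y}) u + (- \<epsilon>) * inner_on V ?g u"
    by (rule inner_on_axpy) (intro si green_sq_summable assms)+
  also have "inner_on V (indicator {y}) u = u y"
    using infsumI[OF indicator_has_sum[OF assms(2), of u]] by (simp add: inner_on_def mult.commute)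
  finally show ?thesis
    using e by (simp add: killed_form_def inner_on_commute)
qed

lemma killed_form_axpy_self:
  assumes "sq_summable V u" "sq_summable V v"
  shows "killed_form (\<lambda>x. u x + t * v x) (\<lambda>x. u x + t * v x) = killed_form u u + 2 * t * killed_form u v + t\<^sup>2 * killed_form v v"
  unfolding killed_form_def inner_on_axpy_self[OF assms]
    energy_axpy_self[OF sq_summable_finite_energy[OF assms(1)] sq_summable_finite_energy[OF assms(2)]]
  by (simp add: algebra_simps)

lemma killed_form_nonneg: "0 \<le> killed_form u u"
  using eps by (simp add: killed_form_def energy_nonneg inner_on_nonneg)

lemma dipole_sq_summable:
  assumes "x \<in> V" "y \<in> V" shows "sq_summable V (dipole E D \<epsilon> x y)"
  unfolding dipole_def[abs_def] by (intro sq_summable_diff green_sq_summable assms)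

lemma killed_form_dipole:
  assumes "sq_summable V u" "x \<in> V" "y \<in> V"
  shows "killed_form u (dipole E D \<epsilon> x y) = u x - u y"
proof -
  have "killed_form u (dipole E D \<epsilon> x y) = killed_form u (green E D \<epsilon> x) - killed_form u (green E D \<epsilon> y)"
    unfolding killed_form_def dipole_def[abs_def]
    using inner_on_diff_right[OF green_sq_summable[OF assms(2)] green_sq_summable[OF assms(3)] assms(1)]
      energy_diff_right[OF sq_summable_finite_energy[OF green_sq_summable[OF assms(2)]]
        sq_summable_finite_energy[OF green_sq_summable[OF assms(3)]]
        sq_summable_finite_energy[OF assms(1)]]
    by (simp add: right_diff_distrib)
  then show ?thesis
    using killed_form_green assms by simp
qed

lemma killed_form_dipole_self:
  assumes "x \<in> V" "y \<in> V"
  shows "killed_form (dipole E D \<epsilon> x y) (dipole E D \<epsilon> x y) = resistance E D \<epsilon> x y"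
  using killed_form_dipole[OF dipole_sq_summable[OF assms] assms] by (simp add: resistance_def)

lemma resistance_nonneg:
  assumes "x \<in> V" "y \<in> V" shows "0 \<le> resistance E D \<epsilon> x y"
  using killed_form_nonneg[of "dipole E D \<epsilon> x y"] killed_form_dipole_self[OF assms] by simp

lemma energy_dipole_le:
  assumes "x \<in> V" "y \<in> V"
  shows "energy E (dipole E D \<epsilon> x y) (dipole E D \<epsilon> x y) \<le> resistance E D \<epsilon> x y"
  using killed_form_dipole_self[OF assms]
    mult_nonneg_nonneg[OF less_imp_le[OF eps] inner_on_nonneg[of V "dipole E D \<epsilon> x y"]]
  unfolding killed_form_def by linarith

text \<open>
  The variational characterisation of the resistance of the grounded network, as an inequality.
\<close>

lemma resistance_bound:
  assumes "sq_summable V u" "x \<in> V" "y \<in> V"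
  shows "(u x - u y)\<^sup>2 \<le> (energy E u u + \<epsilon> * inner_on V u u) * resistance E D \<epsilon> x y"
proof -
  have "(u x - u y)\<^sup>2 \<le> killed_form u u * resistance E D \<epsilon> x y"
  proof (rule discriminant_bound)
    fix t
    have "killed_form (\<lambda>z. u z + t * dipole E D \<epsilon> x y z) (\<lambda>z. u z + t * dipole E D \<epsilon> x y z)
        = killed_form u u + 2 * t * (u x - u y) + t\<^sup>2 * resistance E D \<epsilon> x y"
      using killed_form_axpy_self[OF assms(1) dipole_sq_summable[OF assms(2,3)]]
        killed_form_dipole[OF assms] killed_form_dipole_self[OF assms(2,3)] by simp
    then show "0 \<le> killed_form u u + 2 * t * (u x - u y) + t\<^sup>2 * resistance E D \<epsilon> x y"
      using killed_form_nonneg[of "\<lambda>z. u z + t * dipole E D \<epsilon> x y z"] by simp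
  qed (rule resistance_nonneg[OF assms(2,3)])
  then show ?thesis by (simp add: killed_form_def)
qed

lemma resistance_edge_le_1:
  assumes "{x, y} \<in> E" shows "resistance E D \<epsilon> x y \<le> 1"
proof -
  note xy = edgeD[OF assms]
  let ?r = "resistance E D \<epsilon> x y"
  have "?r\<^sup>2 \<le> energy E (dipole E D \<epsilon> x y) (dipole E D \<epsilon> x y)"
    unfolding resistance_def
    by (intro sq_diff_le_energy sq_summable_finite_energy dipole_sq_summable xy assms)
  also have "\<dots> \<le> ?r" by (rule energy_dipole_le[OF xy(1,2)])
  finally have "?r * ?r \<le> 1 * ?r" by (simp add: power2_eq_square)
  then show ?thesis
    using resistance_nonneg[OF xy(1,2)] by (cases "?r = 0") (auto simp: mult_le_cancel_right)
qed

lemma resistance_eq: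
  "resistance E D \<epsilon> x y
    = (green E D \<epsilon> x x - green E D \<epsilon> x y) + (green E D \<epsilon> y y - green E D \<epsilon> y x)"
  by (simp add: resistance_def dipole_def)

lemma sum_green_diff_nbrs:
  assumes "x \<in> V"
  shows "(\<Sum>y\<in>nbrs E x. green E D \<epsilon> x x - green E D \<epsilon> x y) = 1 - \<epsilon> * green E D \<epsilon> x x"
  using green_equation[OF assms assms] by (simp add: laplacian_def)

lemma energy_green_le:
  assumes "y \<in> V"
  shows "energy E (green E D \<epsilon> y) (green E D \<epsilon> y) \<le> 1 / \<epsilon>"
proof -
  have "energy E (green E D \<epsilon> y) (green E D \<epsilon> y) \<le> killed_form (green E D \<epsilon> y) (green E D \<epsilon> y)"
    using eps by (simp add: killed_form_def inner_on_nonneg)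
  also have "\<dots> = green E D \<epsilon> y y"
    by (rule killed_form_green[OF green_sq_summable[OF assms] assms])
  also have "\<dots> \<le> 1 / \<epsilon>" by (rule green_le[OF assms assms])
  finally show ?thesis .
qed

text \<open>
  Take for \<open>u\<close> the dipole plus the multiple \<open>(h x - h y) / energy h\<close> of \<open>h\<close>. A harmonic function is
  orthogonal to every square-summable one, so the energies add up. The quotient
  \<open>(u x - u y)\<^sup>2 / energy u\<close> is then at least \<open>\<rho>\<close>, so \<open>h\<close> raises the free resistance by at least
  \<open>(h x - h y)\<^sup>2 / energy h\<close>.
\<close>

lemma free_resistance_lower_bound:
  assumes xy: "x \<in> V" "y \<in> V" and h: "finite_energy E h" "\<And>z. z \<in> V \<Longrightarrow> laplacian E h z = 0"
    and pos: "energy E h h > 0"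
  defines "\<rho> \<equiv> resistance E D \<epsilon> x y + (h x - h y)\<^sup>2 / energy E h h"
  shows "\<exists>u. finite_energy E u \<and> u x - u y = \<rho> \<and> energy E u u \<le> \<rho>"
proof -
  let ?d = "dipole E D \<epsilon> x y" and ?t = "(h x - h y) / energy E h h"
  let ?u = "\<lambda>z. ?d z + ?t * h z"
  have fd: "finite_energy E ?d"
    by (intro sq_summable_finite_energy dipole_sq_summable xy)
  have "energy E ?d h = inner_on V ?d (laplacian E h)"
    by (intro Green_identity dipole_sq_summable xy h)
  also have "\<dots> = (\<Sum>\<^sub>\<infinity>z\<in>V. 0)"
    unfolding inner_on_def by (rule infsum_cong) (simp add: h)
  finally have "energy E ?u ?u = energy E ?d ?d + ?t\<^sup>2 * energy E h h"
    using energy_axpy_self[OF fd h(1), of ?t] by simp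
  also have "?t\<^sup>2 * energy E h h = (h x - h y)\<^sup>2 / energy E h h"
    using pos by (simp add: power2_eq_square)
  finally have "energy E ?u ?u \<le> \<rho>"
    using energy_dipole_le[OF xy] by (simp add: \<rho>_def)
  moreover have "?u x - ?u y = \<rho>"
    by (simp add: \<rho>_def resistance_def power2_eq_square algebra_simps diff_divide_distrib
        add_divide_distrib)
  ultimately show ?thesis
    using finite_energy_axpy[OF fd h(1), of ?t] by (intro exI[of _ ?u]) simp
qed

end

end

section \<open>Wired and free effective resistance\<close>

context bounded_degree_graph
begin

text \<open>
  The number \<open>n\<close> is the length of a path from \<open>a\<close> to \<open>b\<close>; it does not depend on the function.
\<close>

lemma connected_difference_bound:
  assumes "(a, b) \<in> {(x, y). {x, y} \<in> E}\<^sup>*"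
  shows "\<exists>n. \<forall>v. finite_energy E v \<longrightarrow> \<bar>v a - v b\<bar> \<le> real n * sqrt (energy E v v)"
  using assms
proof (induction rule: rtrancl_induct)
  case base
  show ?case by (auto intro: exI[of _ 0])
next
  case (step b c)
  then obtain n where n: "\<And>v. finite_energy E v \<Longrightarrow> \<bar>v a - v b\<bar> \<le> real n * sqrt (energy E v v)"
    by blast
  have "\<bar>v a - v c\<bar> \<le> real (Suc n) * sqrt (energy E v v)" if v: "finite_energy E v" for v
  proof -
    have "\<bar>v b - v c\<bar> \<le> sqrt (energy E v v)"
      using sq_diff_le_energy[OF v, of b c] step(2) edgeD[of b c]
      by (intro real_le_rsqrt) auto
    then show ?thesis
      using n[OF v] by (simp add: algebra_simps)
  qed
  then show ?case by blast
qed

text \<open>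
  The function \<open>e j * green E D (e j) x0\<close> is the distribution of the place where the killed walk dies.
  It has total mass at most one, and its energy is at most \<open>e j\<close>, so it is nearly constant on each
  finite set. On an infinite graph it must therefore be small.
\<close>

lemma killed_green_tendsto_0:
  assumes inf: "infinite V" and conn: "\<And>x y. x \<in> V \<Longrightarrow> y \<in> V \<Longrightarrow> y \<in> graph_component E x"
    and x0: "x0 \<in> V" and e: "\<And>j. e j > 0" "e \<longlonglongrightarrow> 0"
  shows "(\<lambda>j. e j * green E D (e j) x0 x0) \<longlonglongrightarrow> 0"
proof (rule order_tendstoI)
  fix a :: real assume "a < 0"
  moreover have "0 \<le> e j * green E D (e j) x0 x0" for j
    using green_nonneg[OF e(1) x0 x0, of j] e(1)[of j] by simp
  ultimately show "\<forall>\<^sub>F j in sequentially. a < e j * green E D (e j) x0 x0"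
    by (intro always_eventually allI) (rule less_le_trans)
next
  fix a :: real assume a: "0 < a"
  obtain N :: nat where N: "N > 0" "1 / real N < a"
    using reals_Archimedean2[of "1 / a"] a
    by (metis divide_less_eq gr0I less_divide_eq mult.commute of_nat_0 of_nat_0_less_iff
        order_less_trans zero_less_divide_1_iff)
  obtain A where A: "A \<subseteq> V" "finite A" "card A = N"
    using infinite_arbitrarily_large[OF inf] by blast
  have "\<forall>z\<in>A. \<exists>n. \<forall>v. finite_energy E v \<longrightarrow> \<bar>v x0 - v z\<bar> \<le> real n * sqrt (energy E v v)"
  proof
    fix z assume "z \<in> A"
    then have "(x0, z) \<in> {(x, y). {x, y} \<in> E}\<^sup>*"
      using conn[OF x0, of z] A by (auto simp: graph_component_def)
    then show "\<exists>n. \<forall>v. finite_energy E v \<longrightarrow> \<bar>v x0 - v z\<bar> \<le> real n * sqrt (energy E v v)"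
      by (rule connected_difference_bound)
  qed
  then obtain n where n: "\<And>z v. z \<in> A \<Longrightarrow> finite_energy E v \<Longrightarrow> \<bar>v x0 - v z\<bar> \<le> real (n z) * sqrt (energy E v v)"
    by metis
  define K where "K = (\<Sum>z\<in>A. real (n z))"
  \<comment> \<open>Average the Green function over \<open>N\<close> vertices at which it is close to its value at the pole.\<close>
  have bound: "e j * green E D (e j) x0 x0 \<le> (1 + K * sqrt (e j)) / real N" for j
  proof -
    let ?g = "green E D (e j) x0"
    have fe: "finite_energy E ?g"
      by (intro sq_summable_finite_energy green_sq_summable e x0)
    have "sqrt (energy E ?g ?g) \<le> sqrt (1 / e j)"
      using energy_green_le[OF e(1) x0] by simp
    then have s: "e j * sqrt (energy E ?g ?g) \<le> sqrt (e j)"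
      using mult_left_mono[of _ "sqrt (1 / e j)" "e j"] e(1)[of j]
      by (simp add: real_sqrt_divide real_div_sqrt)
    have "real N * (e j * ?g x0) = (\<Sum>z\<in>A. e j * ?g x0)"
      using A by simp
    also have "\<dots> \<le> (\<Sum>z\<in>A. e j * ?g z + real (n z) * sqrt (e j))"
    proof (rule sum_mono)
      fix z assume z: "z \<in> A"
      have "e j * (?g x0 - ?g z) \<le> e j * (real (n z) * sqrt (energy E ?g ?g))"
        using n[OF z fe] e(1)[of j] by (intro mult_left_mono) auto
      also have "\<dots> \<le> real (n z) * sqrt (e j)"
        using mult_left_mono[OF s, of "real (n z)"] by (simp add: algebra_simps)
      finally show "e j * ?g x0 \<le> e j * ?g z + real (n z) * sqrt (e j)"
        by (simp add: algebra_simps)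
    qed
    also have "\<dots> = e j * (\<Sum>z\<in>A. ?g z) + K * sqrt (e j)"
      by (simp add: sum.distrib sum_distrib_left sum_distrib_right K_def)
    also have "\<dots> \<le> 1 + K * sqrt (e j)"
      using mult_left_mono[OF sum_green_le[OF e(1) x0 A(2,1)], of "e j" j] e(1)[of j] by simp
    finally show ?thesis
      using N by (simp add: field_simps)
  qed
  have "(\<lambda>j. (1 + K * sqrt (e j)) / real N) \<longlonglongrightarrow> (1 + K * sqrt 0) / real N"
    by (intro tendsto_intros e) (use N in auto)
  then have "\<forall>\<^sub>F j in sequentially. (1 + K * sqrt (e j)) / real N < a"
    using N(2) by (intro order_tendstoD) auto
  then show "\<forall>\<^sub>F j in sequentially. e j * green E D (e j) x0 x0 < a"
    by eventually_elim (rule le_less_trans[OF bound])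
qed

text \<open>
  Letting the killing rate tend to zero in \<open>resistance_bound\<close> removes the \<open>l\<^sup>2\<close> term.
\<close>

lemma wired_bound:
  assumes w: "sq_summable V w" and xy: "x \<in> V" "y \<in> V"
    and e: "\<And>j. e j > 0" "e \<longlonglongrightarrow> 0" and R: "\<And>j. resistance E D (e j) x y \<le> R"
  shows "(w x - w y)\<^sup>2 \<le> energy E w w * R"
proof (rule tendsto_lowerbound)
  show "(\<lambda>j. (energy E w w + e j * inner_on V w w) * R) \<longlonglongrightarrow> energy E w w * R"
    by (auto intro!: tendsto_eq_intros e(2))
  have "(w x - w y)\<^sup>2 \<le> (energy E w w + e j * inner_on V w w) * R" for j
  proof -
    have "(w x - w y)\<^sup>2 \<le> (energy E w w + e j * inner_on V w w) * resistance E D (e j) x y"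
      by (rule resistance_bound[OF e(1) w xy])
    also have "\<dots> \<le> (energy E w w + e j * inner_on V w w) * R"
      using e(1)[of j] by (intro mult_left_mono R add_nonneg_nonneg mult_nonneg_nonneg energy_nonneg inner_on_nonneg) auto
    finally show ?thesis .
  qed
  then show "\<forall>\<^sub>F j in sequentially. (w x - w y)\<^sup>2 \<le> (energy E w w + e j * inner_on V w w) * R"
    by simp
qed simp

text \<open>
  The first variation at an approximate minimiser: perturbing \<open>f\<close> by multiples of a point mass lowers
  the energy by at most \<open>energy E f f - m\<close>.
\<close>

lemma laplacian_sq_le:
  assumes f: "finite_energy E f" and x: "x \<in> V"
    and m: "\<And>w. sq_summable V w \<Longrightarrow> m \<le> energy E (\<lambda>z. f z + w z) (\<lambda>z. f z + w z)"
  shows "(laplacian E f x)\<^sup>2 \<le> (energy E f f - m) * energy E (indicator {x}) (indicator {x})"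
proof (rule discriminant_bound)
  have s: "sq_summable V (indicator {x} :: 'a \<Rightarrow> real)"
    using indicator_has_sum[OF x, of "indicator {x}"]
    by (auto simp: sq_summable_def power2_eq_square summable_on_def)
  have "energy E (indicator {x}) f = laplacian E f x"
    using Green_identity[OF s f] infsumI[OF indicator_has_sum[OF x, of "laplacian E f"]]
    by (simp add: inner_on_def mult.commute)
  then have e: "energy E (\<lambda>z. f z + t * indicator {x} z) (\<lambda>z. f z + t * indicator {x} z)
      = energy E f f + 2 * t * laplacian E f x + t\<^sup>2 * energy E (indicator {x}) (indicator {x})" for t
    using energy_axpy_self[OF f sq_summable_finite_energy[OF s], of t] by (simp add: energy_commute)
  have z: "sq_summable V (\<lambda>z. 0)" by (simp add: sq_summable_def)
  show "0 \<le> energy E f f - m + 2 * t * laplacian E f x + t\<^sup>2 * energy E (indicator {x}) (indicator {x})" for t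
    using m[of "\<lambda>z. t * indicator {x} z"] sq_summable_axpy[OF z s, of t] by (simp add: e)
qed (rule energy_nonneg)

lemma energy_parallelogram:
  assumes f: "finite_energy E f" and g: "finite_energy E g"
  shows "energy E (\<lambda>z. f z - g z) (\<lambda>z. f z - g z)
    = 2 * energy E f f + 2 * energy E g g
      - 4 * energy E (\<lambda>z. f z + (-1/2) * (f z - g z)) (\<lambda>z. f z + (-1/2) * (f z - g z))"
  using energy_axpy_self[OF f finite_energy_diff[OF f g], of "-1"]
    energy_axpy_self[OF f finite_energy_diff[OF f g], of "-1/2"]
  by (simp add: power2_eq_square)

text \<open>
  Minimise the energy of \<open>u - w\<close> over square-summable \<open>w\<close>. By the parallelogram identity a minimising
  sequence is Cauchy in energy, and the differences \<open>u - w\<close> converge along edges to those of a function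
  \<open>h\<close> that is harmonic because it is a minimiser (this is the Royden decomposition). By assumption
  \<open>h\<close> has no differences along edges, so \<open>u\<close> is a limit in energy of square-summable functions, and
  \<open>wired_bound\<close> carries over to \<open>u\<close>.
\<close>

lemma liouville_free_le_wired:
  assumes liouville: "\<And>h x y. finite_energy E h \<Longrightarrow> (\<And>z. z \<in> V \<Longrightarrow> laplacian E h z = 0)
      \<Longrightarrow> {x, y} \<in> E \<Longrightarrow> h x = h y"
    and u: "finite_energy E u" and xy: "{x, y} \<in> E"
    and e: "\<And>j. e j > 0" "e \<longlonglongrightarrow> 0" and R: "\<And>j. resistance E D (e j) x y \<le> R"
  shows "(u x - u y)\<^sup>2 \<le> energy E u u * R"
proof -
  define S where "S = (\<lambda>w. energy E (\<lambda>z. u z - w z) (\<lambda>z. u z - w z)) ` {w. sq_summable V w}"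
  define m where "m = Inf S"
  have z0: "sq_summable V (\<lambda>z. 0)" by (simp add: sq_summable_def)
  then have S: "S \<noteq> {}" "bdd_below S"
    by (auto simp: S_def energy_nonneg intro!: bdd_belowI[of _ 0])
  have m_le: "m \<le> energy E (\<lambda>z. u z - w z) (\<lambda>z. u z - w z)" if "sq_summable V w" for w
    unfolding m_def using that S(2) by (intro cInf_lower) (auto simp: S_def)
  have "\<exists>w. sq_summable V w \<and> energy E (\<lambda>z. u z - w z) (\<lambda>z. u z - w z) < m + 1 / real (Suc n)" for n
    using cInf_lessD[OF S(1), of "m + 1 / real (Suc n)"] by (auto simp: m_def S_def)
  then obtain w where w: "\<And>n. sq_summable V (w n)"
    and wm: "\<And>n. energy E (\<lambda>z. u z - w n z) (\<lambda>z. u z - w n z) < m + 1 / real (Suc n)"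
    by metis
  define f where "f n z = u z - w n z" for n z
  have f: "finite_energy E (f n)" for n
    unfolding f_def[abs_def] by (intro finite_energy_diff u sq_summable_finite_energy w)
  have fm: "energy E (f n) (f n) < m + 1 / real (Suc n)" for n
    using wm by (simp add: f_def[abs_def])
  have m_f: "m \<le> energy E (\<lambda>z. f n z + v z) (\<lambda>z. f n z + v z)" if "sq_summable V v" for n v
    using m_le[OF sq_summable_diff[OF w that, of n]] by (simp add: f_def algebra_simps)
  \<comment> \<open>The midpoint of \<open>f n\<close> and \<open>f k\<close> again differs from \<open>u\<close> by a square-summable function, so its
    energy is at least \<open>m\<close>.\<close>
  have diff: "energy E (\<lambda>z. f n z - f k z) (\<lambda>z. f n z - f k z) \<le> 2 / real (Suc n) + 2 / real (Suc k)" for n k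
  proof -
    have "sq_summable V (\<lambda>z. (-1/2) * (f n z - f k z))"
      using sq_summable_axpy[OF z0 sq_summable_diff[OF w w], of "1/2" n k]
      by (simp add: f_def algebra_simps)
    from m_f[OF this, of n] show ?thesis
      unfolding energy_parallelogram[OF f f] using fm[of n] fm[of k] by simp
  qed
  have conv_edge: "convergent (\<lambda>n. f n a - f n b)" if ab: "{a, b} \<in> E" for a b
  proof -
    have sq: "\<bar>(f n a - f n b) - (f k a - f k b)\<bar> \<le> sqrt (2 / real (Suc n) + 2 / real (Suc k))" for n k
    proof (rule real_le_rsqrt)
      have "(\<lambda>z. f n z - f k z) = (\<lambda>z. f n z - f k z)" ..
      then show "\<bar>(f n a - f n b) - (f k a - f k b)\<bar>\<^sup>2 \<le> 2 / real (Suc n) + 2 / real (Suc k)"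
        using sq_diff_le_energy[OF finite_energy_diff[OF f f, of n k] ab] edgeD[OF ab] diff[of n k]
        by (simp add: algebra_simps)
    qed
    have "Cauchy (\<lambda>n. f n a - f n b)"
    proof (rule metric_CauchyI)
      fix d :: real assume d: "d > 0"
      obtain N where N: "real N > 4 / d\<^sup>2"
        using reals_Archimedean2 by blast
      show "\<exists>M. \<forall>n\<ge>M. \<forall>k\<ge>M. dist (f n a - f n b) (f k a - f k b) < d"
      proof (intro exI allI impI)
        fix n k assume nk: "N \<le> n" "N \<le> k"
        have "real N > 0" using N d by (smt (verit) divide_pos_pos zero_less_power)
        have "2 / real (Suc n) \<le> 2 / real (Suc N)" "2 / real (Suc k) \<le> 2 / real (Suc N)"
          using nk by (auto intro!: divide_left_mono)
        moreover have "2 / real (Suc N) < 2 / real N"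
          using \<open>real N > 0\<close> by (intro divide_strict_left_mono) auto
        moreover have "4 / real N < d\<^sup>2"
          using N d \<open>real N > 0\<close> by (simp add: field_simps)
        ultimately have "2 / real (Suc n) + 2 / real (Suc k) < d\<^sup>2" by simp
        then have "sqrt (2 / real (Suc n) + 2 / real (Suc k)) < d"
          using d by (intro real_less_lsqrt) auto
        then show "dist (f n a - f n b) (f k a - f k b) < d"
          using sq[of n k] by (simp add: dist_real_def)
      qed
    qed
    then show ?thesis by (rule Cauchy_convergent)
  qed
  define r where "r = {(x, y). {x, y} \<in> E}"
  have conv: "convergent (\<lambda>n. f n a - f n b)" if "(a, b) \<in> r\<^sup>*" for a b
    using that
  proof (induction rule: rtrancl_induct)
    case base show ?case by (simp add: convergent_const)
  next
    case (step b c)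
    have "convergent (\<lambda>n. (f n a - f n b) + (f n b - f n c))"
      using step conv_edge[of b c] by (intro convergent_add) (auto simp: r_def)
    then show ?case by simp
  qed
  \<comment> \<open>On each component subtract the value at a chosen vertex, so that convergence of differences
    becomes convergence of functions.\<close>
  define rep where "rep z = (SOME b. (z, b) \<in> r\<^sup>*)" for z
  have rep: "(z, rep z) \<in> r\<^sup>*" for z
    unfolding rep_def by (rule someI[of _ z]) simp
  have sym: "(a, b) \<in> r \<Longrightarrow> (b, a) \<in> r" for a b
    by (simp add: r_def insert_commute)
  have rep_eq: "rep a = rep b" if "(a, b) \<in> r" for a b
  proof -
    have "(a, c) \<in> r\<^sup>* \<longleftrightarrow> (b, c) \<in> r\<^sup>*" for c
      using that sym[OF that] by (meson converse_rtrancl_into_rtrancl)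
    then show ?thesis by (simp add: rep_def)
  qed
  define h where "h z = lim (\<lambda>n. f n z - f n (rep z))" for z
  have h: "(\<lambda>n. f n a - f n b) \<longlonglongrightarrow> h a - h b" if "{a, b} \<in> E" for a b
  proof -
    have "(\<lambda>n. f n z - f n (rep z)) \<longlonglongrightarrow> h z" for z
      using conv[OF rep] by (simp add: h_def convergent_LIMSEQ_iff)
    from tendsto_diff[OF this[of a] this[of b]] rep_eq[of a b] that show ?thesis
      by (simp add: r_def)
  qed
  have "finite_energy E h"
  proof (rule energy_Fatou(1)[OF h f])
    have "energy E (f n) (f n) \<le> m + 1" for n
      using fm[of n] by (smt (verit) divide_le_eq_1 of_nat_0_less_iff of_nat_1 of_nat_Suc of_nat_0_le_iff)
    then show "\<forall>\<^sub>F n in sequentially. energy E (f n) (f n) \<le> m + 1" by simp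
  qed
  moreover have "laplacian E h z = 0" if z: "z \<in> V" for z
  proof (rule LIMSEQ_unique)
    show "(\<lambda>n. laplacian E (f n) z) \<longlonglongrightarrow> laplacian E h z"
      unfolding laplacian_def by (intro tendsto_sum h) (simp add: nbrs_def)
    let ?c = "energy E (indicator {z}) (indicator {z})"
    have "(\<lambda>n. (laplacian E (f n) z)\<^sup>2) \<longlonglongrightarrow> 0"
    proof (rule tendsto_sandwich[of "\<lambda>_. 0" _ _ "\<lambda>n. 1 / real (Suc n) * ?c"])
      show "\<forall>\<^sub>F n in sequentially. (laplacian E (f n) z)\<^sup>2 \<le> 1 / real (Suc n) * ?c"
      proof (intro always_eventually allI)
        fix n
        have "(laplacian E (f n) z)\<^sup>2 \<le> (energy E (f n) (f n) - m) * ?c"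
          by (rule laplacian_sq_le[OF f z m_f])
        also have "\<dots> \<le> 1 / real (Suc n) * ?c"
          using fm[of n] by (intro mult_right_mono energy_nonneg) simp
        finally show "(laplacian E (f n) z)\<^sup>2 \<le> 1 / real (Suc n) * ?c" .
      qed
      show "(\<lambda>n. 1 / real (Suc n) * ?c) \<longlonglongrightarrow> 0"
        using tendsto_mult_right[OF LIMSEQ_inverse_real_of_nat, of ?c] by (simp add: inverse_eq_divide)
    qed auto
    then show "(\<lambda>n. laplacian E (f n) z) \<longlonglongrightarrow> 0"
      by (simp add: power_tendsto_0_iff)
  qed
  ultimately have h0: "h a = h b" if "{a, b} \<in> E" for a b
    using liouville that by blast
  have small: "energy E (f n) (f n) \<le> 2 / real (Suc n)" for n
  proof (rule tendsto_lowerbound)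
    show "(\<lambda>k. 2 / real (Suc n) + 2 / real (Suc k)) \<longlonglongrightarrow> 2 / real (Suc n)"
      using tendsto_add[OF tendsto_const tendsto_mult_left[OF LIMSEQ_inverse_real_of_nat, of 2], of "2 / real (Suc n)"]
      by (simp add: inverse_eq_divide)
    have "energy E (f n) (f n) \<le> 2 / real (Suc n) + 2 / real (Suc j)" for j
    proof (rule energy_Fatou(2))
      show "(\<lambda>k. (f n a - f (k + j) a) - (f n b - f (k + j) b)) \<longlonglongrightarrow> f n a - f n b" if "{a, b} \<in> E" for a b
        using tendsto_diff[OF tendsto_const LIMSEQ_ignore_initial_segment[OF h[OF that], of j], of "f n a - f n b"]
          h0[OF that] by (simp add: algebra_simps)
      show "finite_energy E (\<lambda>z. f n z - f (k + j) z)" for k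
        by (rule finite_energy_diff[OF f f])
      have "energy E (\<lambda>z. f n z - f (k + j) z) (\<lambda>z. f n z - f (k + j) z) \<le> 2 / real (Suc n) + 2 / real (Suc j)" for k
      proof -
        have "2 / real (Suc (k + j)) \<le> 2 / real (Suc j)" by (intro divide_left_mono) auto
        then show ?thesis using diff[of n "k + j"] by linarith
      qed
      then show "\<forall>\<^sub>F k in sequentially. energy E (\<lambda>z. f n z - f (k + j) z) (\<lambda>z. f n z - f (k + j) z)
          \<le> 2 / real (Suc n) + 2 / real (Suc j)" by simp
    qed
    then show "\<forall>\<^sub>F k in sequentially. energy E (f n) (f n) \<le> 2 / real (Suc n) + 2 / real (Suc k)" by simp
  qed simp
  have f0: "(\<lambda>n. energy E (f n) (f n)) \<longlonglongrightarrow> 0"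
  proof (rule tendsto_sandwich[of "\<lambda>_. 0" _ _ "\<lambda>n. 2 / real (Suc n)"])
    show "(\<lambda>n. 2 / real (Suc n)) \<longlonglongrightarrow> 0"
      using tendsto_mult_left[OF LIMSEQ_inverse_real_of_nat, of 2] by (simp add: inverse_eq_divide)
  qed (simp_all add: small energy_nonneg del: of_nat_Suc)
  have uf0: "(\<lambda>n. energy E u (f n)) \<longlonglongrightarrow> 0"
  proof -
    have "(\<lambda>n. (energy E u (f n))\<^sup>2) \<longlonglongrightarrow> 0"
    proof (rule tendsto_sandwich[of "\<lambda>_. 0" _ _ "\<lambda>n. energy E u u * energy E (f n) (f n)"])
      show "(\<lambda>n. energy E u u * energy E (f n) (f n)) \<longlonglongrightarrow> 0"
        using tendsto_mult_left[OF f0, of "energy E u u"] by simp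
    qed (use energy_Cauchy_Schwarz[OF u f] in auto)
    then show ?thesis by (simp add: power_tendsto_0_iff)
  qed
  show ?thesis
  proof (rule tendsto_le)
    have w_eq: "w n = (\<lambda>z. u z + (-1) * f n z)" for n
      by (simp add: f_def)
    have "energy E (w n) (w n) = energy E u u - 2 * energy E u (f n) + energy E (f n) (f n)" for n
      unfolding w_eq energy_axpy_self[OF u f] by simp
    then show "(\<lambda>n. energy E (w n) (w n) * R) \<longlonglongrightarrow> energy E u u * R"
      by (auto intro!: tendsto_eq_intros f0 uf0)
    have "(\<lambda>n. ((u x - u y) - (f n x - f n y))\<^sup>2) \<longlonglongrightarrow> ((u x - u y) - 0)\<^sup>2"
      using h[OF xy] h0[OF xy] by (intro tendsto_intros) simp
    then show "(\<lambda>n. (w n x - w n y)\<^sup>2) \<longlonglongrightarrow> (u x - u y)\<^sup>2"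
      by (simp add: f_def algebra_simps)
    show "\<forall>\<^sub>F n in sequentially. (w n x - w n y)\<^sup>2 \<le> energy E (w n) (w n) * R"
      using wired_bound[OF w _ _ e R] edgeD[OF xy] by simp
  qed simp
qed

end

section \<open>Balls\<close>

primrec graph_ball :: "'a set set \<Rightarrow> 'a \<Rightarrow> nat \<Rightarrow> 'a set" where
  "graph_ball E x 0 = {x}"
| "graph_ball E x (Suc n) = graph_ball E x n \<union> (\<Union>y\<in>graph_ball E x n. nbrs E y)"

lemma nbrs_subset_vertices:
  assumes "simple_graph V E" shows "nbrs E x \<subseteq> V"
  using assms unfolding simple_graph_def nbrs_def by (fastforce simp: doubleton_eq_iff)

lemma graph_ball_subset_vertices:
  assumes "simple_graph V E" "x \<in> V" shows "graph_ball E x n \<subseteq> V"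
  using nbrs_subset_vertices[OF assms(1)] assms(2) by (induction n) auto

lemma finite_graph_ball:
  assumes "simple_graph V E" "locally_finite_graph V E" "x \<in> V"
  shows "finite (graph_ball E x n)"
proof (induction n)
  case (Suc n)
  then show ?case
    using graph_ball_subset_vertices[OF assms(1,3), of n] assms(2)
    by (auto simp: locally_finite_graph_def)
qed simp

lemma graph_ball_mono: "m \<le> n \<Longrightarrow> graph_ball E x m \<subseteq> graph_ball E x n"
  by (rule lift_Suc_mono_le[of "graph_ball E x"]) auto

lemma graph_ball_exhausts:
  assumes "connected_graph V E" "x \<in> V" "y \<in> V"
  shows "\<exists>n. y \<in> graph_ball E x n"
proof -
  have "(x, y) \<in> {(u, v). {u, v} \<in> E}\<^sup>*"
    using assms by (auto simp: connected_graph_def graph_component_def)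
  then show ?thesis
  proof (induction rule: rtrancl_induct)
    case base then show ?case by (intro exI[of _ 0]) simp
  next
    case (step y z)
    then obtain n where "y \<in> graph_ball E x n" by blast
    with step(2) have "z \<in> graph_ball E x (Suc n)" by (auto simp: nbrs_def)
    then show ?case ..
  qed
qed

lemma countable_vertices:
  assumes "clf_graph V E" shows "countable V"
proof -
  obtain x where x: "x \<in> V"
    using assms by (auto simp: clf_graph_def connected_graph_def)
  have "V \<subseteq> (\<Union>n. graph_ball E x n)"
    using graph_ball_exhausts[of V E x] assms x by (auto simp: clf_graph_def)
  moreover have "countable (\<Union>n. graph_ball E x n)"
    using finite_graph_ball[of V E x] assms x by (auto simp: clf_graph_def countable_finite)
  ultimately show ?thesis by (rule countable_subset)
qed

section \<open>Automorphism groups\<close>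

lemma group_aut_group: "group (aut_group V E)"
proof -
  let ?H = "{g \<in> Bij V. \<forall>x\<in>V. \<forall>y\<in>V. {g x, g y} \<in> E \<longleftrightarrow> {x, y} \<in> E}"
  interpret B: group "BijGroup V" by (rule group_BijGroup)
  have "subgroup ?H (BijGroup V)"
  proof (rule B.subgroupI)
    show "?H \<subseteq> carrier (BijGroup V)" by (auto simp: BijGroup_def)
    show "?H \<noteq> {}"
    proof -
      have "(\<lambda>x\<in>V. x) \<in> ?H" using id_Bij[of V] by simp
      then show ?thesis by blast
    qed
    show "inv\<^bsub>BijGroup V\<^esub> g \<in> ?H" if g: "g \<in> ?H" for g
    proof -
      have b: "bij_betw g V V" using g by (simp add: Bij_def)
      have "inv\<^bsub>BijGroup V\<^esub> g = (\<lambda>x\<in>V. inv_into V g x)"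
        using g by (intro inv_BijGroup) simp
      moreover have "{inv_into V g x, inv_into V g y} \<in> E \<longleftrightarrow> {x, y} \<in> E" if xy: "x \<in> V" "y \<in> V" for x y
      proof -
        have i: "inv_into V g z \<in> V" "g (inv_into V g z) = z" if "z \<in> V" for z
          using that b inv_into_into[of z g V] f_inv_into_f[of z g V] by (simp_all add: bij_betw_def)
        have "\<forall>x\<in>V. \<forall>y\<in>V. {g x, g y} \<in> E \<longleftrightarrow> {x, y} \<in> E"
          using g by simp
        from this[rule_format, OF i(1)[OF xy(1)] i(1)[OF xy(2)]] show ?thesis
          by (simp add: i(2) xy)
      qed
      moreover have "(\<lambda>x\<in>V. inv_into V g x) \<in> Bij V"
        using g by (intro restrict_inv_into_Bij) simp
      ultimately show ?thesis
        by simp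
    qed
    show "g \<otimes>\<^bsub>BijGroup V\<^esub> h \<in> ?H" if "g \<in> ?H" "h \<in> ?H" for g h
      using that Bij_imp_funcset[of h V] compose_Bij[of g V h]
      by (auto simp: BijGroup_def compose_eq Pi_iff)
  qed
  then show ?thesis
    unfolding aut_group_def by (rule subgroup.subgroup_is_group) (rule B.is_group)
qed

locale aut_action =
  fixes V :: "'a set" and E :: "'a set set" and \<Gamma> :: "('a \<Rightarrow> 'a) set"
  assumes clf: "clf_graph V E" and closed: "closed_aut_subgroup V E \<Gamma>"
begin

abbreviation "G \<equiv> (aut_group V E)\<lparr>carrier := \<Gamma>\<rparr>"

lemma simple: "simple_graph V E" and conn: "connected_graph V E" and lf: "locally_finite_graph V E"
  using clf by (auto simp: clf_graph_def)

lemma subgroup: "subgroup \<Gamma> (aut_group V E)"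
  using closed by (simp add: closed_aut_subgroup_def)

lemma \<Gamma>_carrier: "\<Gamma> \<subseteq> carrier (aut_group V E)"
  by (rule subgroup.subset[OF subgroup])

lemma \<Gamma>D:
  assumes "g \<in> \<Gamma>"
  shows "g \<in> Bij V" "\<And>x y. x \<in> V \<Longrightarrow> y \<in> V \<Longrightarrow> {g x, g y} \<in> E \<longleftrightarrow> {x, y} \<in> E"
    "\<And>x. x \<in> V \<Longrightarrow> g x \<in> V" "inj_on g V" "g ` V = V"
  using assms \<Gamma>_carrier by (auto simp: aut_group_def Bij_def bij_betw_def)

lemma mult_eq:
  assumes "g \<in> \<Gamma>" "h \<in> \<Gamma>" shows "g \<otimes>\<^bsub>G\<^esub> h = compose V g h"
  using \<Gamma>D(1) assms by (simp add: aut_group_def BijGroup_def)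

lemma compose_closed:
  assumes "g \<in> \<Gamma>" "h \<in> \<Gamma>" shows "compose V g h \<in> \<Gamma>"
  using subgroup.m_closed[OF subgroup assms] mult_eq[OF assms] by simp

text \<open>
  The elements of the group are extensional functions, and their product is composition restricted
  to \<open>V\<close>; hence inverses are described only by their values on \<open>V\<close>.
\<close>

lemma inverse_ex:
  assumes "g \<in> \<Gamma>"
  obtains h where "h \<in> \<Gamma>" "\<And>x. x \<in> V \<Longrightarrow> h (g x) = x" "\<And>x. x \<in> V \<Longrightarrow> g (h x) = x"
proof -
  interpret group "aut_group V E" by (rule group_aut_group)
  have one: "\<one>\<^bsub>aut_group V E\<^esub> = (\<lambda>x\<in>V. x)"
    by (simp add: aut_group_def BijGroup_def)
  let ?h = "inv\<^bsub>aut_group V E\<^esub> g"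
  have h: "?h \<in> \<Gamma>" by (rule subgroup.m_inv_closed[OF subgroup assms])
  have "compose V ?h g = (\<lambda>x\<in>V. x)" "compose V g ?h = (\<lambda>x\<in>V. x)"
    using l_inv[of g] r_inv[of g] mult_eq[OF h assms] mult_eq[OF assms h] assms \<Gamma>_carrier one by auto
  then have "?h (g x) = x" "g (?h x) = x" if "x \<in> V" for x
    using that by (metis compose_eq restrict_apply')+
  then show thesis
    using h by (intro that)
qed

lemma compose_cancel:
  assumes "g \<in> \<Gamma>" "f \<in> \<Gamma>"
  obtains h k where "h \<in> \<Gamma>" "f = compose V g h" "k \<in> \<Gamma>" "f = compose V k g"
proof -
  obtain i where i: "i \<in> \<Gamma>" "\<And>x. x \<in> V \<Longrightarrow> i (g x) = x" "\<And>x. x \<in> V \<Longrightarrow> g (i x) = x"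
    using inverse_ex[OF assms(1)] by blast
  have ext: "f \<in> extensional V" using \<Gamma>D(1)[OF assms(2)] by (simp add: Bij_def)
  have "f = compose V g (compose V i f)" "f = compose V (compose V f i) g"
    using ext i \<Gamma>D(3)[OF assms(2)] \<Gamma>D(3)[OF assms(1)]
    by (auto simp: compose_def fun_eq_iff extensional_def)
  then show thesis
    using that compose_closed[OF i(1) assms(2)] compose_closed[OF assms(2) i(1)] by blast
qed

subsection \<open>Stabilisers are compact and open\<close>

abbreviation "X \<equiv> product_topology (\<lambda>_. discrete_topology V) V"
abbreviation "T \<equiv> subtopology (aut_topology V E) \<Gamma>"

definition stab :: "'a \<Rightarrow> ('a \<Rightarrow> 'a) set" where
  "stab x = {h \<in> \<Gamma>. h x = x}"

lemma openin_X_eval: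
  assumes "x \<in> V" shows "openin X {h \<in> topspace X. h x = y}"
proof (cases "y \<in> V")
  case True
  have "continuous_map X (discrete_topology V) (\<lambda>h. h x)"
    using assms by (rule continuous_map_product_projection)
  then have "openin X {h \<in> topspace X. h x \<in> {y}}"
    by (rule openin_continuous_map_preimage) (use True in simp)
  then show ?thesis by simp
next
  case False
  then have "{h \<in> topspace X. h x = y} = {}"
    using assms by (auto simp: PiE_iff)
  then show ?thesis by (simp only: openin_empty)
qed

lemma openin_X_agree:
  assumes "finite F" "F \<subseteq> V" shows "openin X {h \<in> topspace X. \<forall>z\<in>F. h z = k z}"
  using assms
proof (induction F)
  case empty
  show ?case using openin_topspace[of X] by (simp del: topspace_product_topology)
next
  case (insert w F)
  have "{h \<in> topspace X. \<forall>z\<in>insert w F. h z = k z}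
      = {h \<in> topspace X. h w = k w} \<inter> {h \<in> topspace X. \<forall>z\<in>F. h z = k z}"
    by blast
  moreover have "openin X \<dots>"
    using insert by (intro openin_Int openin_X_eval) auto
  ultimately show ?case by (simp only:)
qed

lemma \<Gamma>_topspace: "\<Gamma> \<subseteq> topspace X"
proof
  fix g assume "g \<in> \<Gamma>"
  then show "g \<in> topspace X"
    using \<Gamma>D(1)[of g] \<Gamma>D(3)[of g] by (simp add: PiE_iff Bij_def)
qed

lemma openin_T_eval:
  assumes "x \<in> V" shows "openin T {h \<in> \<Gamma>. h x = y}"
proof -
  have "{h \<in> \<Gamma>. h x = y} = {h \<in> topspace X. h x = y} \<inter> carrier (aut_group V E) \<inter> \<Gamma>"
    using subsetD[OF \<Gamma>_topspace] subsetD[OF \<Gamma>_carrier] by blast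
  then show ?thesis
    unfolding aut_topology_def openin_subtopology using openin_X_eval[OF assms] by blast
qed

lemma \<Gamma>_graph_ball:
  assumes "g \<in> \<Gamma>" "x \<in> V" "z \<in> graph_ball E x n"
  shows "g z \<in> graph_ball E (g x) n"
  using assms(3)
proof (induction n arbitrary: z)
  case (Suc n)
  show ?case
  proof (cases "z \<in> graph_ball E x n")
    case False
    then obtain y where y: "y \<in> graph_ball E x n" "{y, z} \<in> E"
      using Suc.prems by (auto simp: nbrs_def)
    have "y \<in> V" "z \<in> V"
      using y graph_ball_subset_vertices[OF simple assms(2)] nbrs_subset_vertices[OF simple, of y]
      by (auto simp: nbrs_def)
    then show ?thesis
      using Suc.IH[OF y(1)] y(2) \<Gamma>D(2)[OF assms(1), of y z] by (auto simp: nbrs_def)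
  qed (use Suc.IH in auto)
qed simp

text \<open>
  A pointwise limit of automorphisms that fix \<open>x\<close> agrees with one of them on every finite set. It
  is therefore injective, respects edges and maps each ball around \<open>x\<close> into itself. Balls are finite,
  so the limit is also onto.
\<close>

lemma closure_stab:
  assumes x: "x \<in> V" and g: "g \<in> X closure_of stab x"
  shows "g \<in> stab x"
proof -
  have gX: "g \<in> topspace X" using g by (simp add: in_closure_of)
  have meets: "\<exists>h. h \<in> stab x \<and> h \<in> U" if "openin X U" "g \<in> U" for U
    using g that by (simp only: in_closure_of)
  have approx: "\<exists>h\<in>stab x. \<forall>z\<in>F. h z = g z" if F: "finite F" "F \<subseteq> V" for F
  proof -
    obtain h where "h \<in> stab x" "h \<in> {h \<in> topspace X. \<forall>z\<in>F. h z = g z}"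
      using meets[OF openin_X_agree[OF F, of g]] gX by auto
    then show ?thesis by auto
  qed
  have gext: "g \<in> extensional V" and gV: "\<And>z. z \<in> V \<Longrightarrow> g z \<in> V"
    using gX by (auto simp: PiE_iff)
  have edges: "{g y, g z} \<in> E \<longleftrightarrow> {y, z} \<in> E" if yz: "y \<in> V" "z \<in> V" for y z
  proof -
    obtain h where "h \<in> \<Gamma>" "h y = g y" "h z = g z"
      using approx[of "{y, z}"] yz by (auto simp: stab_def)
    then show ?thesis using \<Gamma>D(2)[of h y z] yz by simp
  qed
  have inj: "inj_on g V"
  proof (rule inj_onI)
    fix y z assume yz: "y \<in> V" "z \<in> V" "g y = g z"
    then obtain h where "h \<in> \<Gamma>" "h y = g y" "h z = g z"
      using approx[of "{y, z}"] by (auto simp: stab_def)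
    with yz inj_on_eq_iff[OF \<Gamma>D(4)[of h], of y z] show "y = z" by simp
  qed
  have ball: "g ` graph_ball E x n = graph_ball E x n" for n
  proof (rule endo_inj_surj)
    show "finite (graph_ball E x n)" by (rule finite_graph_ball[OF simple lf x])
    show "g ` graph_ball E x n \<subseteq> graph_ball E x n"
    proof
      fix w assume "w \<in> g ` graph_ball E x n"
      then obtain z where z: "z \<in> graph_ball E x n" "w = g z" by blast
      then have "z \<in> V" using graph_ball_subset_vertices[OF simple x] by blast
      then obtain h where "h \<in> \<Gamma>" "h x = x" "h z = g z"
        using approx[of "{z}"] by (auto simp: stab_def)
      with \<Gamma>_graph_ball[of h x z n] x z show "w \<in> graph_ball E x n" by simp
    qed
    show "inj_on g (graph_ball E x n)"
      by (rule inj_on_subset[OF inj graph_ball_subset_vertices[OF simple x]])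
  qed
  have "g ` V = V"
  proof
    show "V \<subseteq> g ` V"
    proof
      fix z assume "z \<in> V"
      then obtain n where "z \<in> graph_ball E x n" using graph_ball_exhausts[OF conn x] by blast
      then have "z \<in> g ` graph_ball E x n" by (simp only: ball)
      then show "z \<in> g ` V" by (rule subsetD[OF image_mono[OF graph_ball_subset_vertices[OF simple x]]])
    qed
  qed (use gV in auto)
  then have gA: "g \<in> carrier (aut_group V E)"
    using edges inj gext by (auto simp: aut_group_def Bij_def bij_betw_def)
  have "g \<in> \<Gamma>"
  proof (rule ccontr)
    assume n: "g \<notin> \<Gamma>"
    have "openin (aut_topology V E) (topspace (aut_topology V E) - \<Gamma>)"
      using closed by (simp add: closed_aut_subgroup_def closedin_def)
    then obtain U where U: "openin X U"
      "topspace (aut_topology V E) - \<Gamma> = U \<inter> carrier (aut_group V E)"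
      unfolding aut_topology_def openin_subtopology by blast
    have "g \<in> topspace (aut_topology V E)"
      using gA gX by (simp add: aut_topology_def)
    with U n have "g \<in> U" by blast
    with U obtain h where "h \<in> stab x" "h \<in> U"
      using meets by metis
    then have h: "h \<in> \<Gamma>" by (simp add: stab_def)
    then have "h \<in> U \<inter> carrier (aut_group V E)"
      using \<Gamma>_carrier \<open>h \<in> U\<close> by blast
    then have "h \<notin> \<Gamma>" unfolding U(2)[symmetric] by simp
    with h show False by simp
  qed
  moreover have "g x = x"
    using approx[of "{x}"] x by (auto simp: stab_def)
  ultimately show ?thesis by (simp add: stab_def)
qed

text \<open>
  By \<open>closure_stab\<close> the stabiliser is closed in a product of finite discrete spaces, namely of balls
  that are large enough to contain the orbits.
\<close>

lemma compactin_stab: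
  assumes x: "x \<in> V" shows "compactin T (stab x)"
proof -
  obtain r where r: "\<And>z. z \<in> V \<Longrightarrow> z \<in> graph_ball E x (r z)"
    using graph_ball_exhausts[OF conn x] by metis
  let ?K = "PiE V (\<lambda>z. graph_ball E x (r z))"
  have K: "compactin X ?K"
    using finite_graph_ball[OF simple lf x] graph_ball_subset_vertices[OF simple x]
    by (auto simp: compactin_PiE compactin_discrete_topology)
  have sub: "stab x \<subseteq> ?K"
  proof
    fix h assume h: "h \<in> stab x"
    then have "h z \<in> graph_ball E x (r z)" if "z \<in> V" for z
      using \<Gamma>_graph_ball[of h x z "r z"] r[OF that] x by (simp add: stab_def)
    moreover have "h \<in> extensional V" using h \<Gamma>D(1)[of h] by (simp add: stab_def Bij_def)
    ultimately show "h \<in> ?K" by (simp add: PiE_iff)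
  qed
  have "stab x \<subseteq> \<Gamma>" by (auto simp: stab_def)
  then have top: "stab x \<subseteq> topspace X" "stab x \<subseteq> carrier (aut_group V E)" "stab x \<subseteq> \<Gamma>"
    using \<Gamma>_topspace \<Gamma>_carrier by (blast dest: subset_trans)+
  have "X closure_of stab x \<subseteq> stab x"
    using closure_stab[OF x] by (rule subsetI)
  with top(1) have "closedin X (stab x)"
    unfolding closure_of_subset_eq[symmetric] by (rule conjI)
  then have "compactin X (stab x)"
    by (rule closed_compactin[OF K sub])
  then show ?thesis
    using top(2,3) by (simp only: aut_topology_def compactin_subtopology simp_thms)
qed

subsection \<open>The mass-transport principle\<close>

lemma left_coset_stab:
  assumes "x \<in> V" "g \<in> \<Gamma>"
  shows "g <#\<^bsub>G\<^esub> stab x = {h \<in> \<Gamma>. h x = g x}"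
proof
  show "g <#\<^bsub>G\<^esub> stab x \<subseteq> {h \<in> \<Gamma>. h x = g x}"
    using assms mult_eq compose_closed by (auto simp: l_coset_def stab_def compose_def)
  show "{h \<in> \<Gamma>. h x = g x} \<subseteq> g <#\<^bsub>G\<^esub> stab x"
  proof
    fix f assume f: "f \<in> {h \<in> \<Gamma>. h x = g x}"
    then obtain h where h: "h \<in> \<Gamma>" "f = compose V g h"
      using compose_cancel[OF assms(2)] by blast
    with f assms have "g (h x) = g x" by (simp add: compose_def)
    then have "h x = x"
      using inj_on_eq_iff[OF \<Gamma>D(4)[OF assms(2)], of "h x" x] \<Gamma>D(3)[OF h(1)] assms(1) by simp
    then show "f \<in> g <#\<^bsub>G\<^esub> stab x"
      using h mult_eq[OF assms(2) h(1)] by (auto simp: l_coset_def stab_def)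
  qed
qed

lemma right_coset_stab:
  assumes "x \<in> V" "g \<in> \<Gamma>" "z \<in> V" "g z = x"
  shows "stab x #>\<^bsub>G\<^esub> g = {h \<in> \<Gamma>. h z = x}"
proof
  show "stab x #>\<^bsub>G\<^esub> g \<subseteq> {h \<in> \<Gamma>. h z = x}"
    using assms mult_eq compose_closed by (auto simp: r_coset_def stab_def compose_def)
  show "{h \<in> \<Gamma>. h z = x} \<subseteq> stab x #>\<^bsub>G\<^esub> g"
  proof
    fix f assume f: "f \<in> {h \<in> \<Gamma>. h z = x}"
    then obtain h where h: "h \<in> \<Gamma>" "f = compose V h g"
      using compose_cancel[OF assms(2)] by blast
    with f assms have "h x = x" by (simp add: compose_def)
    then show "f \<in> stab x #>\<^bsub>G\<^esub> g"
      using h mult_eq[OF h(1) assms(2)] by (auto simp: r_coset_def stab_def)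
  qed
qed

text \<open>
  Split the set of all \<open>h\<close> in the group that move \<open>x\<close> to a neighbour into the pieces \<open>N y z\<close> with
  \<open>h x = y\<close> and \<open>h z = x\<close>. A row of this array is a left coset of the stabiliser of \<open>x\<close> and a
  column is a right coset, so for a measure that is invariant on both sides all rows and columns have
  the same finite positive mass. If \<open>N y z\<close> is not empty, then \<open>f y x = f x z\<close>, and summing over the
  array gives the claim.
\<close>

theorem mass_transport:
  fixes f :: "'a \<Rightarrow> 'a \<Rightarrow> real"
  assumes trans: "transitive_on V \<Gamma>" and uni: "unimodular V E \<Gamma>" and x: "x \<in> V"
    and f: "\<And>g y z. g \<in> \<Gamma> \<Longrightarrow> y \<in> V \<Longrightarrow> z \<in> V \<Longrightarrow> f (g y) (g z) = f y z"
  shows "(\<Sum>y\<in>nbrs E x. f y x) = (\<Sum>y\<in>nbrs E x. f x y)"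
proof -
  obtain \<mu> where haar: "left_haar_measure G T \<mu>" and right: "right_invariant G \<mu>"
    using uni by (auto simp: unimodular_def)
  have sets: "sets \<mu> = sigma_sets \<Gamma> {U. openin T U}" and nz: "emeasure \<mu> \<Gamma> \<noteq> 0"
    and comp: "\<And>K. compactin T K \<Longrightarrow> emeasure \<mu> K < \<infinity>"
    and left: "\<And>g A. g \<in> \<Gamma> \<Longrightarrow> A \<in> sets \<mu> \<Longrightarrow> emeasure \<mu> (g <#\<^bsub>G\<^esub> A) = emeasure \<mu> A"
    using haar by (simp_all add: left_haar_measure_def)
  have right': "\<And>g A. g \<in> \<Gamma> \<Longrightarrow> A \<in> sets \<mu> \<Longrightarrow> emeasure \<mu> (A #>\<^bsub>G\<^esub> g) = emeasure \<mu> A"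
    using right by (simp add: right_invariant_def)
  have ev: "{h \<in> \<Gamma>. h y = z} \<in> sets \<mu>" if "y \<in> V" for y z
    unfolding sets using openin_T_eval[OF that] by (intro sigma_sets.Basic) simp
  define m where "m = emeasure \<mu> (stab x)"
  have st: "stab x \<in> sets \<mu>" using ev[OF x, of x] by (simp add: stab_def)
  have m_fin: "m < \<infinity>" unfolding m_def by (rule comp[OF compactin_stab[OF x]])
  have ml: "emeasure \<mu> {h \<in> \<Gamma>. h x = y} = m" if y: "y \<in> V" for y
  proof -
    obtain g where "g \<in> \<Gamma>" "g x = y" using trans x y by (auto simp: transitive_on_def)
    then show ?thesis using left[OF _ st, of g] left_coset_stab[OF x, of g] by (simp add: m_def)
  qed
  have mr: "emeasure \<mu> {h \<in> \<Gamma>. h z = x} = m" if z: "z \<in> V" for z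
  proof -
    obtain g where "g \<in> \<Gamma>" "g z = x" using trans x z by (auto simp: transitive_on_def)
    then show ?thesis
      using right'[OF _ st, of g] right_coset_stab[OF x, of g z] z by (simp add: m_def)
  qed
  \<comment> \<open>The group is a countable union of cosets of the stabiliser.\<close>
  have m_pos: "m \<noteq> 0"
  proof
    assume "m = 0"
    have U: "\<Gamma> = (\<Union>y\<in>V. {h \<in> \<Gamma>. h x = y})"
    proof
      show "\<Gamma> \<subseteq> (\<Union>y\<in>V. {h \<in> \<Gamma>. h x = y})"
      proof
        fix h assume "h \<in> \<Gamma>"
        then show "h \<in> (\<Union>y\<in>V. {h \<in> \<Gamma>. h x = y})"
          using \<Gamma>D(3)[of h, OF _ x] by simp
      qed
    qed blast
    have "(\<Union>y\<in>V. {h \<in> \<Gamma>. h x = y}) \<in> null_sets \<mu>"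
      using countable_vertices[OF clf] ev[OF x] ml \<open>m = 0\<close>
      by (intro null_sets_UN') (auto intro!: null_setsI)
    then have "emeasure \<mu> (\<Union>y\<in>V. {h \<in> \<Gamma>. h x = y}) = 0" by (rule null_setsD1)
    then have "emeasure \<mu> \<Gamma> = 0" by (simp only: U[symmetric])
    with nz show False by simp
  qed
  define N where "N y z = {h \<in> \<Gamma>. h x = y} \<inter> {h \<in> \<Gamma>. h z = x}" for y z
  have nV: "y \<in> V" if "y \<in> nbrs E x" for y
    using that nbrs_subset_vertices[OF simple] by blast
  have fin: "finite (nbrs E x)" using lf x by (simp add: locally_finite_graph_def)
  have N_sets: "N y z \<in> sets \<mu>" if "z \<in> V" for y z
    unfolding N_def using ev[OF x] ev[OF that] by (intro sets.Int)
  have N_fin: "emeasure \<mu> (N y z) \<noteq> \<infinity>" if "y \<in> V" for y z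
  proof -
    have "emeasure \<mu> (N y z) \<le> emeasure \<mu> {h \<in> \<Gamma>. h x = y}"
      by (rule emeasure_mono) (use ev[OF x] in \<open>auto simp: N_def\<close>)
    with ml[OF that] m_fin show ?thesis by (auto simp: top_unique)
  qed
  have row: "(\<Sum>z\<in>nbrs E x. measure \<mu> (N y z)) = enn2real m" if y: "y \<in> nbrs E x" for y
  proof -
    have "(\<Union>z\<in>nbrs E x. N y z) = {h \<in> \<Gamma>. h x = y}"
    proof
      show "{h \<in> \<Gamma>. h x = y} \<subseteq> (\<Union>z\<in>nbrs E x. N y z)"
      proof
        fix h assume h: "h \<in> {h \<in> \<Gamma>. h x = y}"
        then have "x \<in> h ` V" using \<Gamma>D(5)[of h] x by simp
        then obtain z where z: "z \<in> V" "h z = x" by auto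
        with h y \<Gamma>D(2)[of h x z] x have "z \<in> nbrs E x" by (auto simp: nbrs_def insert_commute)
        with h z show "h \<in> (\<Union>z\<in>nbrs E x. N y z)" by (auto simp: N_def)
      qed
    qed (auto simp: N_def)
    moreover have "disjoint_family_on (\<lambda>z. N y z) (nbrs E x)"
      unfolding disjoint_family_on_def
    proof (intro ballI impI)
      fix z w assume zw: "z \<in> nbrs E x" "w \<in> nbrs E x" "z \<noteq> w"
      have False if "h \<in> N y z \<inter> N y w" for h
        using that inj_on_eq_iff[OF \<Gamma>D(4)[of h], of z w] nV zw by (simp add: N_def)
      then show "N y z \<inter> N y w = {}" by blast
    qed
    then have "measure \<mu> (\<Union>z\<in>nbrs E x. N y z) = (\<Sum>z\<in>nbrs E x. measure \<mu> (N y z))"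
      by (intro measure_finite_Union fin N_fin image_subsetI N_sets nV y)
    ultimately show ?thesis
      using ml[OF nV[OF y]] by (simp add: measure_def)
  qed
  have col: "(\<Sum>y\<in>nbrs E x. measure \<mu> (N y z)) = enn2real m" if z: "z \<in> nbrs E x" for z
  proof -
    have "(\<Union>y\<in>nbrs E x. N y z) = {h \<in> \<Gamma>. h z = x}"
    proof
      show "{h \<in> \<Gamma>. h z = x} \<subseteq> (\<Union>y\<in>nbrs E x. N y z)"
      proof
        fix h assume h: "h \<in> {h \<in> \<Gamma>. h z = x}"
        with z \<Gamma>D(2)[of h x z] x nV[OF z] have "h x \<in> nbrs E x"
          by (auto simp: nbrs_def insert_commute)
        with h show "h \<in> (\<Union>y\<in>nbrs E x. N y z)" by (auto simp: N_def)
      qed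
    qed (auto simp: N_def)
    moreover have "disjoint_family_on (\<lambda>y. N y z) (nbrs E x)"
      by (auto simp: disjoint_family_on_def N_def)
    then have "measure \<mu> (\<Union>y\<in>nbrs E x. N y z) = (\<Sum>y\<in>nbrs E x. measure \<mu> (N y z))"
      by (intro measure_finite_Union fin N_fin image_subsetI N_sets nV z)
    ultimately show ?thesis
      using mr[OF nV[OF z]] by (simp add: measure_def)
  qed
  have key: "measure \<mu> (N y z) * f y x = measure \<mu> (N y z) * f x z" if "y \<in> nbrs E x" "z \<in> nbrs E x" for y z
  proof (cases "N y z = {}")
    case False
    then obtain h where "h \<in> \<Gamma>" "h x = y" "h z = x" by (auto simp: N_def)
    then show ?thesis using f[of h x z] x nV that by simp
  qed simp
  have "enn2real m * (\<Sum>y\<in>nbrs E x. f y x) = (\<Sum>y\<in>nbrs E x. \<Sum>z\<in>nbrs E x. measure \<mu> (N y z) * f y x)"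
    unfolding sum_distrib_left by (intro sum.cong refl) (simp add: row sum_distrib_right[symmetric])
  also have "\<dots> = (\<Sum>y\<in>nbrs E x. \<Sum>z\<in>nbrs E x. measure \<mu> (N y z) * f x z)"
    by (intro sum.cong refl key)
  also have "\<dots> = (\<Sum>z\<in>nbrs E x. \<Sum>y\<in>nbrs E x. measure \<mu> (N y z) * f x z)"
    by (rule sum.swap)
  also have "\<dots> = enn2real m * (\<Sum>z\<in>nbrs E x. f x z)"
    unfolding sum_distrib_left by (intro sum.cong refl) (simp add: col sum_distrib_right[symmetric])
  finally show ?thesis
    using m_pos m_fin by (auto simp: enn2real_eq_0_iff)
qed

end

section \<open>Percolation and the Green function\<close>

lemma bounded_degree_subgraph:
  assumes "bounded_degree_graph V E D" "\<omega> \<subseteq> E"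
  shows "bounded_degree_graph V \<omega> D"
proof -
  interpret bounded_degree_graph V E D by fact
  have sub: "nbrs \<omega> x \<subseteq> nbrs E x" for x
    using assms(2) by (auto simp: nbrs_def)
  show ?thesis
  proof
    show "simple_graph V \<omega>" using simple assms(2) by (auto simp: simple_graph_def)
    show "finite (nbrs \<omega> x)" if "x \<in> V" for x
      using finite_subset[OF sub finite_nbrs[OF that]] .
    show "real (card (nbrs \<omega> x)) \<le> D" if "x \<in> V" for x
      using card_mono[OF finite_nbrs[OF that] sub] degree_le[OF that] by linarith
  qed (rule D_pos)
qed

lemma laplacian_subgraph:
  assumes "finite (nbrs E x)" "\<omega> \<subseteq> E"
  shows "laplacian \<omega> f x = (\<Sum>y\<in>nbrs E x. indicator \<omega> {x, y} * (f x - f y))"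
proof -
  have "(\<Sum>y\<in>nbrs E x. indicator \<omega> {x, y} * (f x - f y)) = (\<Sum>y\<in>nbrs \<omega> x. indicator \<omega> {x, y} * (f x - f y))"
    using assms by (intro sum.mono_neutral_right) (auto simp: nbrs_def)
  also have "\<dots> = laplacian \<omega> f x"
    unfolding laplacian_def by (intro sum.cong refl) (simp add: nbrs_def)
  finally show ?thesis ..
qed

lemma laplacian_cong_on:
  assumes "bounded_degree_graph V E D" "x \<in> V" "\<And>y. y \<in> V \<Longrightarrow> f y = f' y"
  shows "laplacian E f x = laplacian E f' x"
  unfolding laplacian_def using bounded_degree_graph.nbrs_subset[OF assms(1)] assms(2,3)
  by (intro sum.cong refl) (metis subsetD)

lemma space_subset_space: "space (subset_space X) = Pow X"
  unfolding subset_space_def by (rule space_measure_of) auto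

lemma sets_subset_space: "sets (subset_space X) = sigma_sets (Pow X) ((\<lambda>x. {S \<in> Pow X. x \<in> S}) ` X)"
  unfolding subset_space_def by (rule sets_measure_of) auto

lemma subset_space_Basic: "x \<in> X \<Longrightarrow> {S \<in> Pow X. x \<in> S} \<in> sets (subset_space X)"
  unfolding sets_subset_space by (rule sigma_sets.Basic) simp

lemma percolation_space:
  assumes "bond_percolation E P" shows "space P = Pow E"
  using sets_eq_imp_space_eq[of P "subset_space E"] assms
  by (simp add: bond_percolation_def space_subset_space)

lemma measurable_indicator_edge:
  assumes P: "bond_percolation E P" and e: "e \<in> E"
  shows "(\<lambda>\<omega>. indicator \<omega> e :: real) \<in> borel_measurable P"
proof -
  have "{\<omega> \<in> space P. e \<in> \<omega>} \<in> sets P"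
    using subset_space_Basic[OF e] P by (simp add: percolation_space bond_percolation_def)
  then have "(indicator {\<omega> \<in> space P. e \<in> \<omega>} :: _ \<Rightarrow> real) \<in> borel_measurable P"
    by (rule borel_measurable_indicator)
  then show ?thesis
    by (rule measurable_cong[THEN iffD1, rotated]) (auto simp: indicator_def)
qed

lemma measurable_laplacian:
  assumes G: "bounded_degree_graph V E D" and P: "bond_percolation E P" and x: "x \<in> V"
    and f: "\<And>z. z \<in> V \<Longrightarrow> (\<lambda>\<omega>. f \<omega> z) \<in> borel_measurable P"
  shows "(\<lambda>\<omega>. laplacian \<omega> (f \<omega>) x) \<in> borel_measurable P"
proof -
  interpret bounded_degree_graph V E D by fact
  have "(\<lambda>\<omega>. \<Sum>y\<in>nbrs E x. indicator \<omega> {x, y} * (f \<omega> x - f \<omega> y)) \<in> borel_measurable P"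
    using f x nbrs_subset
    by (intro borel_measurable_sum borel_measurable_times borel_measurable_diff
        measurable_indicator_edge[OF P]) (auto simp: nbrs_def)
  then show ?thesis
    by (rule measurable_cong[THEN iffD1, rotated])
      (simp add: laplacian_subgraph[OF finite_nbrs[OF x]] percolation_space[OF P])
qed

lemma measurable_green:
  assumes G: "bounded_degree_graph V E D" and P: "bond_percolation E P" and x: "x \<in> V"
  shows "(\<lambda>\<omega>. green \<omega> D \<epsilon> y x) \<in> borel_measurable P"
proof -
  have walk: "(\<lambda>\<omega>. lazy_walk \<omega> D y k z) \<in> borel_measurable P" if "z \<in> V" for k z
    using that
  proof (induction k arbitrary: z)
    case 0
    show ?case by (simp add: lazy_walk_def)
  next
    case (Suc k)
    have "(\<lambda>\<omega>. lazy_walk \<omega> D y k z - laplacian \<omega> (lazy_walk \<omega> D y k) z / D) \<in> borel_measurable P"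
      by (intro borel_measurable_diff borel_measurable_divide borel_measurable_const
          measurable_laplacian[OF G P] Suc)
    then show ?case by (simp add: lazy_walk_def lazy_step_def)
  qed
  show ?thesis
    unfolding green_def
    by (intro borel_measurable_suminf borel_measurable_times borel_measurable_const walk x)
qed

lemma measurable_resistance:
  assumes G: "bounded_degree_graph V E D" and P: "bond_percolation E P" and "x \<in> V" "y \<in> V"
  shows "(\<lambda>\<omega>. resistance \<omega> D \<epsilon> x y) \<in> borel_measurable P"
  unfolding resistance_def dipole_def
  by (intro borel_measurable_diff measurable_green[OF G P] assms)

context aut_action
begin

lemma act_edges_iff:
  assumes g: "g \<in> \<Gamma>" and \<omega>: "\<omega> \<subseteq> E" and xy: "x \<in> V" "y \<in> V"
  shows "{g x, g y} \<in> act_edges g \<omega> \<longleftrightarrow> {x, y} \<in> \<omega>"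
proof
  assume "{g x, g y} \<in> act_edges g \<omega>"
  then obtain e where e: "e \<in> \<omega>" "g ` e = g ` {x, y}"
    by (auto simp: act_edges_def)
  have "e \<subseteq> V" using e(1) \<omega> simple by (fastforce simp: simple_graph_def)
  then have "e = {x, y}"
    using e(2) xy inj_on_image_eq_iff[OF \<Gamma>D(4)[OF g], of e "{x, y}"] by simp
  then show "{x, y} \<in> \<omega>" using e(1) by simp
next
  assume "{x, y} \<in> \<omega>"
  then have "g ` {x, y} \<in> act_edges g \<omega>" unfolding act_edges_def by (rule imageI)
  then show "{g x, g y} \<in> act_edges g \<omega>" by simp
qed

lemma edge_cases:
  assumes "e \<in> E" obtains x y where "x \<in> V" "y \<in> V" "e = {x, y}"
  using assms simple by (auto simp: simple_graph_def)

lemma act_edges_subset: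
  assumes g: "g \<in> \<Gamma>" and \<omega>: "\<omega> \<subseteq> E" shows "act_edges g \<omega> \<subseteq> E"
proof
  fix e assume "e \<in> act_edges g \<omega>"
  then obtain e' where e': "e' \<in> \<omega>" "e = g ` e'" by (auto simp: act_edges_def)
  then obtain x y where "x \<in> V" "y \<in> V" "e' = {x, y}" using \<omega> edge_cases[of e'] by blast
  then show "e \<in> E" using e' \<omega> \<Gamma>D(2)[OF g, of x y] by auto
qed

lemma edge_preimage:
  assumes g: "g \<in> \<Gamma>" and e: "e \<in> E"
  obtains x y where "x \<in> V" "y \<in> V" "e = {g x, g y}" "{x, y} \<in> E"
proof -
  obtain a b where ab: "a \<in> V" "b \<in> V" "e = {a, b}" using edge_cases[OF e] by blast
  then have "a \<in> g ` V" "b \<in> g ` V" using \<Gamma>D(5)[OF g] by simp_all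
  then obtain x y where xy: "x \<in> V" "y \<in> V" "a = g x" "b = g y" by auto
  then show thesis using that ab e \<Gamma>D(2)[OF g xy(1,2)] by simp
qed

lemma act_edges_E:
  assumes g: "g \<in> \<Gamma>" shows "act_edges g E = E"
proof
  show "E \<subseteq> act_edges g E"
  proof
    fix e assume "e \<in> E"
    then obtain x y where "x \<in> V" "y \<in> V" "e = {g x, g y}" "{x, y} \<in> E"
      using edge_preimage[OF g] by blast
    then show "e \<in> act_edges g E" using act_edges_iff[OF g subset_refl, of x y] by simp
  qed
qed (rule act_edges_subset[OF g subset_refl])

lemma nbrs_act_edges:
  assumes g: "g \<in> \<Gamma>" and \<omega>: "\<omega> \<subseteq> E" and x: "x \<in> V"
  shows "nbrs (act_edges g \<omega>) (g x) = g ` nbrs \<omega> x"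
proof
  show "g ` nbrs \<omega> x \<subseteq> nbrs (act_edges g \<omega>) (g x)"
  proof
    fix w assume "w \<in> g ` nbrs \<omega> x"
    then obtain y where y: "{x, y} \<in> \<omega>" "w = g y" by (auto simp: nbrs_def)
    then have "y \<in> V" using \<omega> nbrs_subset_vertices[OF simple, of x] by (auto simp: nbrs_def)
    then show "w \<in> nbrs (act_edges g \<omega>) (g x)"
      using y act_edges_iff[OF g \<omega> x] by (simp add: nbrs_def)
  qed
  show "nbrs (act_edges g \<omega>) (g x) \<subseteq> g ` nbrs \<omega> x"
  proof
    fix w assume w: "w \<in> nbrs (act_edges g \<omega>) (g x)"
    then have "w \<in> nbrs E (g x)" using act_edges_subset[OF g \<omega>] by (auto simp: nbrs_def)
    then have "w \<in> g ` V" using nbrs_subset_vertices[OF simple] \<Gamma>D(5)[OF g] by auto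
    then obtain y where y: "y \<in> V" "w = g y" by auto
    then show "w \<in> g ` nbrs \<omega> x"
      using w act_edges_iff[OF g \<omega> x y(1)] by (simp add: nbrs_def)
  qed
qed

lemma laplacian_act_edges:
  assumes g: "g \<in> \<Gamma>" and \<omega>: "\<omega> \<subseteq> E" and x: "x \<in> V"
  shows "laplacian (act_edges g \<omega>) f (g x) = laplacian \<omega> (\<lambda>z. f (g z)) x"
proof -
  have "nbrs \<omega> x \<subseteq> V"
    using nbrs_subset_vertices[OF simple, of x] \<omega> by (auto simp: nbrs_def)
  then have "inj_on g (nbrs \<omega> x)" using inj_on_subset[OF \<Gamma>D(4)[OF g]] by blast
  then show ?thesis
    unfolding laplacian_def nbrs_act_edges[OF assms] by (simp add: sum.reindex)
qed

lemma bounded_degree: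
  assumes trans: "transitive_on V \<Gamma>"
  obtains D where "bounded_degree_graph V E D"
proof -
  obtain x where x: "x \<in> V" using conn by (auto simp: connected_graph_def)
  have fin: "finite (nbrs E y)" if "y \<in> V" for y
    using lf that by (simp add: locally_finite_graph_def)
  have "card (nbrs E y) = card (nbrs E x)" if y: "y \<in> V" for y
  proof -
    obtain g where g: "g \<in> \<Gamma>" "g x = y" using trans x y by (auto simp: transitive_on_def)
    have "inj_on g (nbrs E x)"
      using inj_on_subset[OF \<Gamma>D(4)[OF g(1)] nbrs_subset_vertices[OF simple]] .
    then show ?thesis
      using nbrs_act_edges[OF g(1) subset_refl x] g by (simp add: act_edges_E card_image)
  qed
  then have "bounded_degree_graph V E (real (card (nbrs E x)) + 1)"
    by unfold_locales (use simple fin in auto)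
  then show thesis by (rule that)
qed

text \<open>
  The equality holds for each step of the lazy walk, since the Laplacian commutes with automorphisms.
\<close>

lemma green_act_edges:
  assumes G: "bounded_degree_graph V E D" and g: "g \<in> \<Gamma>" and \<omega>: "\<omega> \<subseteq> E" and xy: "x \<in> V" "y \<in> V"
  shows "green (act_edges g \<omega>) D \<epsilon> (g y) (g x) = green \<omega> D \<epsilon> y x"
proof -
  have "lazy_walk (act_edges g \<omega>) D (g y) k (g z) = lazy_walk \<omega> D y k z" if "z \<in> V" for k z
    using that
  proof (induction k arbitrary: z)
    case 0
    then show ?case
      using inj_on_eq_iff[OF \<Gamma>D(4)[OF g], of z y] xy(2) by (simp add: lazy_walk_def indicator_def)
  next
    case (Suc k)
    have "laplacian (act_edges g \<omega>) (lazy_walk (act_edges g \<omega>) D (g y) k) (g z)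
        = laplacian \<omega> (lazy_walk \<omega> D y k) z"
      unfolding laplacian_act_edges[OF g \<omega> Suc.prems]
      by (rule laplacian_cong_on[OF bounded_degree_subgraph[OF G \<omega>] Suc.prems Suc.IH])
    then show ?case
      using Suc.IH[OF Suc.prems] by (simp add: lazy_walk_def lazy_step_def)
  qed
  then show ?thesis unfolding green_def using xy by simp
qed

lemma measurable_act_edges:
  assumes P: "bond_percolation E P" and g: "g \<in> \<Gamma>"
  shows "act_edges g \<in> measurable P (subset_space E)"
  unfolding subset_space_def
proof (rule measurable_sigma_sets[OF sets_measure_of])
  show "act_edges g \<in> space P \<rightarrow> Pow E"
    using act_edges_subset[OF g] by (auto simp: percolation_space[OF P])
  fix A assume "A \<in> (\<lambda>x. {S \<in> Pow E. x \<in> S}) ` E"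
  then obtain e where e: "e \<in> E" "A = {S \<in> Pow E. e \<in> S}" by auto
  obtain x y where xy: "x \<in> V" "y \<in> V" "e = {g x, g y}" "{x, y} \<in> E"
    using edge_preimage[OF g e(1)] by blast
  have "act_edges g -` A \<inter> space P = {S \<in> Pow E. {x, y} \<in> S}"
    using act_edges_iff[OF g _ xy(1,2)] act_edges_subset[OF g] xy(3)
    by (auto simp: e(2) percolation_space[OF P])
  then show "act_edges g -` A \<inter> space P \<in> sets P"
    using subset_space_Basic[OF xy(4)] P by (simp add: bond_percolation_def)
qed auto

lemma expectation_invariant:
  fixes F :: "'a set set \<Rightarrow> real"
  assumes P: "invariant_percolation E \<Gamma> P" and g: "g \<in> \<Gamma>" and F: "F \<in> borel_measurable P"
  shows "(\<integral>\<omega>. F (act_edges g \<omega>) \<partial>P) = (\<integral>\<omega>. F \<omega> \<partial>P)"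
proof -
  have bp: "bond_percolation E P" and d: "distr P (subset_space E) (act_edges g) = P"
    using P g by (auto simp: invariant_percolation_def)
  have "F \<in> borel_measurable (subset_space E)"
    using F bp measurable_cong_sets[OF _ refl, of P "subset_space E"] unfolding bond_percolation_def by blast
  from integral_distr[OF measurable_act_edges[OF bp g] this] show ?thesis
    by (simp add: d)
qed

text \<open>
  Mass transport for the function \<open>f a b\<close>, the expectation of \<open>green \<omega> D \<epsilon> a a - green \<omega> D \<epsilon> a b\<close> on
  the event that \<open>{a, b}\<close> is open. Each resistance is \<open>f x y + f y x\<close>, and the sum of \<open>f x y\<close> over
  \<open>y\<close> is an expected Laplacian of the Green function at its pole.
\<close>

theorem expected_resistance_sum:
  assumes G: "bounded_degree_graph V E D" and trans: "transitive_on V \<Gamma>" and uni: "unimodular V E \<Gamma>"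
    and P: "invariant_percolation E \<Gamma> P" and x: "x \<in> V" and eps: "\<epsilon> > 0"
  shows "(\<Sum>y\<in>nbrs E x. \<integral>\<omega>. indicator \<omega> {x, y} * resistance \<omega> D \<epsilon> x y \<partial>P)
    = 2 * (1 - \<epsilon> * (\<integral>\<omega>. green \<omega> D \<epsilon> x x \<partial>P))"
proof -
  have bp: "bond_percolation E P" using P by (simp add: invariant_percolation_def)
  interpret prob_space P using bp by (simp add: bond_percolation_def)
  interpret bounded_degree_graph V E D by fact
  have sp: "space P = Pow E" by (rule percolation_space[OF bp])
  have nV: "y \<in> V" if "y \<in> nbrs E x" for y using that nbrs_subset by blast
  have green_int: "integrable P (\<lambda>\<omega>. green \<omega> D \<epsilon> a b)" if "a \<in> V" "b \<in> V" for a b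
  proof (rule integrable_const_bound)
    have "\<bar>green \<omega> D \<epsilon> a b\<bar> \<le> 1 / \<epsilon>" if "\<omega> \<in> space P" for \<omega>
    proof -
      interpret w: bounded_degree_graph V \<omega> D
        using that sp by (intro bounded_degree_subgraph[OF G]) auto
      show ?thesis
        using w.green_nonneg[OF eps] w.green_le[OF eps] \<open>a \<in> V\<close> \<open>b \<in> V\<close> by simp
    qed
    then show "AE \<omega> in P. norm (green \<omega> D \<epsilon> a b) \<le> 1 / \<epsilon>" by (auto intro: AE_I2)
  qed (rule measurable_green[OF G bp that(2)])
  define F where "F a b \<omega> = indicator \<omega> {a, b} * (green \<omega> D \<epsilon> a a - green \<omega> D \<epsilon> a b)"
    for a b and \<omega> :: "'a set set"
  have F_int: "integrable P (F a b)" if "a \<in> V" "b \<in> V" "{a, b} \<in> E" for a b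
  proof (rule Bochner_Integration.integrable_bound)
    show "integrable P (\<lambda>\<omega>. green \<omega> D \<epsilon> a a - green \<omega> D \<epsilon> a b)"
      by (intro Bochner_Integration.integrable_diff green_int that)
    show "F a b \<in> borel_measurable P"
      unfolding F_def[abs_def]
      by (intro borel_measurable_times borel_measurable_diff measurable_indicator_edge[OF bp]
          measurable_green[OF G bp] that)
    show "AE \<omega> in P. norm (F a b \<omega>) \<le> norm (green \<omega> D \<epsilon> a a - green \<omega> D \<epsilon> a b)"
      by (intro AE_I2) (simp add: F_def indicator_def)
  qed
  define f where "f a b = (if {a, b} \<in> E then \<integral>\<omega>. F a b \<omega> \<partial>P else 0)" for a b
  have f_inv: "f (g a) (g b) = f a b" if g: "g \<in> \<Gamma>" and ab: "a \<in> V" "b \<in> V" for g a b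
  proof (cases "{a, b} \<in> E")
    case True
    then have gE: "{g a, g b} \<in> E" using \<Gamma>D(2)[OF g ab] by simp
    have "(\<integral>\<omega>. F (g a) (g b) \<omega> \<partial>P) = (\<integral>\<omega>. F (g a) (g b) (act_edges g \<omega>) \<partial>P)"
      by (rule expectation_invariant[OF P g, symmetric])
        (rule borel_measurable_integrable[OF F_int[OF \<Gamma>D(3)[OF g ab(1)] \<Gamma>D(3)[OF g ab(2)] gE]])
    also have "\<dots> = (\<integral>\<omega>. F a b \<omega> \<partial>P)"
    proof (rule Bochner_Integration.integral_cong[OF refl])
      fix \<omega> assume "\<omega> \<in> space P"
      then have "\<omega> \<subseteq> E" by (simp add: sp)
      then show "F (g a) (g b) (act_edges g \<omega>) = F a b \<omega>"
        using act_edges_iff[OF g _ ab] green_act_edges[OF G g] ab by (simp add: F_def indicator_def)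
    qed
    finally show ?thesis using True gE by (simp add: f_def)
  next
    case False
    then show ?thesis using \<Gamma>D(2)[OF g ab] by (simp add: f_def)
  qed
  have "(\<integral>\<omega>. indicator \<omega> {x, y} * resistance \<omega> D \<epsilon> x y \<partial>P) = f x y + f y x" if y: "y \<in> nbrs E x" for y
  proof -
    have e: "{x, y} \<in> E" "{y, x} \<in> E" using y by (auto simp: nbrs_def insert_commute)
    have "(\<integral>\<omega>. indicator \<omega> {x, y} * resistance \<omega> D \<epsilon> x y \<partial>P) = (\<integral>\<omega>. F x y \<omega> + F y x \<omega> \<partial>P)"
    proof (rule Bochner_Integration.integral_cong[OF refl])
      fix \<omega> assume "\<omega> \<in> space P"
      then interpret w: bounded_degree_graph V \<omega> D
        using sp by (intro bounded_degree_subgraph[OF G]) auto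
      show "indicator \<omega> {x, y} * resistance \<omega> D \<epsilon> x y = F x y \<omega> + F y x \<omega>"
        using w.resistance_eq[OF eps, of x y]
        by (simp add: F_def insert_commute[of y x] distrib_left)
    qed
    also have "\<dots> = f x y + f y x"
      using F_int x nV[OF y] e by (simp add: f_def)
    finally show ?thesis .
  qed
  then have "(\<Sum>y\<in>nbrs E x. \<integral>\<omega>. indicator \<omega> {x, y} * resistance \<omega> D \<epsilon> x y \<partial>P)
      = (\<Sum>y\<in>nbrs E x. f x y) + (\<Sum>y\<in>nbrs E x. f y x)"
    by (simp add: sum.distrib)
  also have "(\<Sum>y\<in>nbrs E x. f y x) = (\<Sum>y\<in>nbrs E x. f x y)"
    by (rule mass_transport[OF trans uni x f_inv])
  also have "(\<Sum>y\<in>nbrs E x. f x y) = (\<integral>\<omega>. (\<Sum>y\<in>nbrs E x. F x y \<omega>) \<partial>P)"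
    using F_int x nV by (subst Bochner_Integration.integral_sum) (auto simp: f_def nbrs_def)
  also have "\<dots> = (\<integral>\<omega>. 1 - \<epsilon> * green \<omega> D \<epsilon> x x \<partial>P)"
  proof (rule Bochner_Integration.integral_cong[OF refl])
    fix \<omega> assume "\<omega> \<in> space P"
    then have \<omega>: "\<omega> \<subseteq> E" by (simp add: sp)
    then interpret w: bounded_degree_graph V \<omega> D
      by (rule bounded_degree_subgraph[OF G])
    have "(\<Sum>y\<in>nbrs E x. F x y \<omega>) = laplacian \<omega> (green \<omega> D \<epsilon> x) x"
      unfolding laplacian_subgraph[OF finite_nbrs[OF x] \<omega>] F_def ..
    also have "\<dots> = 1 - \<epsilon> * green \<omega> D \<epsilon> x x"
      using w.green_equation[OF eps x x] by simp
    finally show "(\<Sum>y\<in>nbrs E x. F x y \<omega>) = 1 - \<epsilon> * green \<omega> D \<epsilon> x x" .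
  qed
  also have "\<dots> = 1 - \<epsilon> * (\<integral>\<omega>. green \<omega> D \<epsilon> x x \<partial>P)"
    using green_int[OF x x] by (simp add: prob_space)
  finally show ?thesis by simp
qed

text \<open>
  The counterpart for the percolation in which every edge is open.
\<close>

lemma resistance_sum:
  assumes G: "bounded_degree_graph V E D" and trans: "transitive_on V \<Gamma>" and uni: "unimodular V E \<Gamma>"
    and x: "x \<in> V" and eps: "\<epsilon> > 0"
  shows "(\<Sum>y\<in>nbrs E x. resistance E D \<epsilon> x y) = 2 * (1 - \<epsilon> * green E D \<epsilon> x x)"
proof -
  interpret bounded_degree_graph V E D by fact
  define f where "f a b = green E D \<epsilon> a a - green E D \<epsilon> a b" for a b
  have "f (g a) (g b) = f a b" if "g \<in> \<Gamma>" "a \<in> V" "b \<in> V" for g a b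
    using green_act_edges[OF G that(1) subset_refl] that by (simp add: f_def act_edges_E)
  from mass_transport[OF trans uni x this] have "(\<Sum>y\<in>nbrs E x. f y x) = (\<Sum>y\<in>nbrs E x. f x y)" .
  moreover have "resistance E D \<epsilon> x y = f x y + f y x" if "y \<in> nbrs E x" for y
    using resistance_eq[OF eps, of x y] that nbrs_subset by (auto simp: f_def)
  moreover have "(\<Sum>y\<in>nbrs E x. f x y) = 1 - \<epsilon> * green E D \<epsilon> x x"
    using sum_green_diff_nbrs[OF eps x] by (simp add: f_def)
  ultimately show ?thesis by (simp add: sum.distrib)
qed

end

section \<open>Percolations without harmonic Dirichlet functions\<close>

context bounded_degree_graph
begin

text \<open>
  The dipole at the larger killing rate is a competitor in the variational bound at the smaller one.
\<close>

lemma resistance_antimono: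
  assumes eps: "0 < \<epsilon>'" "\<epsilon>' \<le> \<epsilon>" and xy: "x \<in> V" "y \<in> V"
  shows "resistance E D \<epsilon> x y \<le> resistance E D \<epsilon>' x y"
proof -
  have pos: "0 < \<epsilon>" using eps by linarith
  let ?d = "dipole E D \<epsilon> x y" and ?r = "resistance E D \<epsilon> x y" and ?r' = "resistance E D \<epsilon>' x y"
  note nn = resistance_nonneg[OF pos xy] resistance_nonneg[OF eps(1) xy]
  have "?r\<^sup>2 \<le> (energy E ?d ?d + \<epsilon>' * inner_on V ?d ?d) * ?r'"
    using resistance_bound[OF eps(1) dipole_sq_summable[OF pos xy] xy]
    by (simp add: resistance_def[of E D \<epsilon>])
  also have "\<dots> \<le> (energy E ?d ?d + \<epsilon> * inner_on V ?d ?d) * ?r'"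
    by (intro mult_right_mono add_left_mono eps nn inner_on_nonneg)
  also have "energy E ?d ?d + \<epsilon> * inner_on V ?d ?d = ?r"
    using killed_form_dipole_self[OF pos xy] by (simp add: killed_form_def[OF pos])
  finally have "?r * ?r \<le> ?r * ?r'" by (simp add: power2_eq_square)
  then show ?thesis
    using nn by (cases "?r = 0") (auto simp: mult_le_cancel_left)
qed

end

text \<open>
  Constancy is required on edges only, so the graph need not be connected: the condition says that no
  component carries a nonconstant harmonic function of finite energy.
\<close>

definition liouville :: "'a set \<Rightarrow> 'a set set \<Rightarrow> bool" where
  "liouville V E \<longleftrightarrow> (\<forall>h x y. finite_energy E h \<longrightarrow> (\<forall>z\<in>V. laplacian E h z = 0) \<longrightarrow> {x, y} \<in> E \<longrightarrow> h x = h y)"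

context aut_action
begin

text \<open>
  For an open edge \<open>{x, y}\<close> the potential \<open>u\<close> of \<open>free_resistance_lower_bound\<close> on the whole graph is
  a test function on the percolation cluster, where the free resistance equals the wired one. Thus the
  wired resistance of the cluster is at least \<open>\<rho>\<close>, and it averages to at most two.
\<close>

theorem liouville_percolation_marginals:
  assumes G: "bounded_degree_graph V E D" and trans: "transitive_on V \<Gamma>" and uni: "unimodular V E \<Gamma>"
    and inf: "infinite V" and P: "invariant_percolation E \<Gamma> P"
    and liou: "AE \<omega> in P. liouville V \<omega>"
    and h: "finite_energy E h" "\<And>z. z \<in> V \<Longrightarrow> laplacian E h z = 0" "energy E h h > 0"
    and x: "x \<in> V"
    and q: "q \<ge> 0" "\<And>e. e \<in> E \<Longrightarrow> q \<le> measure P {\<omega> \<in> space P. e \<in> \<omega>}"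
  shows "q * (2 + (\<Sum>y\<in>nbrs E x. (h x - h y)\<^sup>2 / energy E h h)) \<le> 2"
proof -
  have bp: "bond_percolation E P" using P by (simp add: invariant_percolation_def)
  interpret prob_space P using bp by (simp add: bond_percolation_def)
  interpret bounded_degree_graph V E D by fact
  have sp: "space P = Pow E" by (rule percolation_space[OF bp])
  have nV: "y \<in> V" if "y \<in> nbrs E x" for y using that nbrs_subset by blast
  have nE: "{x, y} \<in> E" if "y \<in> nbrs E x" for y using that by (simp add: nbrs_def)
  define e where "e k = inverse (real (Suc k))" for k
  have e: "e k > 0" "e \<longlonglongrightarrow> 0" and e_mono: "k \<le> l \<Longrightarrow> e l \<le> e k" for k l
    using LIMSEQ_inverse_real_of_nat by (auto simp: e_def[abs_def] intro!: le_imp_inverse_le)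
  define F where "F k y \<omega> = indicator \<omega> {x, y} * resistance \<omega> D (e k) x y"
    for k y and \<omega> :: "'a set set"
  define L where "L y \<omega> = lim (\<lambda>k. F k y \<omega>)" for y \<omega>
  have F_meas: "F k y \<in> borel_measurable P" if "y \<in> nbrs E x" for k y
    unfolding F_def[abs_def]
    by (intro borel_measurable_times measurable_indicator_edge[OF bp] measurable_resistance[OF G bp]
        nV nE x that)
  have F_bounds: "0 \<le> F k y \<omega>" "F k y \<omega> \<le> 1" and F_mono: "incseq (\<lambda>k. F k y \<omega>)"
    if y: "y \<in> nbrs E x" and w: "\<omega> \<in> space P" for k y \<omega>
  proof -
    interpret w: bounded_degree_graph V \<omega> D
      using w sp by (intro bounded_degree_subgraph[OF G]) auto
    show "0 \<le> F k y \<omega>" using w.resistance_nonneg[OF e(1) x nV[OF y]] by (simp add: F_def)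
    show "F k y \<omega> \<le> 1" using w.resistance_edge_le_1[OF e(1), of x y] by (simp add: F_def indicator_def)
    show "incseq (\<lambda>k. F k y \<omega>)"
      using w.resistance_antimono[OF e(1) e_mono x nV[OF y]]
      by (auto intro!: incseq_SucI mult_left_mono simp: F_def)
  qed
  have F_lim: "(\<lambda>k. F k y \<omega>) \<longlonglongrightarrow> L y \<omega>" if "y \<in> nbrs E x" "\<omega> \<in> space P" for y \<omega>
  proof -
    have "convergent (\<lambda>k. F k y \<omega>)"
      using F_bounds[OF that] F_mono[OF that]
      by (intro Bseq_mono_convergent BseqI'[of _ 1]) (auto simp: incseq_def)
    then show ?thesis by (simp add: L_def convergent_LIMSEQ_iff)
  qed
  have L_meas: "L y \<in> borel_measurable P" if "y \<in> nbrs E x" for y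
    by (rule borel_measurable_LIMSEQ_real[OF F_lim F_meas]) (use that in auto)
  have L_int: "integrable P (L y)" and L_lim: "(\<lambda>k. \<integral>\<omega>. F k y \<omega> \<partial>P) \<longlonglongrightarrow> (\<integral>\<omega>. L y \<omega> \<partial>P)"
    if y: "y \<in> nbrs E x" for y
  proof -
    have bd: "AE \<omega> in P. norm (F k y \<omega>) \<le> 1" for k
      using F_bounds[OF y] by (intro AE_I2) auto
    have lim: "AE \<omega> in P. (\<lambda>k. F k y \<omega>) \<longlonglongrightarrow> L y \<omega>"
      using F_lim[OF y] by (intro AE_I2)
    show "integrable P (L y)"
      by (rule integrable_dominated_convergence[OF L_meas[OF y] F_meas[OF y] integrable_const lim bd])
    show "(\<lambda>k. \<integral>\<omega>. F k y \<omega> \<partial>P) \<longlonglongrightarrow> (\<integral>\<omega>. L y \<omega> \<partial>P)"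
      by (rule integral_dominated_convergence[OF L_meas[OF y] F_meas[OF y] integrable_const lim bd])
  qed
  have upper: "(\<Sum>y\<in>nbrs E x. \<integral>\<omega>. L y \<omega> \<partial>P) \<le> 2"
  proof (rule LIMSEQ_le_const2)
    show "(\<lambda>k. \<Sum>y\<in>nbrs E x. \<integral>\<omega>. F k y \<omega> \<partial>P) \<longlonglongrightarrow> (\<Sum>y\<in>nbrs E x. \<integral>\<omega>. L y \<omega> \<partial>P)"
      by (intro tendsto_sum L_lim)
    have "(\<Sum>y\<in>nbrs E x. \<integral>\<omega>. F k y \<omega> \<partial>P) \<le> 2" for k
    proof -
      have "0 \<le> (\<integral>\<omega>. green \<omega> D (e k) x x \<partial>P)"
      proof (rule integral_nonneg_AE, rule AE_I2)
        fix \<omega> assume "\<omega> \<in> space P"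
        then interpret w: bounded_degree_graph V \<omega> D
          using sp by (intro bounded_degree_subgraph[OF G]) auto
        show "0 \<le> green \<omega> D (e k) x x" by (rule w.green_nonneg[OF e(1) x x])
      qed
      then show ?thesis
        unfolding F_def using expected_resistance_sum[OF G trans uni P x e(1), of k] e(1)[of k]
        by simp
    qed
    then show "\<exists>N. \<forall>k\<ge>N. (\<Sum>y\<in>nbrs E x. \<integral>\<omega>. F k y \<omega> \<partial>P) \<le> 2" by blast
  qed
  \<comment> \<open>A lower bound for the free resistance of the edge \<open>{x, y}\<close> in the whole graph.\<close>
  define \<rho> where "\<rho> j y = resistance E D (e j) x y + (h x - h y)\<^sup>2 / energy E h h" for j y
  have lower: "q * \<rho> j y \<le> (\<integral>\<omega>. L y \<omega> \<partial>P)" if y: "y \<in> nbrs E x" for j y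
  proof -
    let ?A = "{\<omega> \<in> space P. {x, y} \<in> \<omega>}"
    have A: "?A \<in> sets P"
      using subset_space_Basic[OF nE[OF y]] bp sp by (simp add: bond_percolation_def)
    have \<rho>0: "0 \<le> \<rho> j y"
      using resistance_nonneg[OF e(1) x nV[OF y]] h(3) by (simp add: \<rho>_def)
    have "q * \<rho> j y \<le> measure P ?A * \<rho> j y"
      by (intro mult_right_mono q nE y \<rho>0)
    also have "\<dots> = (\<integral>\<omega>. indicator ?A \<omega> * \<rho> j y \<partial>P)"
      using A by simp
    also have "\<dots> \<le> (\<integral>\<omega>. L y \<omega> \<partial>P)"
    proof (rule integral_mono_AE)
      show "integrable P (\<lambda>\<omega>. indicator ?A \<omega> * \<rho> j y)"
        using A by (intro integrable_mult_left integrable_real_indicator) (auto simp: emeasure_eq_measure)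
      show "AE \<omega> in P. indicator ?A \<omega> * \<rho> j y \<le> L y \<omega>"
        using liou AE_space
      proof eventually_elim
        fix \<omega> assume l: "liouville V \<omega>" and w: "\<omega> \<in> space P"
        then have wE: "\<omega> \<subseteq> E" by (simp add: sp)
        interpret w: bounded_degree_graph V \<omega> D by (rule bounded_degree_subgraph[OF G wE])
        have L0: "0 \<le> L y \<omega>"
          using F_lim[OF y w] F_bounds[OF y w] by (intro LIMSEQ_le_const[OF F_lim[OF y w]]) auto
        show "indicator ?A \<omega> * \<rho> j y \<le> L y \<omega>"
        proof (cases "{x, y} \<in> \<omega>")
          case True
          obtain u where u: "finite_energy E u" "u x - u y = \<rho> j y" "energy E u u \<le> \<rho> j y"
            using free_resistance_lower_bound[OF e(1) x nV[OF y] h] by (auto simp: \<rho>_def)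
          have fe: "finite_energy \<omega> u" "energy \<omega> u u \<le> \<rho> j y"
            using energy_mono_edges[OF wE u(1)] u(3) by auto
          have R: "resistance \<omega> D (e k) x y \<le> L y \<omega>" for k
            using incseq_le[OF F_mono[OF y w] F_lim[OF y w], of k] True by (simp add: F_def)
          have "(u x - u y)\<^sup>2 \<le> energy \<omega> u u * L y \<omega>"
            by (rule w.liouville_free_le_wired[OF _ fe(1) True e R]) (use l in \<open>auto simp: liouville_def\<close>)
          also have "\<dots> \<le> \<rho> j y * L y \<omega>"
            by (intro mult_right_mono fe L0)
          finally have "\<rho> j y * \<rho> j y \<le> \<rho> j y * L y \<omega>"
            by (simp add: u(2) power2_eq_square)
          then have "\<rho> j y \<le> L y \<omega>"
            using \<rho>0 L0 by (cases "\<rho> j y = 0") (auto simp: mult_le_cancel_left)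
          then show ?thesis using True w by simp
        qed (use L0 in simp)
      qed
    qed (rule L_int[OF y])
    finally show ?thesis .
  qed
  let ?c = "\<Sum>y\<in>nbrs E x. (h x - h y)\<^sup>2 / energy E h h"
  have bound: "q * (2 * (1 - e j * green E D (e j) x x) + ?c) \<le> 2" for j
  proof -
    have "q * (2 * (1 - e j * green E D (e j) x x) + ?c) = (\<Sum>y\<in>nbrs E x. q * \<rho> j y)"
      using resistance_sum[OF G trans uni x e(1), of j]
      by (simp add: \<rho>_def sum.distrib sum_distrib_left[symmetric])
    also have "\<dots> \<le> (\<Sum>y\<in>nbrs E x. \<integral>\<omega>. L y \<omega> \<partial>P)"
      by (intro sum_mono lower)
    finally show ?thesis using upper by linarith
  qed
  have g0: "(\<lambda>j. e j * green E D (e j) x x) \<longlonglongrightarrow> 0"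
    by (rule killed_green_tendsto_0[OF inf _ x e]) (use conn in \<open>auto simp: connected_graph_def\<close>)
  have "(\<lambda>j. q * (2 * (1 - e j * green E D (e j) x x) + ?c)) \<longlonglongrightarrow> q * (2 * (1 - 0) + ?c)"
    by (intro tendsto_intros g0)
  from LIMSEQ_le_const2[OF this] bound show ?thesis by simp
qed

end

section \<open>Measurability of carrying a harmonic Dirichlet function\<close>

text \<open>
  Bolzano-Weierstrass at every point of \<open>S\<close>, and a diagonal sequence.
\<close>

lemma pointwise_convergent_subsequence:
  fixes f :: "nat \<Rightarrow> 'b \<Rightarrow> real"
  assumes "countable S" and bdd: "\<And>x. x \<in> S \<Longrightarrow> Bseq (\<lambda>n. f n x)"
  obtains k where "strict_mono (k :: nat \<Rightarrow> nat)" "\<And>x. x \<in> S \<Longrightarrow> convergent (\<lambda>n. f (k n) x)"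
proof (cases "S = {}")
  case True
  then show thesis using that[of id] by (simp add: strict_mono_def)
next
  case False
  let ?x = "from_nat_into S"
  interpret D: subseqs "\<lambda>i s. convergent (\<lambda>n. f (s n) (?x i))"
  proof
    fix i and s :: "nat \<Rightarrow> nat" assume "strict_mono s"
    have "bounded (range (\<lambda>n. f n (?x i)))"
      using bdd[OF from_nat_into[OF False]] by (simp add: Bseq_eq_bounded)
    then have "bounded (range (\<lambda>n. f (s n) (?x i)))"
      by (rule bounded_subset) auto
    then obtain l r where "strict_mono r" "((\<lambda>n. f (s n) (?x i)) \<circ> r) \<longlonglongrightarrow> l"
      using bounded_imp_convergent_subsequence by blast
    then show "\<exists>r. strict_mono r \<and> convergent (\<lambda>n. f ((s \<circ> r) n) (?x i))"
      by (auto simp: convergent_def o_def)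
  qed
  have conv: "convergent (\<lambda>n. f (D.diagseq n) (?x i))" for i
  proof -
    have "convergent (\<lambda>n. f ((D.diagseq \<circ> (+) (Suc i)) n) (?x i))"
    proof (rule D.diagseq_holds)
      fix r s :: "nat \<Rightarrow> nat" and n assume "strict_mono r" "convergent (\<lambda>k. f (s k) (?x n))"
      then show "convergent (\<lambda>k. f ((s \<circ> r) k) (?x n))"
        using convergent_subseq_convergent[of "\<lambda>k. f (s k) (?x n)" r] by (simp add: o_def)
    qed
    then show ?thesis
      using convergent_ignore_initial_segment[of "\<lambda>n. f (D.diagseq n) (?x i)" "Suc i"]
      by (simp add: o_def add.commute)
  qed
  show thesis
  proof (rule that[OF D.subseq_diagseq])
    fix x assume "x \<in> S"
    then obtain i where "x = ?x i"
      using from_nat_into_surj[OF assms(1)] by metis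
    then show "convergent (\<lambda>n. f (D.diagseq n) x)" using conv by simp
  qed
qed

lemma finite_energy_finite:
  assumes "finite (oriented_edges E)" shows "finite_energy E u"
  using assms by (simp add: finite_energy_def sq_summable_def)

text \<open>
  The edge \<open>{x, y}\<close> witnesses that its component carries a nonconstant harmonic function of finite
  energy. Unlike membership in \<^const>\<open>O_HD\<close> this refers to one edge at a time, which makes it
  accessible to finite approximation.
\<close>

definition separates :: "'a set \<Rightarrow> 'a set set \<Rightarrow> 'a \<Rightarrow> 'a \<Rightarrow> bool" where
  "separates V E x y \<longleftrightarrow> {x, y} \<in> E \<and>
     (\<exists>F. finite_energy E F \<and> (\<forall>z\<in>V. laplacian E F z = 0) \<and> F x \<noteq> F y)"

definition edge_box :: "'a set set \<Rightarrow> 'a \<Rightarrow> nat \<Rightarrow> 'a set set" where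
  "edge_box E x n = {e \<in> E. e \<subseteq> graph_ball E x n}"

text \<open>
  What can be seen of such a function in the finite subgraph spanned by a ball, after normalising it
  to take the values \<open>0\<close> and \<open>1\<close> at the edge. Harmonicity is asked one layer further inside, where all
  neighbours are visible.
\<close>

definition local_witness :: "'a set set \<Rightarrow> 'a set set \<Rightarrow> 'a \<Rightarrow> 'a \<Rightarrow> nat \<Rightarrow> real \<Rightarrow> ('a \<Rightarrow> real) \<Rightarrow> bool" where
  "local_witness E \<omega> x y n M F \<longleftrightarrow> F x = 0 \<and> F y = 1
     \<and> energy (\<omega> \<inter> edge_box E x (Suc n)) F F \<le> M
     \<and> (\<forall>z\<in>graph_ball E x n. laplacian (\<omega> \<inter> edge_box E x (Suc n)) F z = 0)"

context bounded_degree_graph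
begin

lemma laplacian_axpy_const:
  "laplacian E (\<lambda>z. c + t * F z) z = t * laplacian E F z"
  by (simp add: laplacian_def sum_distrib_left right_diff_distrib)

lemma finite_edge_box: 
  assumes "x \<in> V" "locally_finite_graph V E"
  shows "finite (edge_box E x n)" "finite (oriented_edges (\<omega> \<inter> edge_box E x n))"
proof -
  have B: "finite (graph_ball E x n)" by (rule finite_graph_ball[OF simple assms(2,1)])
  have "edge_box E x n \<subseteq> Pow (graph_ball E x n)" by (auto simp: edge_box_def)
  then show "finite (edge_box E x n)" using B finite_subset by blast
  have "oriented_edges (\<omega> \<inter> edge_box E x n) \<subseteq> graph_ball E x n \<times> graph_ball E x n"
    by (auto simp: edge_box_def oriented_edges_def)
  then show "finite (oriented_edges (\<omega> \<inter> edge_box E x n))" using B finite_subset by blast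
qed

lemma edge_box_mono: "m \<le> n \<Longrightarrow> edge_box E x m \<subseteq> edge_box E x n"
  using graph_ball_mono[of m n E x] by (auto simp: edge_box_def)

lemma nbrs_edge_box:
  assumes "z \<in> graph_ball E x n" "\<omega> \<subseteq> E"
  shows "nbrs (\<omega> \<inter> edge_box E x (Suc n)) z = nbrs \<omega> z"
  using assms by (auto simp: nbrs_def edge_box_def)

lemma edge_box_exhausts:
  assumes "connected_graph V E" "x \<in> V" "e \<in> E"
  shows "\<exists>n. e \<in> edge_box E x n"
proof -
  obtain a b where ab: "a \<in> V" "b \<in> V" "e = {a, b}"
    using simple assms(3) by (auto simp: simple_graph_def)
  obtain m n where mn: "a \<in> graph_ball E x m" "b \<in> graph_ball E x n"
    using graph_ball_exhausts[OF assms(1,2)] ab by blast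
  have "a \<in> graph_ball E x (max m n)" "b \<in> graph_ball E x (max m n)"
    using mn graph_ball_mono[of m "max m n" E x] graph_ball_mono[of n "max m n" E x] by auto
  then show ?thesis using ab assms(3) by (auto simp: edge_box_def)
qed

lemma separates_imp_local_witness:
  assumes \<omega>: "\<omega> \<subseteq> E" and sep: "separates V \<omega> x y"
  shows "\<exists>M::nat. \<forall>n. \<exists>F. local_witness E \<omega> x y n (real M) F"
proof -
  interpret w: bounded_degree_graph V \<omega> D
    by (rule bounded_degree_subgraph[OF bounded_degree_graph_axioms \<omega>])
  obtain F where F: "finite_energy \<omega> F" "\<And>z. z \<in> V \<Longrightarrow> laplacian \<omega> F z = 0" "F x \<noteq> F y" "{x, y} \<in> \<omega>"
    using sep by (auto simp: separates_def)
  \<comment> \<open>Normalisation to the values \<open>0\<close> at \<open>x\<close> and \<open>1\<close> at \<open>y\<close>.\<close>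
  define t where "t = 1 / (F y - F x)"
  define H where "H = (\<lambda>z. - t * F x + t * F z)"
  have zero: "finite_energy \<omega> (\<lambda>_. - t * F x)"
    by (simp add: finite_energy_def sq_summable_def grad_def)
  have H: "finite_energy \<omega> H"
    unfolding H_def by (rule finite_energy_axpy[OF zero F(1)])
  have Hxy: "H x = 0" "H y = 1"
  proof -
    have "t * (F y - F x) = 1" using F(3) by (simp add: t_def)
    then show "H x = 0" "H y = 1" by (simp_all add: H_def right_diff_distrib)
  qed
  have lapH: "laplacian \<omega> H z = 0" if "z \<in> V" for z
    unfolding H_def w.laplacian_axpy_const using F(2)[OF that] by simp
  obtain M :: nat where M: "energy \<omega> H H \<le> real M"
    using real_arch_simple by blast
  have xV: "x \<in> V" using w.edgeD[OF F(4)] by simp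
  have "local_witness E \<omega> x y n (real M) H" for n
    unfolding local_witness_def
  proof (intro conjI ballI Hxy)
    show "energy (\<omega> \<inter> edge_box E x (Suc n)) H H \<le> real M"
      using energy_mono_edges(2)[OF _ H, of "\<omega> \<inter> edge_box E x (Suc n)"] M by auto
    fix z assume z: "z \<in> graph_ball E x n"
    then have "z \<in> V" using graph_ball_subset_vertices[OF simple xV] by blast
    then show "laplacian (\<omega> \<inter> edge_box E x (Suc n)) H z = 0"
      using lapH nbrs_edge_box[OF z \<omega>] by (simp add: laplacian_def)
  qed
  then show ?thesis by blast
qed

text \<open>
  Along each open path the energy bound limits the total variation as soon as the path is inside the
  ball; finitely many radii remain.
\<close>

lemma local_witness_bounded:
  assumes \<omega>: "\<omega> \<subseteq> E" and conn: "connected_graph V E" and lf: "locally_finite_graph V E" and x: "x \<in> V"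
    and F: "\<And>n. local_witness E \<omega> x y n M (F n)"
    and z: "(x, z) \<in> {(u, v). {u, v} \<in> \<omega>}\<^sup>*"
  shows "Bseq (\<lambda>n. F n z)"
  using z
proof (induction rule: rtrancl_induct)
  case base
  then show ?case using F by (simp add: local_witness_def)
next
  case (step a b)
  then have e: "{a, b} \<in> \<omega>" by simp
  obtain m where m: "{a, b} \<in> edge_box E x m" using edge_box_exhausts[OF conn x, of "{a, b}"] e \<omega> by blast
  have "\<bar>F n b - F n a\<bar> \<le> sqrt M" if n: "n \<ge> m" for n
  proof -
    have in_box: "{a, b} \<in> \<omega> \<inter> edge_box E x (Suc n)" using m e edge_box_mono[of m "Suc n" x] n by auto
    have "(F n a - F n b)\<^sup>2 \<le> energy (\<omega> \<inter> edge_box E x (Suc n)) (F n) (F n)"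
      using edgeD[of a b] e \<omega>
      by (intro sq_diff_le_energy finite_energy_finite finite_edge_box x lf in_box) auto
    also have "\<dots> \<le> M" using F[of n] by (simp add: local_witness_def)
    finally show ?thesis by (intro real_le_rsqrt) (simp add: power2_commute)
  qed
  then have "Bseq (\<lambda>n. F (n + m) b - F (n + m) a)"
    by (intro BseqI'[of _ "sqrt M"]) simp
  then have "Bseq (\<lambda>n. F n b - F n a)" by (rule Bseq_offset)
  then obtain K where K: "\<And>n. \<bar>F n b - F n a\<bar> \<le> K" by (auto simp: Bseq_def)
  obtain K' where K': "\<And>n. \<bar>F n a\<bar> \<le> K'" using step.IH by (auto simp: Bseq_def)
  have "\<bar>F n b\<bar> \<le> K + K'" for n using K[of n] K'[of n] by linarith
  then show ?case by (intro BseqI'[of _ "K + K'"]) simp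
qed

text \<open>
  Compactness: a subsequence of the local witnesses converges on the component of \<open>x\<close>. The energy bound
  survives by Fatou's lemma, and harmonicity survives because it involves only finitely many
  vertices. Off the component the limit is set to \<open>0\<close>.
\<close>

lemma local_witness_imp_separates:
  assumes \<omega>: "\<omega> \<subseteq> E" and conn: "connected_graph V E" and lf: "locally_finite_graph V E"
    and xy: "{x, y} \<in> \<omega>" and ex: "\<And>n. \<exists>F. local_witness E \<omega> x y n M F"
  shows "separates V \<omega> x y"
proof -
  interpret w: bounded_degree_graph V \<omega> D
    by (rule bounded_degree_subgraph[OF bounded_degree_graph_axioms \<omega>])
  have x: "x \<in> V" using w.edgeD[OF xy] by simp
  obtain F where F: "\<And>n. local_witness E \<omega> x y n M (F n)" using ex by metis
  let ?r = "{(u, v). {u, v} \<in> \<omega>}"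
  define C where "C = {z. (x, z) \<in> ?r\<^sup>*}"
  have C_edge: "a \<in> C \<longleftrightarrow> b \<in> C" if "{a, b} \<in> \<omega>" for a b
  proof -
    have "(a, b) \<in> ?r" "(b, a) \<in> ?r" using that by (auto simp: insert_commute)
    then show ?thesis unfolding C_def by (auto intro: rtrancl_into_rtrancl)
  qed
  have xC: "x \<in> C" by (simp add: C_def)
  then have yC: "y \<in> C" using C_edge[OF xy] by simp
  have CV: "C \<subseteq> V"
  proof
    fix z assume "z \<in> C"
    then have "(x, z) \<in> ?r\<^sup>*" by (simp add: C_def)
    then show "z \<in> V" by (cases rule: rtrancl.cases) (use x w.edgeD in auto)
  qed
  have cV: "countable V" using countable_vertices[of V E] simple conn lf by (simp add: clf_graph_def)
  obtain k where k: "strict_mono k" "\<And>z. z \<in> C \<Longrightarrow> convergent (\<lambda>n. F (k n) z)"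
  proof (rule pointwise_convergent_subsequence)
    show "countable C" by (rule countable_subset[OF CV cV])
    show "Bseq (\<lambda>n. F n z)" if "z \<in> C" for z
      using local_witness_bounded[OF \<omega> conn lf x F] that by (simp add: C_def)
  qed blast
  define H where "H z = (if z \<in> C then lim (\<lambda>n. F (k n) z) else 0)" for z
  have H: "(\<lambda>n. F (k n) z) \<longlonglongrightarrow> H z" if "z \<in> C" for z
    using k(2)[OF that] that by (simp add: H_def convergent_LIMSEQ_iff)
  \<comment> \<open>The local witness with index \<open>k n\<close> controls the box of index \<open>n\<close>.\<close>
  have kn: "n \<le> k n" for n by (rule seq_suble[OF k(1)])
  have "finite_energy \<omega> H"
    unfolding finite_energy_def sq_summable_def
  proof (rule nonneg_bdd_above_summable_on)
    have "(\<Sum>e\<in>A. (grad H e)\<^sup>2) \<le> 2 * M" if A: "finite A" "A \<subseteq> oriented_edges \<omega>" for A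
    proof -
      let ?A = "{e \<in> A. fst e \<in> C}"
      have "\<exists>N. \<forall>e\<in>A. {fst e, snd e} \<in> edge_box E x N"
        using A
      proof (induction A)
        case (insert e A)
        then obtain N where N: "\<forall>e\<in>A. {fst e, snd e} \<in> edge_box E x N" by auto
        have "{fst e, snd e} \<in> E" using insert.prems \<omega> by (auto simp: oriented_edges_def)
        then obtain N' where N': "{fst e, snd e} \<in> edge_box E x N'" using edge_box_exhausts[OF conn x] by blast
        have "\<forall>e\<in>insert e A. {fst e, snd e} \<in> edge_box E x (max N N')"
          using N N' edge_box_mono[of N "max N N'" x] edge_box_mono[of N' "max N N'" x] by auto
        then show ?case ..
      qed simp
      then obtain N where N: "\<And>e. e \<in> A \<Longrightarrow> {fst e, snd e} \<in> edge_box E x N" by blast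
      have "(\<Sum>e\<in>A. (grad H e)\<^sup>2) = (\<Sum>e\<in>?A. (grad H e)\<^sup>2)"
      proof (rule sum.mono_neutral_right)
        show "\<forall>e\<in>A - ?A. (grad H e)\<^sup>2 = 0"
        proof
          fix e assume e: "e \<in> A - ?A"
          then have "{fst e, snd e} \<in> \<omega>" using A(2) by (auto simp: oriented_edges_def)
          then have "snd e \<notin> C" using C_edge[of "fst e" "snd e"] e by simp
          then show "(grad H e)\<^sup>2 = 0" using e by (simp add: grad_def H_def)
        qed
      qed (use A in auto)
      also have "\<dots> \<le> 2 * M"
      proof (rule LIMSEQ_le_const2)
        show "(\<lambda>n. \<Sum>e\<in>?A. (grad (F (k n)) e)\<^sup>2) \<longlonglongrightarrow> (\<Sum>e\<in>?A. (grad H e)\<^sup>2)"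
        proof (intro tendsto_sum tendsto_power)
          fix e assume e: "e \<in> ?A"
          then have "{fst e, snd e} \<in> \<omega>" using A(2) by (auto simp: oriented_edges_def)
          then have "snd e \<in> C" using C_edge[of "fst e" "snd e"] e by simp
          then show "(\<lambda>n. grad (F (k n)) e) \<longlonglongrightarrow> grad H e"
            using e unfolding grad_def by (intro tendsto_diff H) auto
        qed
        show "\<exists>N. \<forall>n\<ge>N. (\<Sum>e\<in>?A. (grad (F (k n)) e)\<^sup>2) \<le> 2 * M"
        proof (intro exI allI impI)
          fix n assume n: "n \<ge> N"
          let ?\<omega> = "\<omega> \<inter> edge_box E x (Suc (k n))"
          have "edge_box E x N \<subseteq> edge_box E x (Suc (k n))" using n kn[of n] by (intro edge_box_mono) linarith
          then have "?A \<subseteq> oriented_edges ?\<omega>"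
            using A(2) N by (auto simp: oriented_edges_def)
          then have "(\<Sum>e\<in>?A. (grad (F (k n)) e)\<^sup>2) \<le> inner_on (oriented_edges ?\<omega>) (grad (F (k n))) (grad (F (k n)))"
            using A(1) finite_energy_finite[OF finite_edge_box(2)[OF x lf], of \<omega> "Suc (k n)" "F (k n)"]
            by (intro sum_sq_le_inner_on) (auto simp: finite_energy_def)
          also have "\<dots> \<le> 2 * M"
            using F[of "k n"] by (simp add: local_witness_def energy_def)
          finally show "(\<Sum>e\<in>?A. (grad (F (k n)) e)\<^sup>2) \<le> 2 * M" .
        qed
      qed
      finally show ?thesis .
    qed
    then show "bdd_above (sum (\<lambda>e. (grad H e)\<^sup>2) ` {A. A \<subseteq> oriented_edges \<omega> \<and> finite A})"
      by (intro bdd_aboveI2[of _ _ "2 * M"]) auto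
  qed simp
  moreover have "laplacian \<omega> H z = 0" if z: "z \<in> V" for z
  proof (cases "z \<in> C")
    case True
    have nC: "w \<in> C" if "w \<in> nbrs \<omega> z" for w
      using that True C_edge[of z w] by (simp add: nbrs_def)
    obtain m where m: "z \<in> graph_ball E x m" using graph_ball_exhausts[OF conn x z] by blast
    have lim: "(\<lambda>n. laplacian \<omega> (F (k n)) z) \<longlonglongrightarrow> laplacian \<omega> H z"
      unfolding laplacian_def by (intro tendsto_sum tendsto_diff H True nC)
    have zero: "laplacian \<omega> (F (k n)) z = 0" if "n \<ge> m" for n
    proof -
      have zn: "z \<in> graph_ball E x (k n)"
        using m graph_ball_mono[of m "k n" E x] kn[of n] that by auto
      then have "laplacian (\<omega> \<inter> edge_box E x (Suc (k n))) (F (k n)) z = 0"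
        using F[of "k n"] by (simp add: local_witness_def)
      then show ?thesis by (simp add: laplacian_def nbrs_edge_box[OF zn \<omega>])
    qed
    have "(\<lambda>n. laplacian \<omega> (F (k n)) z) \<longlonglongrightarrow> 0"
      by (rule tendsto_eventually) (use zero in \<open>auto simp: eventually_sequentially\<close>)
    with lim show ?thesis by (rule LIMSEQ_unique)
  next
    case False
    have "H w = 0" if "w \<in> nbrs \<omega> z" for w
      using that False C_edge[of z w] by (simp add: nbrs_def H_def)
    then show ?thesis using False by (simp add: laplacian_def H_def)
  qed
  moreover have "H x \<noteq> H y"
  proof -
    have "H x = 0" "H y = 1"
      using LIMSEQ_unique[OF H[OF xC], of 0] LIMSEQ_unique[OF H[OF yC], of 1] F
      by (simp_all add: local_witness_def)
    then show ?thesis by simp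
  qed
  ultimately show ?thesis using xy by (auto simp: separates_def)
qed

end

lemma cylinder_measurable:
  assumes P: "bond_percolation E P" and A: "finite A" "A \<subseteq> E"
  shows "{\<omega> \<in> space P. Q (\<omega> \<inter> A)} \<in> sets P"
proof -
  have sp: "space P = Pow E" by (rule percolation_space[OF P])
  have basic: "{\<omega> \<in> space P. e \<in> \<omega>} \<in> sets P" if "e \<in> E" for e
    using subset_space_Basic[OF that] P by (simp add: sp bond_percolation_def)
  have "{\<omega> \<in> space P. \<omega> \<inter> A = B} \<in> sets P" if B: "B \<in> Pow A" for B
  proof -
    have "{\<omega> \<in> space P. \<omega> \<inter> A = B} = {\<omega> \<in> space P. \<forall>e\<in>A. e \<in> \<omega> \<longleftrightarrow> e \<in> B}"
      using B by auto
    also have "\<dots> \<in> sets P"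
    proof (rule sets.sets_Collect_finite_All[OF _ A(1)])
      fix e assume "e \<in> A"
      then have "{\<omega> \<in> space P. e \<in> \<omega>} \<in> sets P" using A basic by blast
      moreover have "space P - {\<omega> \<in> space P. e \<in> \<omega>} = {\<omega> \<in> space P. e \<notin> \<omega>}" by auto
      ultimately show "{\<omega> \<in> space P. e \<in> \<omega> \<longleftrightarrow> e \<in> B} \<in> sets P"
        using sets.compl_sets[of "{\<omega> \<in> space P. e \<in> \<omega>}" P] by (cases "e \<in> B") simp_all
    qed
    finally show ?thesis .
  qed
  then have "(\<Union>B\<in>{B \<in> Pow A. Q B}. {\<omega> \<in> space P. \<omega> \<inter> A = B}) \<in> sets P"
    using A by (intro sets.finite_UN) auto
  moreover have "(\<Union>B\<in>{B \<in> Pow A. Q B}. {\<omega> \<in> space P. \<omega> \<inter> A = B}) = {\<omega> \<in> space P. Q (\<omega> \<inter> A)}"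
    by auto
  ultimately show ?thesis by simp
qed

lemma separates_measurable:
  assumes G: "bounded_degree_graph V E D" and clf: "clf_graph V E" and P: "bond_percolation E P"
    and xy: "{x, y} \<in> E"
  shows "{\<omega> \<in> space P. separates V \<omega> x y} \<in> sets P"
proof -
  interpret bounded_degree_graph V E D by fact
  have conn: "connected_graph V E" and lf: "locally_finite_graph V E" using clf by (auto simp: clf_graph_def)
  have x: "x \<in> V" using edgeD[OF xy] by simp
  have sp: "space P = Pow E" by (rule percolation_space[OF P])
  have eq: "separates V \<omega> x y \<longleftrightarrow> {x, y} \<in> \<omega> \<and> (\<exists>M::nat. \<forall>n. \<exists>F. local_witness E \<omega> x y n (real M) F)"
    if "\<omega> \<subseteq> E" for \<omega>
  proof
    assume s: "separates V \<omega> x y"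
    then have "{x, y} \<in> \<omega>" by (simp add: separates_def)
    with separates_imp_local_witness[OF that s]
    show "{x, y} \<in> \<omega> \<and> (\<exists>M::nat. \<forall>n. \<exists>F. local_witness E \<omega> x y n (real M) F)" by simp
  qed (use local_witness_imp_separates[OF that conn lf] in blast)
  have 1: "{\<omega> \<in> space P. {x, y} \<in> \<omega>} \<in> sets P"
    using subset_space_Basic[OF xy] P by (simp add: sp bond_percolation_def)
  have "{\<omega> \<in> space P. \<exists>F. local_witness E \<omega> x y n (real M) F} \<in> sets P" for M n :: nat
  proof -
    have "edge_box E x (Suc n) \<subseteq> E" by (auto simp: edge_box_def)
    from cylinder_measurable[OF P finite_edge_box(1)[OF x lf] this,
        of "\<lambda>\<eta>. \<exists>F. local_witness E \<eta> x y n (real M) F"]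
    show ?thesis by (simp add: local_witness_def Int_assoc)
  qed
  then have 2: "{\<omega> \<in> space P. \<exists>M::nat. \<forall>n. \<exists>F. local_witness E \<omega> x y n (real M) F} \<in> sets P"
    by (intro sets.sets_Collect_countable_Ex sets.sets_Collect_countable_All)
  have "{\<omega> \<in> space P. separates V \<omega> x y} = {\<omega> \<in> space P. {x, y} \<in> \<omega>}
      \<inter> {\<omega> \<in> space P. \<exists>M::nat. \<forall>n. \<exists>F. local_witness E \<omega> x y n (real M) F}"
    using eq by (auto simp: sp)
  then show ?thesis using 1 2 by simp
qed

section \<open>Components and harmonic Dirichlet functions\<close>

lemma not_liouville_iff: "\<not> liouville V E \<longleftrightarrow> (\<exists>x y. separates V E x y)"
  by (auto simp: liouville_def separates_def)

lemma graph_component_closed: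
  assumes "C \<in> graph_components V E" "{a, b} \<in> E"
  shows "a \<in> C \<longleftrightarrow> b \<in> C"
proof -
  obtain x where C: "C = {y. (x, y) \<in> {(u, v). {u, v} \<in> E}\<^sup>*}"
    using assms(1) by (auto simp: graph_components_def graph_component_def)
  have "(a, b) \<in> {(u, v). {u, v} \<in> E}" "(b, a) \<in> {(u, v). {u, v} \<in> E}"
    using assms(2) by (auto simp: insert_commute)
  then show ?thesis unfolding C by (auto intro: rtrancl_into_rtrancl)
qed

context bounded_degree_graph
begin

lemma graph_component_subset:
  assumes "C \<in> graph_components V E" shows "C \<subseteq> V"
proof
  obtain x where x: "x \<in> V" "C = {y. (x, y) \<in> {(u, v). {u, v} \<in> E}\<^sup>*}"
    using assms by (auto simp: graph_components_def graph_component_def)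
  fix z assume "z \<in> C"
  then have "(x, z) \<in> {(u, v). {u, v} \<in> E}\<^sup>*" using x by simp
  then show "z \<in> V" by (cases rule: rtrancl.cases) (use x edgeD in auto)
qed

lemma harmonic_at_iff:
  assumes "x \<in> V" "nbrs E x \<noteq> {}"
  shows "F x = (\<Sum>y\<in>nbrs E x. F y) / real (card (nbrs E x)) \<longleftrightarrow> laplacian E F x = 0"
proof -
  have "real (card (nbrs E x)) \<noteq> 0" using assms finite_nbrs by simp
  then show ?thesis
    by (simp add: laplacian_def sum_subtractf nonzero_eq_divide_eq mult.commute)
qed

text \<open>
  Edges do not leave \<open>C\<close>, so cutting a function off outside \<open>C\<close> creates no new differences.
\<close>

lemma extend_by_zero:
  assumes C: "\<And>a b. {a, b} \<in> E \<Longrightarrow> a \<in> C \<longleftrightarrow> b \<in> C"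
    and F: "finite_energy {e \<in> E. e \<subseteq> C} F" "\<And>z. z \<in> C \<Longrightarrow> laplacian E F z = 0"
  defines "H \<equiv> \<lambda>z. if z \<in> C then F z else 0"
  shows "finite_energy E H" and "laplacian E H z = 0"
proof -
  have "(\<lambda>e. (grad F e)\<^sup>2) summable_on oriented_edges {e \<in> E. e \<subseteq> C}
      \<longleftrightarrow> (\<lambda>e. (grad H e)\<^sup>2) summable_on oriented_edges E"
  proof (rule summable_on_cong_neutral)
    fix e assume "e \<in> oriented_edges E - oriented_edges {e \<in> E. e \<subseteq> C}"
    then have "fst e \<notin> C" "snd e \<notin> C" using C[of "fst e" "snd e"] by (auto simp: oriented_edges_def)
    then show "(grad H e)\<^sup>2 = 0" by (simp add: grad_def H_def)
  qed (auto simp: oriented_edges_def grad_def H_def)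
  then show "finite_energy E H" using F(1) by (simp add: finite_energy_def sq_summable_def)
  have "w \<in> C \<longleftrightarrow> z \<in> C" if "w \<in> nbrs E z" for w
    using C[of z w] that by (simp add: nbrs_def)
  then have "laplacian E H z = (if z \<in> C then laplacian E F z else 0)"
    unfolding laplacian_def by (auto simp: H_def intro!: sum.cong)
  then show "laplacian E H z = 0" using F(2) by simp
qed

lemma component_graph_clf:
  assumes C: "C \<in> graph_components V E"
  shows "clf_graph C {e \<in> E. e \<subseteq> C}" and "z \<in> C \<Longrightarrow> nbrs {e \<in> E. e \<subseteq> C} z = nbrs E z"
proof -
  let ?E = "{e \<in> E. e \<subseteq> C}"
  obtain x where x: "x \<in> V" and Cx: "C = {y. (x, y) \<in> {(u, v). {u, v} \<in> E}\<^sup>*}"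
    using C by (auto simp: graph_components_def graph_component_def)
  note CV = graph_component_subset[OF C]
  show nb: "nbrs ?E z = nbrs E z" if "z \<in> C" for z
    using graph_component_closed[OF C, of z] that by (auto simp: nbrs_def)
  let ?r = "{(u, v). {u, v} \<in> ?E}"
  have from_x: "(x, z) \<in> ?r\<^sup>*" if "z \<in> C" for z
  proof -
    have "(x, z) \<in> {(u, v). {u, v} \<in> E}\<^sup>*" using that by (simp add: Cx)
    then show ?thesis
    proof (induction rule: rtrancl_induct)
      case (step y z)
      then have "y \<in> C" by (simp add: Cx)
      with step have "{y, z} \<in> ?E" using graph_component_closed[OF C, of y z] by auto
      then have "(y, z) \<in> ?r" by simp
      with step.IH show ?case by (rule rtrancl_into_rtrancl)
    qed simp
  qed
  have "sym ?r" by (simp add: sym_def insert_commute)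
  then have "sym (?r\<^sup>*)" by (rule sym_rtrancl)
  then have to_x: "(z, x) \<in> ?r\<^sup>*" if "z \<in> C" for z
    using from_x[OF that] by (rule symD)
  have "(z, w) \<in> ?r\<^sup>*" if "z \<in> C" "w \<in> C" for z w
    using to_x[OF that(1)] from_x[OF that(2)] by (rule rtrancl_trans)
  then have "connected_graph C ?E"
    by (auto simp: connected_graph_def graph_component_def Cx)
  moreover have "simple_graph C ?E"
    unfolding simple_graph_def
  proof
    fix e assume e: "e \<in> ?E"
    then obtain a b where "a \<noteq> b" "e = {a, b}" using simple by (auto simp: simple_graph_def)
    then show "\<exists>a\<in>C. \<exists>b\<in>C. a \<noteq> b \<and> e = {a, b}" using e by blast
  qed
  moreover have "locally_finite_graph C ?E"
    using nb finite_nbrs CV by (auto simp: locally_finite_graph_def)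
  ultimately show "clf_graph C ?E" by (simp add: clf_graph_def)
qed

text \<open>
  The two notions of harmonicity differ only at isolated vertices, where \<^const>\<open>harmonic\<close> forces the
  value \<open>0\<close> and the Laplacian vanishes for every function. An isolated vertex is a component by itself,
  so this does not affect the class.
\<close>

theorem component_not_O_HD_iff:
  assumes C: "C \<in> graph_components V E"
  shows "component_graph E C \<notin> O_HD \<longleftrightarrow> (\<exists>x\<in>C. \<exists>y\<in>C. separates V E x y)"
proof -
  let ?E = "{e \<in> E. e \<subseteq> C}"
  note CV = graph_component_subset[OF C]
  note clfC = component_graph_clf(1)[OF C] and nb = component_graph_clf(2)[OF C]
  interpret c: bounded_degree_graph C ?E D
    using clfC nb CV finite_nbrs degree_le D_pos by unfold_locales (auto simp: clf_graph_def)
  have lap: "laplacian ?E F z = laplacian E F z" if "z \<in> C" for F z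
    using nb[OF that] by (simp add: laplacian_def)
  have iff: "component_graph E C \<notin> O_HD
      \<longleftrightarrow> (\<exists>F. harmonic C ?E F \<and> finite_energy ?E F \<and> \<not> F constant_on C)"
    using clfC by (auto simp: component_graph_def O_HD_def c.dirichlet_iff_finite_energy)
  show ?thesis
  proof
    assume "component_graph E C \<notin> O_HD"
    then obtain F where F: "harmonic C ?E F" "finite_energy ?E F" "\<not> F constant_on C"
      using iff by blast
    have F0: "laplacian E F z = 0" if z: "z \<in> C" for z
    proof (cases "nbrs ?E z = {}")
      case True
      then show ?thesis using lap[OF z, of F] by (simp add: laplacian_def)
    next
      case False
      have "F z = (\<Sum>y\<in>nbrs ?E z. F y) / real (card (nbrs ?E z))"
        using F(1) z unfolding harmonic_def by (rule bspec)
      then have "laplacian ?E F z = 0"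
        by (rule c.harmonic_at_iff[OF z False, THEN iffD1])
      then show ?thesis by (simp only: lap[OF z])
    qed
    let ?H = "\<lambda>z. if z \<in> C then F z else 0"
    note H = extend_by_zero[of C F, OF graph_component_closed[OF C] F(2) F0]
    have "\<exists>x y. {x, y} \<in> ?E \<and> F x \<noteq> F y"
    proof (rule ccontr)
      assume "\<not> (\<exists>x y. {x, y} \<in> ?E \<and> F x \<noteq> F y)"
      then have eq: "\<And>x y. {x, y} \<in> ?E \<Longrightarrow> F x = F y" by blast
      have "F y = F x" if "x \<in> C" "y \<in> C" for x y
      proof -
        have "(x, y) \<in> {(u, v). {u, v} \<in> ?E}\<^sup>*"
          using clfC that by (auto simp: clf_graph_def connected_graph_def graph_component_def)
        then show ?thesis
        proof (induction rule: rtrancl_induct)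
          case (step y z)
          then show ?case using eq[of y z] by simp
        qed simp
      qed
      then have "F constant_on C" unfolding constant_on_def by blast
      with F(3) show False ..
    qed
    then obtain x y where xy: "{x, y} \<in> ?E" "F x \<noteq> F y" by blast
    then have "separates V E x y"
      using H by (auto simp: separates_def intro!: exI[of _ ?H])
    then show "\<exists>x\<in>C. \<exists>y\<in>C. separates V E x y" using xy by blast
  next
    assume "\<exists>x\<in>C. \<exists>y\<in>C. separates V E x y"
    then obtain x y F where xy: "x \<in> C" "y \<in> C" "{x, y} \<in> E"
      and F: "finite_energy E F" "\<And>z. z \<in> V \<Longrightarrow> laplacian E F z = 0" "F x \<noteq> F y"
      by (auto simp: separates_def)
    \<comment> \<open>At isolated vertices \<^const>\<open>harmonic\<close> requires the value \<open>0\<close>.\<close>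
    define H where "H z = (if nbrs E z = {} then 0 else F z)" for z
    have nonempty: "nbrs E a \<noteq> {}" "nbrs E b \<noteq> {}" if "{a, b} \<in> E" for a b
      using that by (auto simp: nbrs_def insert_commute)
    have "sq_summable (oriented_edges ?E) (grad H) \<longleftrightarrow> sq_summable (oriented_edges ?E) (grad F)"
    proof (rule sq_summable_cong)
      fix e assume "e \<in> oriented_edges ?E"
      then have "{fst e, snd e} \<in> E" by (auto simp: oriented_edges_def)
      then show "grad H e = grad F e" using nonempty[of "fst e" "snd e"] by (simp add: grad_def H_def)
    qed
    moreover have "finite_energy ?E F" by (rule energy_mono_edges(1)[OF _ F(1)]) auto
    ultimately have "finite_energy ?E H" by (simp add: finite_energy_def)
    moreover have "harmonic C ?E H"
      unfolding harmonic_def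
    proof
      fix z assume z: "z \<in> C"
      show "H z = (\<Sum>y\<in>nbrs ?E z. H y) / real (card (nbrs ?E z))"
      proof (cases "nbrs E z = {}")
        case True
        then show ?thesis using nb[OF z] by (simp add: H_def)
      next
        case False
        have Hw: "H w = F w" if "w \<in> nbrs E z" for w
        proof -
          have "{z, w} \<in> E" using that by (simp add: nbrs_def)
          from nonempty(2)[OF this] show ?thesis by (simp add: H_def)
        qed
        have "H z = F z" using False by (simp add: H_def)
        then have "laplacian E H z = laplacian E F z"
          unfolding laplacian_def by (intro sum.cong refl) (simp only: Hw)
        then have "laplacian ?E H z = 0"
          unfolding lap[OF z] using F(2)[OF subsetD[OF CV z]] by (simp only:)
        moreover have "nbrs ?E z \<noteq> {}" unfolding nb[OF z] by (rule False)
        ultimately show ?thesis by (intro c.harmonic_at_iff[OF z, THEN iffD2])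
      qed
    qed
    moreover have "H x \<noteq> H y" using nonempty[OF xy(3)] F(3) by (simp add: H_def)
    then have "\<not> H constant_on C" using xy(1,2) unfolding constant_on_def by metis
    ultimately show "component_graph E C \<notin> O_HD" using iff by blast
  qed
qed

text \<open>
  On a finite component a harmonic function, cut off outside, is square-summable, so by Green's
  identity its energy is zero.
\<close>

lemma separates_imp_infinite_component:
  assumes C: "C \<in> graph_components V E" and x: "x \<in> C" and sep: "separates V E x y"
  shows "infinite C"
proof
  assume fin: "finite C"
  obtain F where F: "finite_energy E F" "\<And>z. z \<in> V \<Longrightarrow> laplacian E F z = 0" "F x \<noteq> F y"
    and xy: "{x, y} \<in> E"
    using sep by (auto simp: separates_def)
  have y: "y \<in> C" using graph_component_closed[OF C xy] x by simp
  let ?H = "\<lambda>z. if z \<in> C then F z else 0"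
  have "finite_energy {e \<in> E. e \<subseteq> C} F" by (rule energy_mono_edges(1)[OF _ F(1)]) auto
  note H = extend_by_zero[of C F, OF graph_component_closed[OF C] this F(2)]
  have HE: "finite_energy E ?H" and Hl: "laplacian E ?H z = 0" for z
    using H graph_component_subset[OF C] by auto
  have "sq_summable V ?H"
    unfolding sq_summable_def
  proof (rule summable_on_cong_neutral[THEN iffD1])
    show "(\<lambda>z. (?H z)\<^sup>2) summable_on C" using fin by simp
  qed (use graph_component_subset[OF C] in auto)
  then have "energy E ?H ?H = 0"
    using Green_identity[OF _ HE] by (simp add: Hl inner_on_def)
  then have "?H x = ?H y" using sq_diff_le_energy[OF HE xy] edgeD[OF xy] by simp
  then show False using F(3) x y by simp
qed

end

section \<open>Invariance\<close>

context aut_action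
begin

lemma edge_vertices:
  assumes "{a, b} \<in> E" shows "a \<in> V" "b \<in> V"
proof -
  obtain x y where "x \<in> V" "y \<in> V" "{a, b} = {x, y}" using edge_cases[OF assms] by metis
  then show "a \<in> V" "b \<in> V" by (auto simp: doubleton_eq_iff)
qed

lemma separates_pullback:
  assumes g: "g \<in> \<Gamma>" and \<omega>: "\<omega> \<subseteq> E" and xy: "x \<in> V" "y \<in> V"
    and sep: "separates V (act_edges g \<omega>) (g x) (g y)"
  shows "separates V \<omega> x y"
proof -
  obtain F where F: "finite_energy (act_edges g \<omega>) F"
      "\<And>z. z \<in> V \<Longrightarrow> laplacian (act_edges g \<omega>) F z = 0" "F (g x) \<noteq> F (g y)"
    and e: "{g x, g y} \<in> act_edges g \<omega>"
    using sep by (auto simp: separates_def)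
  let ?O = "oriented_edges \<omega>" and ?m = "map_prod g g"
  have OV: "a \<in> V \<and> b \<in> V" if "(a, b) \<in> ?O" for a b
    using that \<omega> edge_vertices[of a b] by (auto simp: oriented_edges_def)
  have sub: "?m ` ?O \<subseteq> oriented_edges (act_edges g \<omega>)"
  proof
    fix w assume "w \<in> ?m ` ?O"
    then obtain a b where ab: "(a, b) \<in> ?O" "w = (g a, g b)" by auto
    then show "w \<in> oriented_edges (act_edges g \<omega>)"
      using act_edges_iff[OF g \<omega>, of a b] OV[OF ab(1)] by (simp add: oriented_edges_def)
  qed
  have "inj_on ?m ?O"
  proof (rule inj_on_subset)
    show "inj_on ?m (V \<times> V)" by (rule map_prod_inj_on) (rule \<Gamma>D(4)[OF g])+
  qed (use OV in auto)
  then have "((\<lambda>e. (grad F e)\<^sup>2) \<circ> ?m) summable_on ?O"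
    using summable_on_subset_banach[OF F(1)[unfolded finite_energy_def sq_summable_def] sub]
    by (simp add: summable_on_reindex)
  then have "finite_energy \<omega> (\<lambda>z. F (g z))"
    by (simp add: finite_energy_def sq_summable_def grad_def o_def map_prod_def case_prod_unfold)
  moreover have "laplacian \<omega> (\<lambda>z. F (g z)) z = 0" if "z \<in> V" for z
    using laplacian_act_edges[OF g \<omega> that, of F] F(2)[OF \<Gamma>D(3)[OF g that]] by simp
  moreover have "{x, y} \<in> \<omega>" using e act_edges_iff[OF g \<omega> xy] by simp
  ultimately show ?thesis
    using F(3) by (auto simp: separates_def intro!: exI[of _ "\<lambda>z. F (g z)"])
qed

lemma image_inverse:
  assumes "\<And>x. x \<in> V \<Longrightarrow> i (g x) = x" "A \<subseteq> V"
  shows "i ` g ` A = A"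
proof -
  have "(\<lambda>x. i (g x)) ` A = (\<lambda>x. x) ` A"
    by (rule image_cong[OF refl]) (rule assms(1)[OF subsetD[OF assms(2)]])
  then show ?thesis by (simp add: image_image)
qed

lemma act_edges_inverse:
  assumes "\<And>x. x \<in> V \<Longrightarrow> i (g x) = x" and \<omega>: "\<omega> \<subseteq> E"
  shows "act_edges i (act_edges g \<omega>) = \<omega>"
proof -
  have inv: "i ` g ` e = e" if e: "e \<in> \<omega>" for e
  proof (rule image_inverse[of i g, OF assms(1)])
    obtain x y where "x \<in> V" "y \<in> V" "e = {x, y}"
      using edge_cases[OF subsetD[OF \<omega> e]] by metis
    then show "e \<subseteq> V" by simp
  qed
  show ?thesis
  proof
    show "act_edges i (act_edges g \<omega>) \<subseteq> \<omega>"
    proof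
      fix d assume "d \<in> act_edges i (act_edges g \<omega>)"
      then obtain e where e: "e \<in> \<omega>" "d = i ` g ` e" unfolding act_edges_def by blast
      then show "d \<in> \<omega>" by (simp only: inv[OF e(1)])
    qed
    show "\<omega> \<subseteq> act_edges i (act_edges g \<omega>)"
    proof
      fix e assume e: "e \<in> \<omega>"
      then have "i ` g ` e \<in> act_edges i (act_edges g \<omega>)"
        unfolding act_edges_def by (intro imageI)
      then show "e \<in> act_edges i (act_edges g \<omega>)" by (simp only: inv[OF e])
    qed
  qed
qed

lemma separates_act_edges:
  assumes g: "g \<in> \<Gamma>" and \<omega>: "\<omega> \<subseteq> E" and sep: "separates V \<omega> x y" and xy: "x \<in> V" "y \<in> V"
  shows "separates V (act_edges g \<omega>) (g x) (g y)"
proof -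
  obtain i where i: "i \<in> \<Gamma>" "\<And>x. x \<in> V \<Longrightarrow> i (g x) = x" "\<And>x. x \<in> V \<Longrightarrow> g (i x) = x"
    by (rule inverse_ex[OF g]) (rule that)
  show ?thesis
    using separates_pullback[OF i(1) act_edges_subset[OF g \<omega>] \<Gamma>D(3)[OF g xy(1)] \<Gamma>D(3)[OF g xy(2)]]
      act_edges_inverse[of i g \<omega>, OF i(2) \<omega>] i(2)[OF xy(1)] i(2)[OF xy(2)] sep
    by (simp only: simp_thms)
qed

lemma separates_vertices:
  assumes "\<omega> \<subseteq> E" "separates V \<omega> x y" shows "{x, y} \<in> E" "x \<in> V" "y \<in> V"
proof -
  show e: "{x, y} \<in> E" using assms by (auto simp: separates_def)
  then show "x \<in> V" "y \<in> V" using edge_vertices by blast+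
qed

lemma separating_event_invariant:
  assumes g: "g \<in> \<Gamma>"
  shows "act_edges g ` {\<omega> \<in> Pow E. \<exists>x y. separates V \<omega> x y} = {\<omega> \<in> Pow E. \<exists>x y. separates V \<omega> x y}"
    (is "_ ` ?B = ?B")
proof -
  have sub: "act_edges k \<omega> \<in> ?B" if k: "k \<in> \<Gamma>" and B: "\<omega> \<in> ?B" for k \<omega>
  proof -
    have w: "\<omega> \<subseteq> E" using B by simp
    obtain x y where s: "separates V \<omega> x y" using B by auto
    have "separates V (act_edges k \<omega>) (k x) (k y)"
      by (rule separates_act_edges[OF k w s separates_vertices(2,3)[OF w s]])
    then show ?thesis using act_edges_subset[OF k w] by auto
  qed
  obtain i where i: "i \<in> \<Gamma>" "\<And>x. x \<in> V \<Longrightarrow> i (g x) = x" "\<And>x. x \<in> V \<Longrightarrow> g (i x) = x"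
    by (rule inverse_ex[OF g]) (rule that)
  show ?thesis
  proof
    show "act_edges g ` ?B \<subseteq> ?B" using sub[OF g] by (rule image_subsetI)
    show "?B \<subseteq> act_edges g ` ?B"
    proof
      fix \<omega> assume w: "\<omega> \<in> ?B"
      then have "\<omega> = act_edges g (act_edges i \<omega>)" using act_edges_inverse[of g i \<omega>, OF i(3)] by simp
      with sub[OF i(1) w] show "\<omega> \<in> act_edges g ` ?B" by (rule image_eqI[rotated])
    qed
  qed
qed

text \<open>
  The invariant property of a component to which indistinguishability is applied.
\<close>

definition separated_pairs :: "('a set \<times> 'a set set) set" where
  "separated_pairs = {(C, \<omega>). C \<subseteq> V \<and> \<omega> \<subseteq> E \<and> (\<exists>x\<in>C. \<exists>y\<in>C. separates V \<omega> x y)}"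

lemma separated_pairs_invariant:
  assumes g: "g \<in> \<Gamma>"
  shows "(\<lambda>(C, \<omega>). (g ` C, act_edges g \<omega>)) ` separated_pairs = separated_pairs"
proof -
  have sub: "(k ` C, act_edges k \<omega>) \<in> separated_pairs" if k: "k \<in> \<Gamma>" and C: "(C, \<omega>) \<in> separated_pairs" for k C \<omega>
  proof -
    obtain x y where xy: "C \<subseteq> V" "\<omega> \<subseteq> E" "x \<in> C" "y \<in> C" "separates V \<omega> x y"
      using C by (auto simp: separated_pairs_def)
    have "separates V (act_edges k \<omega>) (k x) (k y)"
      by (rule separates_act_edges[OF k xy(2,5) separates_vertices(2,3)[OF xy(2,5)]])
    then have "\<exists>a\<in>k ` C. \<exists>b\<in>k ` C. separates V (act_edges k \<omega>) a b"
      using xy(3,4) by (intro bexI[OF _ imageI])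
    moreover have "k ` C \<subseteq> V"
      by (rule image_subsetI) (rule \<Gamma>D(3)[OF k subsetD[OF xy(1)]])
    ultimately show ?thesis
      using act_edges_subset[OF k xy(2)] by (simp add: separated_pairs_def)
  qed
  obtain i where i: "i \<in> \<Gamma>" "\<And>x. x \<in> V \<Longrightarrow> i (g x) = x" "\<And>x. x \<in> V \<Longrightarrow> g (i x) = x"
    by (rule inverse_ex[OF g]) (rule that)
  show ?thesis
  proof
    show "(\<lambda>(C, \<omega>). (g ` C, act_edges g \<omega>)) ` separated_pairs \<subseteq> separated_pairs"
    proof (rule image_subsetI)
      fix p assume "p \<in> separated_pairs"
      then show "(\<lambda>(C, \<omega>). (g ` C, act_edges g \<omega>)) p \<in> separated_pairs"
        using sub[OF g, of "fst p" "snd p"] by (simp add: case_prod_unfold)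
    qed
    show "separated_pairs \<subseteq> (\<lambda>(C, \<omega>). (g ` C, act_edges g \<omega>)) ` separated_pairs"
    proof
      fix p assume p: "p \<in> separated_pairs"
      obtain C \<omega> where C: "p = (C, \<omega>)" by (cases p)
      have CV: "C \<subseteq> V" and w: "\<omega> \<subseteq> E" using p C by (auto simp: separated_pairs_def)
      have "g ` i ` C = C" by (rule image_inverse[of g i C, OF i(3) CV])
      moreover have "act_edges g (act_edges i \<omega>) = \<omega>" by (rule act_edges_inverse[of g i \<omega>, OF i(3) w])
      ultimately have "p = (\<lambda>(C, \<omega>). (g ` C, act_edges g \<omega>)) (i ` C, act_edges i \<omega>)" by (simp add: C)
      then show "p \<in> (\<lambda>(C, \<omega>). (g ` C, act_edges g \<omega>)) ` separated_pairs"
        by (rule image_eqI) (rule sub[OF i(1) p[unfolded C]])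
    qed
  qed
qed

lemma separating_event_measurable:
  assumes G: "bounded_degree_graph V E D" and P: "bond_percolation E P"
  shows "{\<omega> \<in> Pow E. \<exists>x y. separates V \<omega> x y} \<in> sets P"
    and "separated_pairs \<in> sets (subset_space V \<Otimes>\<^sub>M subset_space E)"
proof -
  let ?I = "{(x, y) \<in> V \<times> V. {x, y} \<in> E}"
  have sp: "space P = Pow E" by (rule percolation_space[OF P])
  have cnt: "countable ?I"
    by (rule countable_subset[of _ "V \<times> V"]) (use countable_vertices[OF clf] in auto)
  have m: "{\<omega> \<in> Pow E. separates V \<omega> (fst p) (snd p)} \<in> sets P" if "p \<in> ?I" for p
    using separates_measurable[OF G clf P, of "fst p" "snd p"] that by (auto simp: sp)
  have "(\<Union>p\<in>?I. {\<omega> \<in> Pow E. separates V \<omega> (fst p) (snd p)}) \<in> sets P"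
    by (rule sets.countable_UN'[OF cnt image_subsetI[OF m]])
  moreover have "(\<Union>p\<in>?I. {\<omega> \<in> Pow E. separates V \<omega> (fst p) (snd p)})
      = {\<omega> \<in> Pow E. \<exists>x y. separates V \<omega> x y}"
  proof
    show "{\<omega> \<in> Pow E. \<exists>x y. separates V \<omega> x y}
        \<subseteq> (\<Union>p\<in>?I. {\<omega> \<in> Pow E. separates V \<omega> (fst p) (snd p)})"
    proof
      fix \<omega> assume B: "\<omega> \<in> {\<omega> \<in> Pow E. \<exists>x y. separates V \<omega> x y}"
      then have w: "\<omega> \<subseteq> E" by simp
      obtain x y where s: "separates V \<omega> x y" using B by auto
      then have "(x, y) \<in> ?I" using separates_vertices[OF w s] by simp
      moreover have "\<omega> \<in> {\<omega> \<in> Pow E. separates V \<omega> (fst (x, y)) (snd (x, y))}" using w s by simp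
      ultimately show "\<omega> \<in> (\<Union>p\<in>?I. {\<omega> \<in> Pow E. separates V \<omega> (fst p) (snd p)})" by (rule UN_I)
    qed
  qed auto
  ultimately show "{\<omega> \<in> Pow E. \<exists>x y. separates V \<omega> x y} \<in> sets P" by simp
  let ?S = "\<lambda>p. ({C \<in> Pow V. fst p \<in> C} \<inter> {C \<in> Pow V. snd p \<in> C})
      \<times> {\<omega> \<in> Pow E. separates V \<omega> (fst p) (snd p)}"
  have "(\<Union>p\<in>?I. ?S p) \<in> sets (subset_space V \<Otimes>\<^sub>M subset_space E)"
  proof (rule sets.countable_UN'[OF cnt])
    have "?S p \<in> sets (subset_space V \<Otimes>\<^sub>M subset_space E)" if p: "p \<in> ?I" for p
    proof (rule pair_measureI)
      show "{C \<in> Pow V. fst p \<in> C} \<inter> {C \<in> Pow V. snd p \<in> C} \<in> sets (subset_space V)"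
        using p by (intro sets.Int subset_space_Basic) auto
      show "{\<omega> \<in> Pow E. separates V \<omega> (fst p) (snd p)} \<in> sets (subset_space E)"
        using m[OF p] P by (simp add: bond_percolation_def)
    qed
    then show "?S ` ?I \<subseteq> sets (subset_space V \<Otimes>\<^sub>M subset_space E)" by (rule image_subsetI)
  qed
  moreover have "(\<Union>p\<in>?I. ?S p) = separated_pairs"
  proof
    show "(\<Union>p\<in>?I. ?S p) \<subseteq> separated_pairs" by (auto simp: separated_pairs_def)
    show "separated_pairs \<subseteq> (\<Union>p\<in>?I. ?S p)"
    proof
      fix p assume "p \<in> separated_pairs"
      then obtain C \<omega> x y where p: "p = (C, \<omega>)" "C \<subseteq> V" "\<omega> \<subseteq> E" "x \<in> C" "y \<in> C" "separates V \<omega> x y"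
        by (auto simp: separated_pairs_def)
      then have "(x, y) \<in> ?I" using separates_vertices[OF p(3,6)] by simp
      moreover have "p \<in> ?S (x, y)" using p by simp
      ultimately show "p \<in> (\<Union>p\<in>?I. ?S p)" by (rule UN_I)
    qed
  qed
  ultimately show "separated_pairs \<in> sets (subset_space V \<Otimes>\<^sub>M subset_space E)" by simp
qed

end

section \<open>Percolation of large marginals\<close>

theorem theorem5p7:
  fixes V :: "'a set" and E :: "'a set set" and \<Gamma> :: "('a \<Rightarrow> 'a) set"
  assumes "clf_graph V E"
    and "closed_aut_subgroup V E \<Gamma>"
    and "transitive_on V \<Gamma>"
    and "unimodular V E \<Gamma>"
    and "(V, E) \<notin> O_HD"
  shows "\<exists>p0::real. p0 < 1 \<and>
    (\<forall>P. invariant_percolation E \<Gamma> P \<and> (INF e\<in>E. \<P>(\<omega> in P. e \<in> \<omega>)) > p0 \<longrightarrow>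
       \<P>(\<omega> in P. \<exists>C\<in>graph_components V \<omega>. component_graph \<omega> C \<notin> O_HD) > 0 \<and>
       (ergodic_percolation \<Gamma> P \<and> indistinguishable_components V E \<Gamma> P \<longrightarrow>
          (AE \<omega> in P. \<forall>C\<in>graph_components V \<omega>. infinite C \<longrightarrow> component_graph \<omega> C \<notin> O_HD)))"
proof -
  interpret aut_action V E \<Gamma> by unfold_locales (fact assms)+
  obtain D where G: "bounded_degree_graph V E D" using bounded_degree[OF assms(3)] .
  interpret bounded_degree_graph V E D by (fact G)
  obtain a where a: "a \<in> V" using conn by (auto simp: connected_graph_def)
  have VC: "V \<in> graph_components V E"
  proof -
    have "graph_component E a \<in> graph_components V E" using a by (auto simp: graph_components_def)
    moreover from graph_component_subset[OF this] have "graph_component E a = V"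
      using conn a by (auto simp: connected_graph_def)
    ultimately show ?thesis by simp
  qed
  have "component_graph E V = (V, E)"
    using edge_cases by (force simp: component_graph_def)
  then obtain x y where xy: "x \<in> V" "y \<in> V" "separates V E x y"
    using component_not_O_HD_iff[OF VC] assms(5) by auto
  then obtain h where h: "finite_energy E h" "\<And>z. z \<in> V \<Longrightarrow> laplacian E h z = 0" "h x \<noteq> h y"
    and e: "{x, y} \<in> E" by (auto simp: separates_def)
  have inf: "infinite V" by (rule separates_imp_infinite_component[OF VC xy(1,3)])
  have "0 < (h x - h y)\<^sup>2" using h(3) by simp
  also have "\<dots> \<le> energy E h h" using sq_diff_le_energy[OF h(1) e] edgeD[OF e] by simp
  finally have pos: "0 < energy E h h" .
  \<comment> \<open>Positive because the edge \<open>{x, y}\<close> contributes.\<close>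
  define c where "c = (\<Sum>z\<in>nbrs E x. (h x - h z)\<^sup>2 / energy E h h)"
  have c: "0 < c"
    unfolding c_def
    by (rule sum_pos2[of _ y]) (use finite_nbrs[OF xy(1)] e h(3) pos in \<open>auto simp: nbrs_def\<close>)
  define p0 where "p0 = 2 / (2 + c)"
  have p0: "0 < p0" "p0 < 1" using c by (auto simp: p0_def)
  show ?thesis
  proof (intro exI[of _ p0] conjI allI impI p0)
    fix P assume "invariant_percolation E \<Gamma> P \<and> (INF e\<in>E. \<P>(\<omega> in P. e \<in> \<omega>)) > p0"
    then have P: "invariant_percolation E \<Gamma> P" and q: "(INF e\<in>E. \<P>(\<omega> in P. e \<in> \<omega>)) > p0" by auto
    have bp: "bond_percolation E P" using P by (simp add: invariant_percolation_def)
    interpret prob_space P using bp by (simp add: bond_percolation_def)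
    have sp: "space P = Pow E" by (rule percolation_space[OF bp])
    let ?B = "{\<omega> \<in> Pow E. \<exists>x y. separates V \<omega> x y}"
    note B = separating_event_measurable[OF G bp]
    have sub: "bounded_degree_graph V \<omega> D" if "\<omega> \<subseteq> E" for \<omega>
      by (rule bounded_degree_subgraph[OF G that])
    have comp: "(\<exists>C\<in>graph_components V \<omega>. component_graph \<omega> C \<notin> O_HD) \<longleftrightarrow> (\<exists>x y. separates V \<omega> x y)"
      if w: "\<omega> \<subseteq> E" for \<omega>
    proof
      assume "\<exists>C\<in>graph_components V \<omega>. component_graph \<omega> C \<notin> O_HD"
      then show "\<exists>x y. separates V \<omega> x y"
        using bounded_degree_graph.component_not_O_HD_iff[OF sub[OF w]] by blast
    next
      assume "\<exists>x y. separates V \<omega> x y"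
      then obtain x y where s: "separates V \<omega> x y" by blast
      have C: "graph_component \<omega> x \<in> graph_components V \<omega>"
        using separates_vertices[OF w s] by (auto simp: graph_components_def)
      have "x \<in> graph_component \<omega> x" by (simp add: graph_component_def)
      moreover have "{x, y} \<in> \<omega>" using s by (simp add: separates_def)
      ultimately have "y \<in> graph_component \<omega> x" using graph_component_closed[OF C] by blast
      then show "\<exists>C\<in>graph_components V \<omega>. component_graph \<omega> C \<notin> O_HD"
        using bounded_degree_graph.component_not_O_HD_iff[OF sub[OF w] C] C s
          \<open>x \<in> graph_component \<omega> x\<close> by blast
    qed
    have B_eq: "{\<omega> \<in> space P. \<exists>C\<in>graph_components V \<omega>. component_graph \<omega> C \<notin> O_HD} = ?B"
      unfolding sp by (intro Collect_cong conj_cong refl comp) simp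
    have B_pos: "measure P ?B > 0"
    proof (rule ccontr)
      assume "\<not> measure P ?B > 0"
      then have "measure P ?B = 0" using measure_nonneg[of P ?B] by linarith
      then have "AE \<omega> in P. \<omega> \<notin> ?B" using B(1) by (simp add: prob_eq_0)
      then have liou: "AE \<omega> in P. liouville V \<omega>"
        using AE_space by eventually_elim (auto simp: sp not_liouville_iff[symmetric])
      let ?q = "INF e\<in>E. \<P>(\<omega> in P. e \<in> \<omega>)"
      have "?q * (2 + c) \<le> 2"
        unfolding c_def
      proof (rule liouville_percolation_marginals[OF G assms(3,4) inf P liou h(1,2) pos xy(1)])
        show "0 \<le> ?q" using p0 q by linarith
        show "?q \<le> measure P {\<omega> \<in> space P. e \<in> \<omega>}" if "e \<in> E" for e
          using that by (intro cINF_lower) (auto intro!: bdd_belowI[of _ 0])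
      qed
      then have "?q \<le> p0" using c by (simp add: p0_def field_simps)
      with q show False by linarith
    qed
    then show "\<P>(\<omega> in P. \<exists>C\<in>graph_components V \<omega>. component_graph \<omega> C \<notin> O_HD) > 0"
      by (simp only: B_eq)
    assume "ergodic_percolation \<Gamma> P \<and> indistinguishable_components V E \<Gamma> P"
    then have erg: "ergodic_percolation \<Gamma> P" and ind: "indistinguishable_components V E \<Gamma> P" by auto
    have "\<forall>g\<in>\<Gamma>. act_edges g ` ?B = ?B"
      by (rule ballI) (rule separating_event_invariant)
    then have "measure P ?B = 0 \<or> measure P ?B = 1"
      by (rule mp[OF bspec[OF erg[unfolded ergodic_percolation_def] B(1)]])
    then have "measure P ?B = 1" using B_pos by simp
    then have "AE \<omega> in P. \<omega> \<in> ?B" by (simp only: AE_in_set_eq_1[OF B(1)])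
    moreover have "AE \<omega> in P. (\<forall>C\<in>graph_components V \<omega>. infinite C \<longrightarrow> (C, \<omega>) \<in> separated_pairs)
        \<or> (\<forall>C\<in>graph_components V \<omega>. infinite C \<longrightarrow> (C, \<omega>) \<notin> separated_pairs)"
      by (rule mp[OF bspec[OF ind[unfolded indistinguishable_components_def] B(2)]])
        (rule ballI, rule separated_pairs_invariant)
    ultimately show "AE \<omega> in P. \<forall>C\<in>graph_components V \<omega>. infinite C \<longrightarrow> component_graph \<omega> C \<notin> O_HD"
    proof eventually_elim
      fix \<omega> assume w: "\<omega> \<in> ?B"
        and alt: "(\<forall>C\<in>graph_components V \<omega>. infinite C \<longrightarrow> (C, \<omega>) \<in> separated_pairs)
          \<or> (\<forall>C\<in>graph_components V \<omega>. infinite C \<longrightarrow> (C, \<omega>) \<notin> separated_pairs)"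
      then have wE: "\<omega> \<subseteq> E" by simp
      interpret w: bounded_degree_graph V \<omega> D by (rule sub[OF wE])
      have pair: "(C, \<omega>) \<in> separated_pairs \<longleftrightarrow> component_graph \<omega> C \<notin> O_HD" if "C \<in> graph_components V \<omega>" for C
        using w.component_not_O_HD_iff[OF that] w.graph_component_subset[OF that] wE
        by (simp add: separated_pairs_def)
      obtain C where C: "C \<in> graph_components V \<omega>" "component_graph \<omega> C \<notin> O_HD"
        using comp[OF wE] w by auto
      obtain x y where "x \<in> C" "separates V \<omega> x y"
        using w.component_not_O_HD_iff[OF C(1)] C(2) by auto
      then have "infinite C" by (rule w.separates_imp_infinite_component[OF C(1)])
      with alt C pair[OF C(1)] have all: "\<forall>C\<in>graph_components V \<omega>. infinite C \<longrightarrow> (C, \<omega>) \<in> separated_pairs"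
        by auto
      show "\<forall>C\<in>graph_components V \<omega>. infinite C \<longrightarrow> component_graph \<omega> C \<notin> O_HD"
      proof (intro ballI impI)
        fix C assume "C \<in> graph_components V \<omega>" "infinite C"
        then show "component_graph \<omega> C \<notin> O_HD" using all pair[of C] by simp
      qed
    qed
  qed
qed

end
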